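(* Let $m\in\mathbb{N}_0$ be such that $(m)_q^!\,b_m\ne0$. Then the multiplicity of $m\alpha_1+2\alpha_2$ (for $\mathcal{B}(V)$) is $$m'-\big|\mathbb{J}\cap[0,m]\big|,$$ where $$m'=\begin{cases}(m+1)/2&\text{if $m$ is odd,}\\ m/2&\text{if $m$ is even and $q^{m^2/4}r^{m/2}s\ne-1$,}\\ m/2+1&\text{if $m$ is even and $q^{m^2/4}r^{m/2}s=-1$.}\end{cases}$$
   Context: Let $\Bbbk$ be a field of characteristic $p$ ($p$ a prime or $0$), $\mathbb{N}_0=\{0,1,2,\dots\}$. Let $(V,c)$ be a two-dimensional braided vector space of diagonal type: $V$ has basis $x_1,x_2$ and $c(x_i\otimes x_j)=q_{ij}x_j\otimes x_i$ with $q_{ij}\in\Bbbk^\times$. Put $q=q_{11}$, $r=q_{12}q_{21}$, $s=q_{22}$. Let $\alpha_1,\alpha_2$ be the standard basis of $\mathbb{Z}^2$ and $\chi$ the bicharacter of $\mathbb{Z}^2$ with $\chi(\alpha_i,\alpha_j)=q_{ij}$. The tensor algebra $T(V)$ and the Nichols algebra $\mathcal{B}(V)$ are $\mathbb{Z}^2$-graded with $\deg x_i=\alpha_i$. Elements of $T(V)$ are also viewed in $\mathcal{B}(V)$ via the canonical map $\pi:T(V)\to\mathcal{B}(V)$. Notation: $(k)_t=1+t+\cdots+t^{k-1}$, $(k)_t^!=\prod_{i=1}^k(i)_t$, $b_k=\prod_{i=0}^{k-1}(1-q^ir)$. The set $\mathbb{J}=\mathbb{J}^p_{q,r,s}\subseteq\mathbb{N}_0$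 is defined recursively: $j\in\mathbb{J}$ iff $q^{j(j-1)/2}(-r)^js=-1$ and for every $n\in\mathbb{J}$ with $n<j$ one has $\left(\frac{j-n}{2}\right)_{q^{n+j-1}r^2}=0$ if $j-n$ is even, and $(j-n)_{-q^{(n+j-1)/2}r}=0$ if $j-n$ is odd (equalities in $\Bbbk$). Multiplicities. Words are in the letters $x_1<x_2$, compared by the lexicographic order $<_{\mathrm{lex}}$ (a proper prefix of a word is smaller than the word). A non-empty word $w$ is Lyndon if $w<_{\mathrm{lex}}v$ for every decomposition $w=uv$ with $u,v$ non-empty. The Shirshov decomposition of a Lyndon word $w$ with $|w|\ge2$ is $w=uv$ with $u,v$ Lyndon and $|u|$ minimal. For Lyndon $w$ the super-letter $[w]\in T(V)$ is defined by $[w]=w$ if $|w|=1$, and $[w]=[u][v]-\chi(\deg u,\deg v)[v][u]$ if $|w|\ge2$ has Shirshov decomposition $w=uv$; for Lyndon $w$ and $k\ge2$, $[w^k]=[w]^k$. For $\alpha\in\mathbb{Z}^2$ let $o_\alpha\in\mathbb{N}\cup\{\infty\}$ be the multiplicative order of $\chi(\alpha,\alpha)$; let $O_\alpha=\{1,o_\alpha,\infty\}$ if $o_\alpha=\infty$ or $p=0$, and $O_\alpha=\{1,o_\alpha p^k,\infty\mid k\in\mathbb{N}_0\}$ if $o_\alpha<\infty$ and $p>0$. For a non-empty word $w$, $[w]$ is a root vector candidate if $w=v^k$ for some Lyndon word $v$ and some $k\in O_{\deg v}\setminus\{\infty\}$. A root vector candidate $[w]$ is a root vector (of $\mathcal{B}(V)$)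 if $[w]\in\mathcal{B}(V)$ is not a linear combination of elements of the form $[v_k]^{m_k}\cdots[v_1]^{m_1}$, where $k\in\mathbb{N}_0$, the $m_i$ are positive integers, and $[v_1],\dots,[v_k]$ are root vector candidates with $w<_{\mathrm{lex}}v_1<_{\mathrm{lex}}\cdots<_{\mathrm{lex}}v_k$. The multiplicity of $\alpha\in\mathbb{N}_0^2$ is the number of words $w$ with $\deg w=\alpha$ such that $[w]$ is a root vector (it is $0$ if $\alpha$ is not a root). *)

theory Defs
  imports "HOL-Library.Poly_Mapping" "HOL-Library.Product_Plus" "HOL-Library.Extended_Nat"
begin

datatype letter = X1 | X2

type_synonym word = "letter list"

text \<open>Concatenation makes words an additively written, non-commutative monoid, so that the
  convolution product on finitely supported functions \<^typ>\<open>word \<Rightarrow>\<^sub>0 'k\<close> is the product of the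
  free algebra on the two letters, that is, of \<open>T(V)\<close> with basis \<open>x\<^sub>1, x\<^sub>2\<close> of \<open>V\<close>.\<close>

instantiation list :: (type) monoid_add
begin
definition zero_list :: "'a list" where "zero_list = []"
definition plus_list :: "'a list \<Rightarrow> 'a list \<Rightarrow> 'a list" where "plus_list u v = u @ v"
instance by standard (simp_all add: zero_list_def plus_list_def)
end

type_synonym 'k tensor_alg = "word \<Rightarrow>\<^sub>0 'k"

text \<open>The basis of \<open>T(V) \<otimes> T(V)\<close> consists of the tensors \<open>u \<otimes> v\<close> of two words. Of this type only
  the vector space structure is used; the braided product is \<open>braided_mult\<close> below.\<close>

type_synonym 'k tensor_sq = "(word \<times> word) \<Rightarrow>\<^sub>0 'k"

definition scale :: "'k::field \<Rightarrow> ('a \<Rightarrow>\<^sub>0 'k) \<Rightarrow> ('a \<Rightarrow>\<^sub>0 'k)" where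
  "scale c a = Poly_Mapping.map ((*) c) a"

lemma lookup_scale [simp]: "Poly_Mapping.lookup (scale c a) w = c * Poly_Mapping.lookup a w"
  by (simp add: scale_def map.rep_eq when_def)

global_interpretation pm: vector_space "scale :: 'k::field \<Rightarrow> ('a \<Rightarrow>\<^sub>0 'k) \<Rightarrow> ('a \<Rightarrow>\<^sub>0 'k)"
  by standard (rule poly_mapping_eqI, simp add: Poly_Mapping.lookup_add algebra_simps)+

text \<open>A braiding matrix is a function \<open>Q\<close> with \<open>Q X\<^sub>i X\<^sub>j = q\<^sub>i\<^sub>j\<close>; the element
  \<open>a \<alpha>\<^sub>1 + b \<alpha>\<^sub>2\<close> of the grading group is the pair \<open>(a, b)\<close>.\<close>

fun deg :: "word \<Rightarrow> int \<times> int" where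
  "deg [] = 0"
| "deg (X1 # w) = (1, 0) + deg w"
| "deg (X2 # w) = (0, 1) + deg w"

definition bichar :: "(letter \<Rightarrow> letter \<Rightarrow> 'k::field) \<Rightarrow> int \<times> int \<Rightarrow> int \<times> int \<Rightarrow> 'k" where
  "bichar Q \<alpha> \<beta> =
     Q X1 X1 powi (fst \<alpha> * fst \<beta>) * Q X1 X2 powi (fst \<alpha> * snd \<beta>) *
     Q X2 X1 powi (snd \<alpha> * fst \<beta>) * Q X2 X2 powi (snd \<alpha> * snd \<beta>)"

definition tensor :: "'k::field tensor_alg \<Rightarrow> 'k tensor_alg \<Rightarrow> 'k tensor_sq" where
  "tensor a b =
     (\<Sum>u\<in>Poly_Mapping.keys a. \<Sum>v\<in>Poly_Mapping.keys b.
        Poly_Mapping.single (u, v) (Poly_Mapping.lookup a u * Poly_Mapping.lookup b v))"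

text \<open>\<open>(a \<otimes> b) (a' \<otimes> b') = a c(b \<otimes> a') b'\<close>, where \<open>c(v \<otimes> u') = \<chi>(deg v, deg u') u' \<otimes> v\<close>.\<close>

definition braided_mult ::
    "(letter \<Rightarrow> letter \<Rightarrow> 'k::field) \<Rightarrow> 'k tensor_sq \<Rightarrow> 'k tensor_sq \<Rightarrow> 'k tensor_sq" where
  "braided_mult Q s t =
     (\<Sum>(u, v)\<in>Poly_Mapping.keys s. \<Sum>(u', v')\<in>Poly_Mapping.keys t.
        Poly_Mapping.single (u @ u', v @ v')
          (Poly_Mapping.lookup s (u, v) * Poly_Mapping.lookup t (u', v') *
             bichar Q (deg v) (deg u')))"

text \<open>The coproduct is the algebra map \<open>T(V) \<rightarrow> T(V) \<otimes> T(V)\<close> (braided product on the right) with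
  \<open>x \<mapsto> x \<otimes> 1 + 1 \<otimes> x\<close> for each letter \<open>x\<close>.\<close>

fun coprod_word :: "(letter \<Rightarrow> letter \<Rightarrow> 'k::field) \<Rightarrow> word \<Rightarrow> 'k tensor_sq" where
  "coprod_word Q [] = Poly_Mapping.single ([], []) 1"
| "coprod_word Q (x # w) =
     braided_mult Q (Poly_Mapping.single ([x], []) 1 + Poly_Mapping.single ([], [x]) 1)
       (coprod_word Q w)"

definition coprod :: "(letter \<Rightarrow> letter \<Rightarrow> 'k::field) \<Rightarrow> 'k tensor_alg \<Rightarrow> 'k tensor_sq" where
  "coprod Q a = (\<Sum>w\<in>Poly_Mapping.keys a. scale (Poly_Mapping.lookup a w) (coprod_word Q w))"

text \<open>The counit maps an element to its coefficient at the empty word.\<close>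

definition coideal :: "(letter \<Rightarrow> letter \<Rightarrow> 'k::field) \<Rightarrow> 'k tensor_alg set \<Rightarrow> bool" where
  "coideal Q J \<longleftrightarrow> pm.subspace J \<and> (\<forall>a\<in>J. Poly_Mapping.lookup a [] = 0) \<and>
     (\<forall>a\<in>J. coprod Q a \<in> pm.span {tensor b c | b c. b \<in> J \<or> c \<in> J})"

text \<open>The Nichols algebra is \<open>\<B>(V) = T(V) / \<I>(V)\<close>, where \<open>\<I>(V)\<close> is the largest coideal (that is, the
  sum of all coideals) contained in the part of \<open>T(V)\<close> of tensor degree at least 2. It is represented
  by \<open>T(V)\<close> modulo this subspace: an equation in \<open>\<B>(V)\<close> is a congruence modulo
  \<open>nichols_ideal Q\<close>.\<close>

definition nichols_ideal :: "(letter \<Rightarrow> letter \<Rightarrow> 'k::field) \<Rightarrow> 'k tensor_alg set" where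
  "nichols_ideal Q =
     pm.span (\<Union>{J. coideal Q J \<and> (\<forall>a\<in>J. \<forall>w\<in>Poly_Mapping.keys a. 2 \<le> length w)})"

text \<open>The image of \<open>a\<close> in \<open>\<B>(V)\<close> is a linear combination of the images of the elements of \<open>S\<close>.\<close>

definition nichols_lin_comb ::
    "(letter \<Rightarrow> letter \<Rightarrow> 'k::field) \<Rightarrow> 'k tensor_alg set \<Rightarrow> 'k tensor_alg \<Rightarrow> bool" where
  "nichols_lin_comb Q S a \<longleftrightarrow> (\<exists>b\<in>pm.span S. a - b \<in> nichols_ideal Q)"

definition lex_less :: "word \<Rightarrow> word \<Rightarrow> bool" (infix \<open><\<^sub>l\<^sub>e\<^sub>x\<close> 50) where
  "u <\<^sub>l\<^sub>e\<^sub>x v \<longleftrightarrow> (u, v) \<in> lexord {(X1, X2)}"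

definition lyndon :: "word \<Rightarrow> bool" where
  "lyndon w \<longleftrightarrow> w \<noteq> [] \<and> (\<forall>u v. w = u @ v \<and> u \<noteq> [] \<and> v \<noteq> [] \<longrightarrow> w <\<^sub>l\<^sub>e\<^sub>x v)"

text \<open>Splitting \<open>w\<close> after its first \<open>n\<close> letters gives two Lyndon words. The Shirshov decomposition of
  a Lyndon word is the split with the least such \<open>n\<close>.\<close>

definition lyndon_split :: "word \<Rightarrow> nat \<Rightarrow> bool" where
  "lyndon_split w n \<longleftrightarrow> 0 < n \<and> n < length w \<and> lyndon (take n w) \<and> lyndon (drop n w)"

definition shirshov_left :: "word \<Rightarrow> word" where
  "shirshov_left w = take (LEAST n. lyndon_split w n) w"

definition shirshov_right :: "word \<Rightarrow> word" where
  "shirshov_right w = drop (LEAST n. lyndon_split w n) w"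

lemma length_shirshov:
  assumes "\<exists>n. lyndon_split w n"
  shows "length (shirshov_left w) < length w" "length (shirshov_right w) < length w"
  using LeastI_ex[OF assms]
  by (auto simp: shirshov_left_def shirshov_right_def lyndon_split_def)

text \<open>Every Lyndon word of length at least 2 has a split into two Lyndon words, so that for Lyndon
  words the second case is that of a single letter.\<close>

function super_letter :: "(letter \<Rightarrow> letter \<Rightarrow> 'k::field) \<Rightarrow> word \<Rightarrow> 'k tensor_alg" where
  "super_letter Q w =
     (if \<exists>n. lyndon_split w n then
        super_letter Q (shirshov_left w) * super_letter Q (shirshov_right w) -
        scale (bichar Q (deg (shirshov_left w)) (deg (shirshov_right w)))
          (super_letter Q (shirshov_right w) * super_letter Q (shirshov_left w))
      else Poly_Mapping.single w 1)"
  by auto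
termination
  by (relation "measure (\<lambda>(Q, w). length w)") (auto intro: length_shirshov)

declare super_letter.simps [simp del]

definition word_power :: "word \<Rightarrow> nat \<Rightarrow> word" where
  "word_power v k = concat (replicate k v)"

text \<open>\<open>[v\<^sup>k] = [v]\<^sup>k\<close> for Lyndon \<open>v\<close> and \<open>k \<ge> 1\<close>, see \<open>bracket_word_power\<close> below;
  other words are irrelevant.\<close>

definition bracket :: "(letter \<Rightarrow> letter \<Rightarrow> 'k::field) \<Rightarrow> word \<Rightarrow> 'k tensor_alg" where
  "bracket Q w = (THE a. \<exists>v k. lyndon v \<and> 1 \<le> k \<and> w = word_power v k \<and> a = super_letter Q v ^ k)"

definition mult_order :: "'k::field \<Rightarrow> enat" where
  "mult_order x = (if \<exists>n>0. x ^ n = 1 then enat (LEAST n. 0 < n \<and> x ^ n = 1) else \<infinity>)"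

definition root_orders :: "(letter \<Rightarrow> letter \<Rightarrow> 'k::field) \<Rightarrow> int \<times> int \<Rightarrow> enat set" where
  "root_orders Q \<alpha> =
     (let n = mult_order (bichar Q \<alpha> \<alpha>) in
      if n = \<infinity> \<or> CHAR('k) = 0 then {1, n, \<infinity>}
      else {1, \<infinity>} \<union> {n * enat (CHAR('k) ^ k) | k. True})"

definition root_vector_candidate :: "(letter \<Rightarrow> letter \<Rightarrow> 'k::field) \<Rightarrow> word \<Rightarrow> bool" where
  "root_vector_candidate Q w \<longleftrightarrow>
     w \<noteq> [] \<and> (\<exists>v k. lyndon v \<and> enat k \<in> root_orders Q (deg v) \<and> w = word_power v k)"

text \<open>The list \<open>[(v\<^sub>1, m\<^sub>1), \<dots>, (v\<^sub>k, m\<^sub>k)]\<close> stands for the product \<open>[v\<^sub>k]\<^bsup>m\<^sub>k\<^esup> \<cdots> [v\<^sub>1]\<^bsup>m\<^sub>1\<^esup>\<close>.\<close>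

definition larger_products :: "(letter \<Rightarrow> letter \<Rightarrow> 'k::field) \<Rightarrow> word \<Rightarrow> 'k tensor_alg set" where
  "larger_products Q w =
     {prod_list (rev (map (\<lambda>(v, m). bracket Q v ^ m) vms)) | vms :: (word \<times> nat) list.
        (\<forall>(v, m)\<in>set vms. root_vector_candidate Q v \<and> 0 < m) \<and>
        sorted_wrt (<\<^sub>l\<^sub>e\<^sub>x) (w # map fst vms)}"

definition root_vector :: "(letter \<Rightarrow> letter \<Rightarrow> 'k::field) \<Rightarrow> word \<Rightarrow> bool" where
  "root_vector Q w \<longleftrightarrow>
     root_vector_candidate Q w \<and> \<not> nichols_lin_comb Q (larger_products Q w) (bracket Q w)"

definition multiplicity :: "(letter \<Rightarrow> letter \<Rightarrow> 'k::field) \<Rightarrow> int \<times> int \<Rightarrow> nat" where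
  "multiplicity Q \<alpha> = card {w. deg w = \<alpha> \<and> root_vector Q w}"

definition qnum :: "nat \<Rightarrow> 'k::field \<Rightarrow> 'k" where
  "qnum k t = (\<Sum>i<k. t ^ i)"

definition qfact :: "nat \<Rightarrow> 'k::field \<Rightarrow> 'k" where
  "qfact k t = (\<Prod>i=1..k. qnum i t)"

definition bprod :: "'k::field \<Rightarrow> 'k \<Rightarrow> nat \<Rightarrow> 'k" where
  "bprod q r k = (\<Prod>i<k. 1 - q ^ i * r)"

text \<open>All divisions by 2 below are exact, and \<open>n + j - 1\<close> is never truncated since \<open>n < j\<close>.\<close>

fun in_J :: "'k::field \<Rightarrow> 'k \<Rightarrow> 'k \<Rightarrow> nat \<Rightarrow> bool" where
  "in_J q r s j \<longleftrightarrow>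
     q ^ (j * (j - 1) div 2) * (- r) ^ j * s = -1 \<and>
     (\<forall>n\<in>{..<j}. in_J q r s n \<longrightarrow>
        (if even (j - n) then qnum ((j - n) div 2) (q ^ (n + j - 1) * r\<^sup>2) = 0
         else qnum (j - n) (- (q ^ ((n + j - 1) div 2) * r)) = 0))"

declare in_J.simps [simp del]

definition J_set :: "'k::field \<Rightarrow> 'k \<Rightarrow> 'k \<Rightarrow> nat set" where
  "J_set q r s = {j. in_J q r s j}"

lemma lyndon_not_power:
  assumes "lyndon (word_power z m)"
  shows "m = 1"
proof (rule ccontr)
  assume m: "m \<noteq> 1"
  have ne: "word_power z m \<noteq> []" using assms by (simp add: lyndon_def)
  then have z: "z \<noteq> []" and m0: "m \<noteq> 0" by (auto simp: word_power_def)
  with m obtain k where k: "m = Suc (Suc k)" by (metis One_nat_def not0_implies_Suc)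
  have d: "word_power z m = z @ word_power z (Suc k)" by (simp add: word_power_def k)
  have d': "word_power z m = word_power z (Suc k) @ z"
    unfolding k word_power_def
    by (metis append_Nil2 concat.simps concat_append replicate_Suc replicate_append_same)
  have ne': "word_power z (Suc k) \<noteq> []" using z by (simp add: word_power_def)
  have "word_power z m <\<^sub>l\<^sub>e\<^sub>x word_power z (Suc k)"
    using assms d z ne' unfolding lyndon_def by blast
  moreover have "word_power z (Suc k) <\<^sub>l\<^sub>e\<^sub>x word_power z m"
    unfolding d' lex_less_def by (rule lexord_append_rightI) (use z in \<open>cases z; auto\<close>)
  ultimately show False unfolding lex_less_def
    using lexord_asymmetric[of "{(X1, X2)}"] by (auto simp: asym_iff)
qed

lemma length_word_power: "length (word_power v k) = k * length v"
  by (induction k) (simp_all add: word_power_def)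

lemma prefix_word_power:
  assumes "u \<noteq> []" "p @ t = word_power u k"
  shows "\<exists>i u'. p = word_power u i @ u' \<and> length u' < length u \<and> take (length u') u = u'"
  using assms(2)
proof (induction k arbitrary: p)
  case 0
  then show ?case using assms(1)
    by (intro exI[of _ 0] exI[of _ "[]"]) (simp add: word_power_def)
next
  case (Suc k)
  have e: "p @ t = u @ word_power u k" using Suc.prems by (simp add: word_power_def)
  show ?case
  proof (cases "length p < length u")
    case True
    then have "take (length p) u = p" using e by (auto simp: append_eq_append_conv_if)
    with True show ?thesis
      by (intro exI[of _ 0] exI[of _ p]) (simp add: word_power_def)
  next
    case False
    then obtain p' where p': "p = u @ p'" "p' @ t = word_power u k"
      using e by (auto simp: append_eq_append_conv2)
    from Suc.IH[OF p'(2)] obtain i u' where i: "p' = word_power u i @ u'"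
      "length u' < length u" "take (length u') u = u'" by blast
    have "p = word_power u (Suc i) @ u'" using p'(1) i(1) by (simp add: word_power_def)
    with i(2,3) show ?thesis by blast
  qed
qed

lemma lyndon_prefix_power:
  assumes "lyndon u" "lyndon v" "v @ t = word_power u k" "length u \<le> length v"
  shows "u = v"
proof -
  have u: "u \<noteq> []" using assms(1) by (simp add: lyndon_def)
  obtain i u' where i: "v = word_power u i @ u'" "length u' < length u" "take (length u') u = u'"
    using prefix_word_power[OF u assms(3)] by blast
  have i0: "i \<noteq> 0" using i(1,2) assms(4) by (cases i) (auto simp: word_power_def)
  then obtain i' where i': "word_power u i = u @ word_power u i'"
    by (cases i) (auto simp: word_power_def)
  show ?thesis
  proof (cases "u' = []")
    case True
    with i(1) have "v = word_power u i" by simp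
    moreover from this have "i = 1" using assms(2) lyndon_not_power by blast
    ultimately show ?thesis by (simp add: word_power_def)
  next
    case False
    then have "v <\<^sub>l\<^sub>e\<^sub>x u'" using assms(2) i(1) i' u unfolding lyndon_def by (metis append_is_Nil_conv)
    moreover have "v = u' @ drop (length u') u @ word_power u i' @ u'"
      using i(1,3) i' by (metis append.assoc append_take_drop_id)
    then have "u' <\<^sub>l\<^sub>e\<^sub>x v" unfolding lex_less_def
      using i(2) lexord_append_rightI[of "drop (length u') u @ word_power u i' @ u'" u']
      by (cases "drop (length u') u") auto
    ultimately show ?thesis unfolding lex_less_def
      using lexord_asymmetric[of "{(X1, X2)}"] by (auto simp: asym_iff)
  qed
qed

lemma lyndon_power_unique:
  assumes "lyndon u" "lyndon v" "1 \<le> k" "1 \<le> l" "word_power u k = word_power v l"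
  shows "u = v \<and> k = l"
proof -
  obtain k' l' where kl: "k = Suc k'" "l = Suc l'" using assms(3,4) by (metis Suc_le_D One_nat_def)
  have a: "v @ word_power v l' = word_power u k" "u @ word_power u k' = word_power v l"
    using assms(5) by (simp_all add: kl word_power_def)
  have eq: "u = v"
    using lyndon_prefix_power[OF assms(1,2) a(1)] lyndon_prefix_power[OF assms(2,1) a(2)] by force
  have "k * length u = l * length u"
    using arg_cong[OF assms(5), of length] eq by (simp add: length_word_power)
  moreover have "length u \<noteq> 0" using assms(1) by (simp add: lyndon_def)
  ultimately show ?thesis using eq by simp
qed

lemma bracket_word_power:
  assumes "lyndon v" "1 \<le> k"
  shows "bracket Q (word_power v k) = super_letter Q v ^ k"
  unfolding bracket_def
  by (rule the_equality) (use assms lyndon_power_unique in blast)+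

end

theory Submission
  imports "HOL-Computational_Algebra.Polynomial" "HOL-Library.Function_Algebras" Defs
begin

text \<open>
Write \<open>u\<^sub>i\<close> for the super-letter of \<open>x\<^sub>1\<^sup>ix\<^sub>2\<close>, which is \<open>(ad x\<^sub>1)\<^sup>i(x\<^sub>2)\<close>. The root vector candidates of degree
\<open>m\<alpha>\<^sub>1 + 2\<alpha>\<^sub>2\<close> are the words \<open>w\<^sub>a = x\<^sub>1\<^sup>ax\<^sub>2x\<^sub>1\<^sup>bx\<^sub>2\<close> with \<open>a + b = m\<close> and \<open>b < a\<close>, and in addition the square with
\<open>a = b = m/2\<close> if \<open>q\<^bsup>aa\<^esup>r\<^sup>as = -1\<close>. Their number is \<open>m'\<close>, so the claim is that exactly \<open>|J \<inter> [0,m]|\<close> of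
them are not root vectors.

\<^emph>\<open>From words to relations.\<close> In degree \<open>m\<alpha>\<^sub>1 + 2\<alpha>\<^sub>2\<close> everything takes place in the span of the products
\<open>u\<^sub>iu\<^bsub>m-i\<^esub>\<close>: the bracket of \<open>w\<^sub>a\<close> is \<open>u\<^sub>au\<^sub>b + \<kappa>u\<^sub>bu\<^sub>a\<close> plus a combination of the \<open>u\<^sub>iu\<^bsub>m-i\<^esub>\<close> with \<open>b < i < a\<close>, and
the latter span the same space as the products of larger candidates. On the other hand, in a relation
\<open>\<Sum> f\<^sub>i u\<^sub>iu\<^bsub>m-i\<^esub> = 0\<close> in the Nichols algebra whose coefficients vanish outside \<open>[b,a]\<close>, the two extreme
coefficients always satisfy \<open>f\<^sub>b = \<kappa>f\<^sub>a\<close> (lemma \<open>relation_ends\<close>). Hence \<open>w\<^sub>a\<close> fails to be a root vector if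
and only if \<open>a\<close> is the largest index occurring in some relation, and these indices \<open>a \<ge> m/2\<close> are as many
as the dimension of the space of relations (\<open>lin_comb_iff_leading\<close>, \<open>dim_relations_leading\<close>).

\<^emph>\<open>Relations as a kernel.\<close> The Nichols ideal is closed under the right skew derivations \<open>D\<^sub>1, D\<^sub>2\<close>, and the
elements without constant term killed by both form a coideal. All \<open>u\<^sub>iu\<^bsub>m-i\<^esub>\<close> are killed by \<open>D\<^sub>1\<close>, and
\<open>D\<^sub>2\<close> maps them to the span of the \<open>u\<^sub>ix\<^sub>1\<^bsup>m-i\<^esup>\<close>, which are linearly independent in the Nichols algebra because
\<open>(m)\<^sub>q!b\<^sub>m \<noteq> 0\<close>. So the relations are the kernel of \<open>D\<^sub>2\<close>, which amounts to the kernel of \<open>1 + c\<close> for the braiding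
\<open>c\<close> of the \<open>u\<^sub>i\<close>. In the basis \<open>(ad x\<^sub>1)\<^bsup>m-j\<^esup>(x\<^sub>2u\<^sub>j)\<close> the map \<open>c\<close> becomes, up to rescaling, the upper
triangular matrix \<open>C\<^sub>n\<^sub>j = \<epsilon>\<^sub>n/(j-n)\<^sub>q!\<close> with \<open>\<epsilon>\<^sub>n = q\<^bsup>n(n-1)/2\<^esup>(-r)\<^sup>ns\<close>, the same for all \<open>m\<close>
(\<open>relation_iff\<close>). The dimension of its kernel is the number of \<open>j \<le> m\<close> such that some kernel vector has
its last nonzero entry in place \<open>j\<close>, and it remains to see that these \<open>j\<close> form \<open>J \<inter> [0,m]\<close>.

\<^emph>\<open>The kernel of \<open>1 + C\<close>.\<close> A necessary condition is \<open>\<epsilon>\<^sub>j = -1\<close>. The matrix \<open>C\<close> commutes with an upper bidiagonal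
matrix \<open>A\<close> with nonzero superdiagonal, whose diagonal entries \<open>n\<close> and \<open>j\<close> agree if and only if
\<open>q\<^bsup>n+j-1\<^esup>r\<^sup>2 = 1\<close>. If no \<open>n < j\<close> is linked to \<open>j\<close> in this way, then the eigenvector of \<open>A\<close> with last entry in
place \<open>j\<close> is also one of \<open>C\<close>, and the equations in the definition of \<open>J\<close> hold by a geometric sum. If
\<open>q \<noteq> 1\<close>, there is at most one linked \<open>n\<close>. It satisfies \<open>\<epsilon>\<^sub>n = \<epsilon>\<^sub>j\<close>, and \<open>1 + C\<close> maps the generalised
eigenvector of \<open>A\<close> to a multiple of the eigenvector. The multiple is a terminating hypergeometric sum, which
\<open>q_vandermonde\<close> identifies, up to a nonzero factor, with the \<open>q\<close>-number in the definition of \<open>J\<close>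
(\<open>linked_kernel_vector\<close>). If \<open>q = 1\<close> and some \<open>n < j\<close> is linked to \<open>j\<close>, then \<open>r = -1\<close> and \<open>C\<close> is the scalar
\<open>s\<close> times a unipotent Jordan block, so that only \<open>j = 0\<close> can occur.
\<close>

section \<open>A q-Vandermonde sum\<close>

text \<open>The Gaussian binomial coefficients, defined by a Pascal rule so that they exist in every
commutative ring; below they are used over polynomials.\<close>

fun qbin :: "'a::comm_ring_1 \<Rightarrow> nat \<Rightarrow> nat \<Rightarrow> 'a" where
  "qbin q k 0 = 1"
| "qbin q 0 (Suc t) = 0"
| "qbin q (Suc k) (Suc t) = qbin q k (Suc t) + q ^ (k - t) * qbin q k t"

lemma qbin_eq_0: "k < t \<Longrightarrow> qbin q k t = 0"
proof (induction k arbitrary: t)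
  case 0
  then show ?case by (cases t) auto
next
  case (Suc k)
  then show ?case by (cases t) auto
qed

lemma Suc_choose_two: "Suc t choose 2 = t + (t choose 2)"
  by (simp add: numeral_2_eq_2)

text \<open>Pascal's rule splits the sum for \<open>k + 1\<close> into the sum for \<open>k\<close>
at \<open>(qa, qb)\<close>, times \<open>1 - b\<close>, and the sum for \<open>k\<close> at
\<open>(a, b)\<close>, times \<open>-q\<^sup>k(1 - q\<^sup>ka)\<close>.\<close>

lemma q_vandermonde:
  fixes q a b :: "'a::comm_ring_1"
  shows "(\<Sum>t\<le>k. (-1) ^ t * q ^ (t choose 2) * qbin q k t *
      ((\<Prod>i=k-t..<k. 1 - q ^ i * a) * (\<Prod>i<k-t. 1 - q ^ i * b))) =
    (\<Prod>i<k. q ^ (k - 1) * a - q ^ i * b)"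
proof (induction k arbitrary: a b)
  case 0
  show ?case by (simp add: numeral_2_eq_2)
next
  case (Suc k)
  define F where "F a b = (\<Sum>t\<le>k. (-1) ^ t * q ^ (t choose 2) * qbin q k t *
      ((\<Prod>i=k-t..<k. 1 - q ^ i * a) * (\<Prod>i<k-t. 1 - q ^ i * b)))" for a b :: 'a
  define R where "R = (\<Prod>i<k. q ^ (k - 1) * a - q ^ i * b)"
  define P where "P t = (\<Prod>i=Suc k-t..<Suc k. 1 - q ^ i * a) * (\<Prod>i<Suc k-t. 1 - q ^ i * b)" for t
  define A where "A t = (-1) ^ t * q ^ (t choose 2) * qbin q k t * P t" for t
  define B where "B t = (case t of 0 \<Rightarrow> 0 | Suc u \<Rightarrow>
    (-1) ^ t * q ^ (t choose 2) * (q ^ (k - u) * qbin q k u) * P t)" for t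
  have split: "(-1) ^ t * q ^ (t choose 2) * qbin q (Suc k) t * P t = A t + B t" for t
    by (cases t) (simp_all add: A_def B_def algebra_simps)
  have "(\<Sum>t\<le>Suc k. A t) = (\<Sum>t\<le>k. A t)"
    by (simp add: A_def qbin_eq_0)
  also have "\<dots> = (\<Sum>t\<le>k. (1 - b) * ((-1) ^ t * q ^ (t choose 2) * qbin q k t *
      ((\<Prod>i=k-t..<k. 1 - q ^ i * (q * a)) * (\<Prod>i<k-t. 1 - q ^ i * (q * b)))))"
  proof (rule sum.cong[OF refl])
    fix t assume "t \<in> {..k}"
    then have s: "Suc k - t = Suc (k - t)" by auto
    have "P t = (\<Prod>i=k-t..<k. 1 - q ^ i * (q * a)) * ((1 - b) * (\<Prod>i<k-t. 1 - q ^ i * (q * b)))"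
      unfolding P_def s prod.shift_bounds_Suc_ivl prod.lessThan_Suc_shift
      by (simp add: mult_ac)
    then show "A t = (1 - b) * ((-1) ^ t * q ^ (t choose 2) * qbin q k t *
      ((\<Prod>i=k-t..<k. 1 - q ^ i * (q * a)) * (\<Prod>i<k-t. 1 - q ^ i * (q * b))))"
      by (simp add: A_def mult_ac)
  qed
  also have "\<dots> = (1 - b) * F (q * a) (q * b)"
    by (simp add: F_def sum_distrib_left)
  also have "F (q * a) (q * b) = (\<Prod>i<k. q ^ (k - 1) * (q * a) - q ^ i * (q * b))"
    unfolding F_def by (rule Suc.IH)
  also have "\<dots> = (\<Prod>i<k. q * (q ^ (k - 1) * a - q ^ i * b))"
    by (simp add: algebra_simps)
  also have "\<dots> = q ^ k * R" by (simp add: R_def prod.distrib)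
  finally have sA: "(\<Sum>t\<le>Suc k. A t) = (1 - b) * (q ^ k * R)" .
  have "(\<Sum>t\<le>Suc k. B t) = (\<Sum>t\<le>k. B (Suc t))"
    unfolding sum.atMost_Suc_shift by (simp add: B_def)
  also have "\<dots> = (\<Sum>t\<le>k. - (q ^ k * (1 - q ^ k * a)) * ((-1) ^ t * q ^ (t choose 2) * qbin q k t *
      ((\<Prod>i=k-t..<k. 1 - q ^ i * a) * (\<Prod>i<k-t. 1 - q ^ i * b))))"
  proof (rule sum.cong[OF refl])
    fix t assume "t \<in> {..k}"
    then have "q ^ k = q ^ t * q ^ (k - t)" by (simp flip: power_add)
    moreover have "(\<Prod>i=k-t..<Suc k. 1 - q ^ i * a) = (\<Prod>i=k-t..<k. 1 - q ^ i * a) * (1 - q ^ k * a)"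
      by (rule prod.atLeastLessThan_Suc) simp
    ultimately show "B (Suc t) = - (q ^ k * (1 - q ^ k * a)) * ((-1) ^ t * q ^ (t choose 2) * qbin q k t *
      ((\<Prod>i=k-t..<k. 1 - q ^ i * a) * (\<Prod>i<k-t. 1 - q ^ i * b)))"
      by (simp add: B_def P_def Suc_choose_two power_add mult_ac del: prod.op_ivl_Suc)
  qed
  also have "\<dots> = - (q ^ k * (1 - q ^ k * a)) * F a b"
    by (simp only: F_def sum_distrib_left)
  also have "F a b = R" unfolding F_def R_def by (rule Suc.IH)
  finally have sB: "(\<Sum>t\<le>Suc k. B t) = - (q ^ k * (1 - q ^ k * a)) * R" .
  have "(\<Prod>i<Suc k. q ^ (Suc k - 1) * a - q ^ i * b) = (q ^ k * a - b) * (\<Prod>i<k. q ^ k * a - q ^ Suc i * b)"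
    by (simp add: prod.lessThan_Suc_shift del: prod.lessThan_Suc)
  also have "(\<Prod>i<k. q ^ k * a - q ^ Suc i * b) = (\<Prod>i<k. q * (q ^ (k - 1) * a - q ^ i * b))"
  proof (rule prod.cong[OF refl])
    fix i assume "i \<in> {..<k}"
    then have "q ^ k = q * q ^ (k - 1)" by (metis lessThan_iff less_nat_zero_code not_gr_zero power_eq_if)
    then show "q ^ k * a - q ^ Suc i * b = q * (q ^ (k - 1) * a - q ^ i * b)" by (simp add: algebra_simps)
  qed
  also have "\<dots> = q ^ k * R" by (simp add: R_def prod.distrib)
  finally have r: "(\<Prod>i<Suc k. q ^ (Suc k - 1) * a - q ^ i * b) = (q ^ k * a - b) * (q ^ k * R)" .
  have "(\<Sum>t\<le>Suc k. (-1) ^ t * q ^ (t choose 2) * qbin q (Suc k) t * P t) =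
      (\<Sum>t\<le>Suc k. A t) + (\<Sum>t\<le>Suc k. B t)"
    unfolding split by (rule sum.distrib)
  also have "\<dots> = (q ^ k * a - b) * (q ^ k * R)"
    unfolding sA sB by (simp add: algebra_simps)
  finally show ?case unfolding r P_def .
qed

text \<open>For \<open>b = q\<^bsup>k-1\<^esup>a\<^sup>2\<close>, all terms of the q-Vandermonde sum
except the last have the factor \<open>1 - b\<close>. This is the sum of these terms with that
factor cancelled; its value at \<open>b = 1\<close> is what matters.\<close>

definition vand_sum :: "'a::comm_ring_1 \<Rightarrow> 'a \<Rightarrow> nat \<Rightarrow> 'a" where
  "vand_sum q a k = (\<Sum>t<k. (-1) ^ t * q ^ (t choose 2) * qbin q k t *
      ((\<Prod>i=k-t..<k. 1 - q ^ i * a) * (\<Prod>i=1..<k-t. 1 - q ^ i * (q ^ (k - 1) * a\<^sup>2))))"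

lemma qbin_self: "qbin q k k = 1"
  by (induction k) (auto simp: qbin_eq_0)

text \<open>The special case \<open>b = q\<^bsup>k-1\<^esup>a\<^sup>2\<close> of the q-Vandermonde
sum, solved for the terms divisible by \<open>1 - b\<close>.\<close>

lemma vand_sum_times:
  fixes q a :: "'a::comm_ring_1"
  assumes "0 < k"
  shows "(1 - q ^ (k - 1) * a\<^sup>2) * vand_sum q a k =
    q ^ (k choose 2) * (\<Prod>i<k. 1 - q ^ i * a) * (a ^ k * q ^ (k choose 2) - (-1) ^ k)"
proof -
  define z where "z = q ^ (k - 1) * a\<^sup>2"
  have "(1 - z) * vand_sum q a k = (\<Sum>t<k. (-1) ^ t * q ^ (t choose 2) * qbin q k t *
      ((\<Prod>i=k-t..<k. 1 - q ^ i * a) * (\<Prod>i<k-t. 1 - q ^ i * z)))"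
    unfolding vand_sum_def z_def[symmetric] sum_distrib_left
  proof (rule sum.cong[OF refl])
    fix t assume "t \<in> {..<k}"
    then have "{..<k-t} = insert 0 {1..<k-t}" by auto
    then have "(\<Prod>i<k-t. 1 - q ^ i * z) = (1 - z) * (\<Prod>i=1..<k-t. 1 - q ^ i * z)" by simp
    then show "(1 - z) * ((-1) ^ t * q ^ (t choose 2) * qbin q k t *
      ((\<Prod>i=k-t..<k. 1 - q ^ i * a) * (\<Prod>i=1..<k-t. 1 - q ^ i * z))) = (-1) ^ t * q ^ (t choose 2) * qbin q k t *
      ((\<Prod>i=k-t..<k. 1 - q ^ i * a) * (\<Prod>i<k-t. 1 - q ^ i * z))"
      by (simp add: mult_ac)
  qed
  also have "\<dots> = (\<Prod>i<k. q ^ (k - 1) * a - q ^ i * z) -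
      (-1) ^ k * q ^ (k choose 2) * (\<Prod>i<k. 1 - q ^ i * a)"
    unfolding q_vandermonde[symmetric] lessThan_Suc_atMost[symmetric]
    by (simp add: qbin_self lessThan_atLeast0)
  also have "(\<Prod>i<k. q ^ (k - 1) * a - q ^ i * z) = (\<Prod>i<k. q ^ (k - 1) * a * (1 - q ^ i * a))"
    by (simp add: z_def algebra_simps power2_eq_square)
  also have "\<dots> = q ^ ((k - 1) * k) * a ^ k * (\<Prod>i<k. 1 - q ^ i * a)"
    by (simp add: prod.distrib power_mult_distrib power_mult)
  also have "q ^ ((k - 1) * k) = q ^ (k choose 2) * q ^ (k choose 2)"
  proof -
    have "even (k * (k - 1))" by (cases k) auto
    then have "2 * (k choose 2) = (k - 1) * k" by (simp add: choose_two mult.commute)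
    then show ?thesis by (metis mult_2 power_add)
  qed
  finally show ?thesis by (simp add: z_def algebra_simps)
qed

lemma poly_qbin: "poly (qbin [:q:] k t) x = qbin q k t"
  by (induction "[:q:]" k t rule: qbin.induct) (simp_all add: poly_const_pow)

lemma poly_vand_sum: "poly (vand_sum [:q:] [:0, 1:] k) x = vand_sum q x k"
  by (simp add: vand_sum_def poly_sum poly_prod poly_qbin mult.commute)

text \<open>For \<open>z = q\<^bsup>2l-1\<^esup>a\<^sup>2\<close> the last factor in
\<open>vand_sum_times\<close> is \<open>z\<^sup>l - 1\<close>, a multiple of \<open>z - 1\<close>.
The case of interest is \<open>z = 1\<close>, so the cancellation is done for an indeterminate
\<open>a\<close>, which is specialised afterwards.\<close>

lemma vand_sum_even:
  fixes q a :: "'a::field"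
  assumes "0 < l"
  shows "vand_sum q a (2 * l) = - (q ^ (2 * l choose 2) * (\<Prod>i<2*l. 1 - q ^ i * a)) *
    qnum l (q ^ (2 * l - 1) * a\<^sup>2)"
proof -
  define X Z where "X = [:0, 1 :: 'a:]" and "Z = [:q:] ^ (2 * l - 1) * X\<^sup>2"
  define U where "U = [:q:] ^ (2 * l choose 2) * (\<Prod>i<2*l. 1 - [:q:] ^ i * X)"
  have e: "(2 * l choose 2) = (2 * l - 1) * l" by (simp add: choose_two)
  have "X ^ (2 * l) * [:q:] ^ (2 * l choose 2) = Z ^ l"
    unfolding Z_def e power_mult_distrib power_mult[symmetric] by (simp add: mult_ac)
  then have "(1 - Z) * vand_sum [:q:] X (2 * l) = U * (Z ^ l - 1)"
    using vand_sum_times[of "2 * l" "[:q:]" X] assms by (simp add: Z_def U_def)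
  also have "\<dots> = (1 - Z) * (- U * (\<Sum>i<l. Z ^ i))"
  proof -
    have "1 - Z ^ l = (1 - Z) * (\<Sum>i<l. Z ^ i)" by (rule one_diff_power_eq)
    then have "Z ^ l - 1 = (1 - Z) * - (\<Sum>i<l. Z ^ i)" by (simp add: algebra_simps)
    then show ?thesis by simp
  qed
  finally have eq: "(1 - Z) * vand_sum [:q:] X (2 * l) = (1 - Z) * (- U * (\<Sum>i<l. Z ^ i))" .
  \<comment> \<open>The constant term in the indeterminate shows that the factor to be cancelled is not zero.\<close>
  have "poly (1 - Z) 0 = 1" by (simp add: Z_def X_def)
  then have "1 - Z \<noteq> 0" by auto
  then have "vand_sum [:q:] X (2 * l) = - U * (\<Sum>i<l. Z ^ i)"
    using eq mult_left_cancel by blast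
  then have "poly (vand_sum [:q:] X (2 * l)) a = poly (- U * (\<Sum>i<l. Z ^ i)) a" by simp
  then show ?thesis
    by (simp add: X_def poly_vand_sum U_def Z_def poly_sum poly_prod qnum_def mult.commute)
qed

text \<open>With \<open>z = -q\<^sup>la\<close>, the left factor in \<open>vand_sum_times\<close> is
\<open>1 - z\<^sup>2\<close> and the right one \<open>1 - z\<^sup>k\<close> for \<open>k = 2l +
1\<close>. Again \<open>1 - z\<close> is cancelled for an indeterminate \<open>a\<close>.\<close>

lemma vand_sum_odd:
  fixes q a :: "'a::field"
  shows "(1 - q ^ l * a) * vand_sum q a (2 * l + 1) =
    q ^ (2 * l + 1 choose 2) * (\<Prod>i<2*l+1. 1 - q ^ i * a) * qnum (2 * l + 1) (- (q ^ l * a))"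
proof -
  define k where "k = 2 * l + 1"
  define X Z where "X = [:0, 1 :: 'a:]" and "Z = - ([:q:] ^ l * X)"
  define U where "U = [:q:] ^ (k choose 2) * (\<Prod>i<k. 1 - [:q:] ^ i * X)"
  have k: "0 < k" "odd k" by (simp_all add: k_def)
  have e: "(k choose 2) = l * k" by (simp add: choose_two k_def)
  have "X ^ k * [:q:] ^ (k choose 2) = ([:q:] ^ l * X) ^ k"
    unfolding e power_mult_distrib power_mult[symmetric] by (simp add: mult_ac)
  moreover have "([:q:] ^ l * X) ^ k = - (Z ^ k)" by (simp add: Z_def k_def)
  moreover have "[:q:] ^ (k - 1) * X\<^sup>2 = Z\<^sup>2"
    by (simp add: Z_def k_def power_mult power_mult_distrib mult.commute[of 2])
  ultimately have "(1 - Z\<^sup>2) * vand_sum [:q:] X k = U * (1 - Z ^ k)"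
    using vand_sum_times[of k "[:q:]" X] k by (simp add: U_def)
  also have "1 - Z ^ k = (1 - Z) * (\<Sum>i<k. Z ^ i)" by (rule one_diff_power_eq)
  finally have eq: "(1 - Z) * ((1 + Z) * vand_sum [:q:] X k) = (1 - Z) * (U * (\<Sum>i<k. Z ^ i))"
    by (simp add: algebra_simps power2_eq_square)
  have "poly (1 - Z) 0 = 1" by (simp add: Z_def X_def)
  then have "1 - Z \<noteq> 0" by auto
  then have "(1 + Z) * vand_sum [:q:] X k = U * (\<Sum>i<k. Z ^ i)"
    using eq mult_left_cancel by blast
  then have "poly ((1 + Z) * vand_sum [:q:] X k) a = poly (U * (\<Sum>i<k. Z ^ i)) a" by simp
  then show ?thesis
    by (simp only: k_def[symmetric]) (simp add: X_def poly_vand_sum U_def Z_def poly_sum poly_prod qnum_def mult.commute)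
qed

section \<open>A triangular matrix commuting with a bidiagonal one\<close>

lemma qnum_Suc: "qnum (Suc a) q = qnum a q + q ^ a"
  by (simp add: qnum_def)

lemma qnum_add: "qnum (a + b) q = qnum a q + q ^ a * qnum b q"
  by (induction b) (simp_all add: qnum_Suc algebra_simps power_add, simp add: qnum_def)

lemma qnum_times: "(q - 1) * qnum a q = q ^ a - 1"
  unfolding qnum_def by (rule power_diff_1_eq[symmetric])

lemma qfact_Suc: "qfact (Suc a) q = qfact a q * qnum (Suc a) q"
  by (simp add: qfact_def)

lemma qfact_0: "qfact 0 q = 1"
  by (simp add: qfact_def)

lemma qbin_qfact: "t \<le> k \<Longrightarrow> qbin q k t * (qfact t q * qfact (k - t) q) = qfact k q"
proof (induction q k t rule: qbin.induct)
  case (3 q k t)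
  show ?case
  proof (cases "t = k")
    case True
    then show ?thesis by (simp add: qbin_self qfact_0)
  next
    case False
    with 3(3) have t: "t < k" by simp
    then obtain u where u: "k - t = Suc u" "k - Suc t = u" "k = t + Suc u" by (metis Suc_diff_Suc less_imp_add_positive add_diff_cancel_left' less_imp_Suc_add add_Suc_right)
    have a: "qbin q k (Suc t) * (qfact (Suc t) q * qfact u q) = qfact k q"
      using 3(1) t u by simp
    have b: "qbin q k t * (qfact t q * qfact (Suc u) q) = qfact k q"
      using 3(2) t u by simp
    have "qbin q (Suc k) (Suc t) * (qfact (Suc t) q * qfact (Suc k - Suc t) q) =
      (qbin q k (Suc t) * (qfact (Suc t) q * qfact u q)) * qnum (Suc u) q +
      q ^ Suc u * qnum (Suc t) q * (qbin q k t * (qfact t q * qfact (Suc u) q))"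
      by (simp add: u(1) qfact_Suc algebra_simps)
    also have "\<dots> = qfact k q * (qnum (Suc u) q + q ^ Suc u * qnum (Suc t) q)"
      unfolding a b by (simp add: algebra_simps)
    also have "qnum (Suc u) q + q ^ Suc u * qnum (Suc t) q = qnum (Suc k) q"
      unfolding qnum_add[symmetric] using u(3) by (simp add: add.commute)
    finally show ?thesis by (simp add: qfact_Suc)
  qed
qed (simp_all add: qfact_0)

lemma downward_solution:
  fixes d \<beta> w Z :: "nat \<Rightarrow> 'k::field"
  assumes "\<And>i. i < n \<Longrightarrow> d i \<noteq> 0"
  shows "\<exists>y. (\<forall>i\<ge>n. y i = Z i) \<and> (\<forall>i<n. d i * y i + \<beta> (Suc i) * y (Suc i) = w i)"
  using assms
proof (induction n arbitrary: Z)
  case (Suc n)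
  define Z' where "Z' = Z(n := (w n - \<beta> (Suc n) * Z (Suc n)) / d n)"
  obtain y where y: "\<forall>i\<ge>n. y i = Z' i" "\<forall>i<n. d i * y i + \<beta> (Suc i) * y (Suc i) = w i"
    using Suc.IH[of Z'] Suc.prems by auto
  have "d n * y n + \<beta> (Suc n) * y (Suc n) = w n"
    using Suc.prems[of n] y(1) by (simp add: Z'_def)
  with y show ?case by (intro exI[of _ y]) (auto simp: Z'_def less_Suc_eq)
qed auto

lemma downward_zero:
  fixes d \<beta> Z :: "nat \<Rightarrow> 'k::field"
  assumes "\<And>i. i < n \<Longrightarrow> d i \<noteq> 0" "\<And>i. i < n \<Longrightarrow> d i * Z i + \<beta> (Suc i) * Z (Suc i) = 0"
    "Z n = 0" "i \<le> n"
  shows "Z i = 0"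
  using assms(4)
proof (induction rule: inc_induct)
  case (step i)
  then show ?case using assms(1,2)[of i] by simp
qed (use assms in simp)

locale kernel_setup =
  fixes q r s :: "'k::field" and m :: nat
  assumes q0: "q \<noteq> 0" and fact0: "qfact m q \<noteq> 0" and b0: "bprod q r m \<noteq> 0"
begin

lemma qnum_nonzero: "0 < i \<Longrightarrow> i \<le> m \<Longrightarrow> qnum i q \<noteq> 0"
  using fact0 by (auto simp: qfact_def)

lemma qfact_nonzero: "i \<le> m \<Longrightarrow> qfact i q \<noteq> 0"
  using fact0 by (auto simp: qfact_def)

lemma b_factor_nonzero: "i < m \<Longrightarrow> 1 - q ^ i * r \<noteq> 0"
  using b0 by (auto simp: bprod_def)

text \<open>The eigenvalue of the braiding \<open>c\<close> that is new at level
\<open>n\<close>.\<close>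

definition eps :: "nat \<Rightarrow> 'k" where
  "eps n = q ^ (n choose 2) * (- r) ^ n * s"

text \<open>The matrix of the braiding; see \<open>coeff_newton_poly_id_plus_c\<close> below. It is
the diagonal matrix of the \<open>eps i\<close> times the q-exponential of a shift.\<close>

definition C :: "nat \<Rightarrow> nat \<Rightarrow> 'k" where
  "C i j = (if i \<le> j then eps i / qfact (j - i) q else 0)"

definition B :: "nat \<Rightarrow> nat \<Rightarrow> 'k" where
  "B i j = (if i = j then 1 else 0) + C i j"

definition bop :: "(nat \<Rightarrow> 'k) \<Rightarrow> nat \<Rightarrow> 'k" where
  "bop H i = (\<Sum>j\<le>m. B i j * H j)"

text \<open>The matrix \<open>A\<close> commuting with \<open>C\<close> has diagonal entries
\<open>-(n)\<^sub>qq\<^bsup>-n\<^esup>(1 - q\<^bsup>n-1\<^esup>r\<^sup>2)\<close> and superdiagonal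
entries \<open>q\<^bsup>-j\<^esup>(1 - q\<^bsup>j-1\<^esup>r)\<close>; it comes from a lowering
operator that commutes with the braiding, followed by \<open>ad x\<^sub>1\<close>. Here the last
diagonal entry is subtracted and everything is multiplied by \<open>q\<^sup>m\<close>, so that
\<open>d m = 0\<close>.\<close>

definition d :: "nat \<Rightarrow> 'k" where
  "d i = qnum (m - i) q * (1 - q ^ (m + i - 1) * r\<^sup>2)"

definition beta :: "nat \<Rightarrow> 'k" where
  "beta j = (if j = 0 then 0 else q ^ (m - j) * (1 - q ^ (j - 1) * r))"

definition aop :: "(nat \<Rightarrow> 'k) \<Rightarrow> nat \<Rightarrow> 'k" where
  "aop H i = d i * H i + beta (Suc i) * H (Suc i)"

lemma d_m: "d m = 0"
  by (simp add: d_def qnum_def)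

lemma beta_nonzero: "0 < j \<Longrightarrow> j \<le> m \<Longrightarrow> beta j \<noteq> 0"
  using b_factor_nonzero[of "j - 1"] q0 by (simp add: beta_def)

lemma d_diff:
  assumes "i < j" "j \<le> m"
  shows "d i - d j = qnum (j - i) q * (beta j + r * q ^ i * beta (Suc i))"
proof -
  obtain k where k: "j = i + k" "0 < k" using assms less_imp_add_positive by blast
  obtain l where l: "m = j + l" using assms(2) le_Suc_ex by blast
  obtain k' where k': "k = Suc k'" using k by (cases k) auto
  have e: "qnum (m - i) q = qnum l q + q ^ l * qnum k q"
    unfolding qnum_add[symmetric] by (simp add: k l add.commute)
  have c: "(q ^ k - 1) * qnum l q = (q ^ l - 1) * qnum k q"
    unfolding qnum_times[symmetric] by (simp add: mult_ac)
  have x: "q ^ (m + j - 1) = q ^ (m + i - 1) * q ^ k"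
  proof -
    have "m + j - 1 = (m + i - 1) + k" using k l by simp
    then show ?thesis by (simp add: power_add)
  qed
  have "d i - d j = q ^ l * qnum k q * (1 - q ^ (m + i - 1) * r\<^sup>2)
      + r\<^sup>2 * q ^ (m + i - 1) * ((q ^ k - 1) * qnum l q)"
    unfolding d_def e x by (simp add: l algebra_simps)
  also have "\<dots> = qnum k q * (q ^ l - r\<^sup>2 * q ^ (m + i - 1))"
    unfolding c by (simp add: algebra_simps)
  also have "q ^ l - r\<^sup>2 * q ^ (m + i - 1) = beta j + r * q ^ i * beta (Suc i)"
  proof -
    have "q ^ (m - j) * q ^ (j - 1) = q ^ (m - 1)" "q ^ (m - Suc i) * q ^ i = q ^ (m - 1)"
      "q ^ (m - 1) * q ^ i = q ^ (m + i - 1)"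
      using k by (simp_all add: l k' add_ac flip: power_add)
    moreover have "q ^ (m - j) = q ^ l" by (simp add: l)
    moreover have "beta j = q ^ (m - j) - q ^ (m - j) * q ^ (j - 1) * r"
      using k by (simp add: beta_def algebra_simps)
    moreover have "q ^ i * beta (Suc i) = q ^ (m - Suc i) * q ^ i * (1 - q ^ i * r)"
      by (simp add: beta_def algebra_simps)
    ultimately have "beta j = q ^ l - q ^ (m - 1) * r"
      and bi: "q ^ i * beta (Suc i) = q ^ (m - 1) - q ^ (m + i - 1) * r"
      by (simp_all add: right_diff_distrib flip: mult.assoc)
    then show ?thesis
      unfolding mult.assoc bi by (simp add: right_diff_distrib power2_eq_square mult_ac)
  qed
  finally show ?thesis using k by simp
qed

lemma eps_Suc: "eps (Suc i) = - (r * q ^ i) * eps i"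
  by (simp add: eps_def Suc_choose_two power_add)

text \<open>The entries of \<open>C\<close> in the places \<open>(i + 1, j)\<close> and \<open>(i, j
- 1)\<close> are \<open>-rq\<^sup>i(j-i)\<^sub>q\<close> and \<open>(j-i)\<^sub>q\<close> times the
one in place \<open>(i, j)\<close>, so the claim reduces to \<open>d_diff\<close>.\<close>

lemma C_commutes:
  assumes "j \<le> m"
  shows "d i * C i j + beta (Suc i) * C (Suc i) j = C i j * d j + C i (j - 1) * beta j"
proof -
  consider "i < j" | "i = j" | "j < i" by linarith
  then show ?thesis
  proof cases
    case 1
    define f where "f = qfact (j - i) q"
    have n0: "qnum (j - i) q \<noteq> 0" "f \<noteq> 0" 
      using 1 assms qnum_nonzero[of "j - i"] qfact_nonzero[of "j - i"] by (auto simp: f_def)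
    have f: "f = qfact (j - Suc i) q * qnum (j - i) q"
      using qfact_Suc[of "j - Suc i" q] Suc_diff_Suc[OF 1] by (simp add: f_def)
    then have g: "1 / qfact (j - Suc i) q = qnum (j - i) q / f" using n0 by (auto simp: field_simps)
    have c1: "C (Suc i) j = eps (Suc i) * (1 / qfact (j - Suc i) q)" using 1 by (simp add: C_def)
    have "j - 1 - i = j - Suc i" "i \<le> j - 1" using 1 by auto
    then have c2: "C i (j - 1) = eps i * (1 / qfact (j - Suc i) q)" by (simp add: C_def)
    have c0: "C i j = eps i / f" using 1 by (simp add: C_def f_def)
    have "d i * C i j - C i j * d j = eps i / f * (d i - d j)"
      unfolding c0 by (simp add: algebra_simps)
    also have "\<dots> = C i (j - 1) * beta j - beta (Suc i) * C (Suc i) j"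
      unfolding d_diff[OF 1 assms] c1 c2 g eps_Suc by (simp add: algebra_simps)
    finally show ?thesis by (simp add: algebra_simps)
  qed (auto simp: C_def beta_def)
qed

lemma B_commutes:
  assumes "j \<le> m"
  shows "d i * B i j + beta (Suc i) * B (Suc i) j = B i j * d j + B i (j - 1) * beta j"
proof -
  define \<delta> where "\<delta> i j = (if i = j then 1 else 0 :: 'k)" for i j :: nat
  have "d i * \<delta> i j + beta (Suc i) * \<delta> (Suc i) j = \<delta> i j * d j + \<delta> i (j - 1) * beta j"
    by (cases j) (auto simp: \<delta>_def beta_def)
  moreover have "B i j = \<delta> i j + C i j" for i j by (simp add: B_def \<delta>_def)
  ultimately show ?thesis using C_commutes[OF assms] by (simp add: algebra_simps)
qed

lemma B_triangular: "j < i \<Longrightarrow> B i j = 0"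
  by (simp add: B_def C_def)

lemma aop_bop:
  assumes "\<And>i. m < i \<Longrightarrow> H i = 0"
  shows "aop (bop H) i = bop (aop H) i"
proof -
  have "aop (bop H) i = (\<Sum>j\<le>m. (d i * B i j + beta (Suc i) * B (Suc i) j) * H j)"
    by (simp add: aop_def bop_def sum_distrib_left distrib_right sum.distrib mult.assoc)
  also have "\<dots> = (\<Sum>j\<le>m. B i j * d j * H j) + (\<Sum>j\<le>m. B i (j - 1) * beta j * H j)"
    by (simp add: B_commutes algebra_simps sum.distrib)
  also have "(\<Sum>j\<le>m. B i (j - 1) * beta j * H j) = (\<Sum>j\<le>Suc m. B i (j - 1) * beta j * H j)"
    using assms by simp
  also have "\<dots> = (\<Sum>j\<le>m. B i j * beta (Suc j) * H (Suc j))"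
    unfolding sum.atMost_Suc_shift by (simp add: beta_def)
  also have "(\<Sum>j\<le>m. B i j * d j * H j) + \<dots> = bop (aop H) i"
    by (simp add: bop_def aop_def algebra_simps sum.distrib)
  finally show ?thesis .
qed

lemma bop_m: "bop H m = (1 + eps m) * H m"
proof -
  have "bop H m = (\<Sum>j\<in>{m}. B m j * H j)"
    unfolding bop_def by (rule sum.mono_neutral_right) (auto simp: B_triangular)
  then show ?thesis by (simp add: B_def C_def qfact_0)
qed

lemma bop_top:
  assumes "\<And>i. n < i \<Longrightarrow> H i = 0" "n \<le> m"
  shows "bop H n = (1 + eps n) * H n"
proof -
  have "B n j * H j = 0" if "j \<noteq> n" for j
    using assms B_triangular[of j n] that by (cases j n rule: linorder_cases) auto
  then have "bop H n = (\<Sum>j\<in>{n}. B n j * H j)"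
    unfolding bop_def using assms(2) by (intro sum.mono_neutral_right) auto
  then show ?thesis by (simp add: B_def C_def qfact_0)
qed

lemma bop_above:
  assumes "\<And>i. n < i \<Longrightarrow> H i = 0" "n < i"
  shows "bop H i = 0"
  unfolding bop_def
proof (rule sum.neutral, rule ballI)
  fix j show "B i j * H j = 0"
    using assms B_triangular[of j i] by (cases "j < i") auto
qed

text \<open>The eigenvector of \<open>A\<close> with last entry in place \<open>n\<close> is unique,
because the diagonal entries above are different. As \<open>B\<close> commutes with
\<open>A\<close>, it maps the eigenvector to a multiple of itself, and the multiple is \<open>1 +
eps n = 0\<close>.\<close>

lemma eigenvector:
  assumes n: "n \<le> m" "d n = 0" "\<And>i. i < n \<Longrightarrow> d i \<noteq> 0" and e: "eps n = -1"
  obtains y where "y n = 1" "\<And>i. n < i \<Longrightarrow> y i = 0" "\<And>i. aop y i = 0" "\<And>i. bop y i = 0"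
proof -
  obtain y where y: "\<forall>i\<ge>n. y i = (if i = n then 1 else 0)"
      "\<forall>i<n. d i * y i + beta (Suc i) * y (Suc i) = 0"
    using downward_solution[of n d "\<lambda>i. if i = n then 1 else 0" beta "\<lambda>_. 0"] n(3) by auto
  have yn: "y n = 1" using y(1)[rule_format, of n] by simp
  have top: "y i = 0" if "n < i" for i using y(1)[rule_format, of i] that by simp
  have a: "aop y i = 0" for i
  proof (cases i n rule: linorder_cases)
    case less
    then show ?thesis using y(2) by (simp add: aop_def)
  next
    case equal
    then show ?thesis using n(2) top[of "Suc n"] by (simp add: aop_def)
  next
    case greater
    then show ?thesis using top[of i] top[of "Suc i"] by (simp add: aop_def)
  qed
  have ab: "d i * bop y i + beta (Suc i) * bop y (Suc i) = 0" for i
  proof -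
    have "bop (aop y) i = 0" unfolding bop_def a by simp
    moreover have "m < i \<Longrightarrow> y i = 0" for i using top n(1) by simp
    ultimately show ?thesis using aop_bop[of y i] unfolding aop_def[of "bop y"] by simp
  qed
  have "bop y n = 0" using bop_top[of n y] top n(1) e by simp
  then have "bop y i = 0" if "i \<le> n" for i
    using downward_zero[of n d "bop y" beta i] n(3) ab that by blast
  moreover have "bop y i = 0" if "n < i" for i using bop_above[of n y i] top that by blast
  ultimately have "bop y i = 0" for i by (meson not_le)
  then show ?thesis using that[of y] yn top a by blast
qed

text \<open>The entries in the places \<open>i > n\<close> of a vector with entry \<open>1\<close>
in place \<open>m\<close> that \<open>A\<close> maps to a multiple of the eigenvector with last
entry in place \<open>n < m\<close>.\<close>

definition Y :: "nat \<Rightarrow> 'k" where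
  "Y i = (- 1) ^ (m - i) * q ^ (m - i choose 2) * (\<Prod>l=i..<m. 1 - q ^ l * r) /
     (qfact (m - i) q * (\<Prod>l=i..<m. 1 - q ^ (l + m - 1) * r\<^sup>2))"

lemma Y_m: "Y m = 1"
  by (simp add: Y_def qfact_0 numeral_2_eq_2)

lemma Y_step:
  assumes "i < m" "d i \<noteq> 0"
  shows "d i * Y i + beta (Suc i) * Y (Suc i) = 0"
proof -
  obtain t where t: "m - i = Suc t" "m - Suc i = t" using assms(1) by (metis Suc_diff_Suc)
  have p: "(\<Prod>l=i..<m. f l) = f i * (\<Prod>l=Suc i..<m. f l)" for f :: "nat \<Rightarrow> 'k"
    by (rule prod.atLeast_Suc_lessThan[OF assms(1)])
  have nz: "qnum (Suc t) q \<noteq> 0" "1 - q ^ (i + m - 1) * r\<^sup>2 \<noteq> 0"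
    using assms(2) by (auto simp: d_def t add.commute)
  have "Y i = - (q ^ t * (1 - q ^ i * r)) * Y (Suc i) / (qnum (Suc t) q * (1 - q ^ (i + m - 1) * r\<^sup>2))"
    unfolding Y_def p t qfact_Suc Suc_choose_two power_add power_Suc by (simp add: mult_ac)
  then have "qnum (Suc t) q * (1 - q ^ (i + m - 1) * r\<^sup>2) * Y i = - (q ^ t * (1 - q ^ i * r)) * Y (Suc i)"
    using nz by simp
  then show ?thesis by (simp add: d_def beta_def t add.commute)
qed

text \<open>After multiplication by \<open>(m-n)\<^sub>q!\<close> and the denominators, the sum is
\<open>vand_sum\<close> at \<open>a = q\<^sup>nr\<close>, with summation index \<open>m -
i\<close>.\<close>

lemma Y_sum:
  assumes n: "n < m" and d: "\<And>i. n < i \<Longrightarrow> i < m \<Longrightarrow> d i \<noteq> 0"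
  shows "(\<Sum>i=Suc n..m. Y i / qfact (i - n) q) = 0 \<longleftrightarrow> vand_sum q (q ^ n * r) (m - n) = 0"
proof -
  define k where "k = m - n"
  define W where "W = (\<Prod>l=Suc n..<m. 1 - q ^ (l + m - 1) * r\<^sup>2)"
  have nz: "1 - q ^ (l + m - 1) * r\<^sup>2 \<noteq> 0" if "n < l" "l < m" for l
    using d[OF that] by (auto simp: d_def add.commute)
  have W0: "W \<noteq> 0" using nz by (simp add: W_def)
  have "(\<Sum>i=Suc n..m. Y i / qfact (i - n) q) = (\<Sum>t<k. Y (m - t) / qfact (k - t) q)"
    by (rule sum.reindex_bij_witness[of _ "\<lambda>t. m - t" "\<lambda>i. m - i"]) (use n in \<open>auto simp: k_def\<close>)
  then have "qfact k q * W * (\<Sum>i=Suc n..m. Y i / qfact (i - n) q) =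
      (\<Sum>t<k. qfact k q * W * (Y (m - t) / qfact (k - t) q))"
    by (simp add: sum_distrib_left)
  also have "\<dots> = vand_sum q (q ^ n * r) k"
    unfolding vand_sum_def
  proof (rule sum.cong[OF refl])
    fix t assume "t \<in> {..<k}"
    then have t: "t < k" by simp
    define i where "i = m - t"
    have i: "m - i = t" "i \<le> m" "n < i" "i - n = k - t" using t n by (auto simp: i_def k_def)
    define W1 W2 where "W1 = (\<Prod>l=Suc n..<i. 1 - q ^ (l + m - 1) * r\<^sup>2)"
      and "W2 = (\<Prod>l=i..<m. 1 - q ^ (l + m - 1) * r\<^sup>2)"
    have W: "W = W1 * W2" unfolding W_def W1_def W2_def
      by (rule prod.atLeastLessThan_concat[symmetric]) (use i in auto)
    have f0: "qfact t q \<noteq> 0" "qfact (k - t) q \<noteq> 0" "W2 \<noteq> 0"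
      using qfact_nonzero t W W0 by (auto simp: k_def)
    have b: "qfact k q = qbin q k t * (qfact t q * qfact (k - t) q)"
      using qbin_qfact[of t k q] t by simp
    have "(\<Prod>l=i..<m. 1 - q ^ l * r) = (\<Prod>l=k-t..<k. 1 - q ^ l * (q ^ n * r))"
    proof (rule prod.reindex_bij_witness[of _ "\<lambda>l. l + n" "\<lambda>l. l - n"])
      fix l assume "l \<in> {i..<m}"
      then have "l = (l - n) + n" using i by simp
      then have "q ^ l = q ^ (l - n) * q ^ n" by (metis power_add)
      then show "1 - q ^ (l - n) * (q ^ n * r) = 1 - q ^ l * r" by (simp add: mult.assoc)
    qed (use i n in \<open>auto simp: k_def\<close>)
    moreover have "W1 = (\<Prod>l=1..<k-t. 1 - q ^ l * (q ^ (k - 1) * (q ^ n * r)\<^sup>2))"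
      unfolding W1_def
    proof (rule prod.reindex_bij_witness[of _ "\<lambda>l. l + n" "\<lambda>l. l - n"])
      fix l assume "l \<in> {Suc n..<i}"
      then have "l + m - 1 = (l - n) + (k - 1) + n * 2" using n by (auto simp: k_def)
      then show "1 - q ^ (l - n) * (q ^ (k - 1) * (q ^ n * r)\<^sup>2) = 1 - q ^ (l + m - 1) * r\<^sup>2"
        by (simp add: power_add power_mult power_mult_distrib)
    qed (use i in auto)
    moreover have "qfact k q * W * (Y (m - t) / qfact (k - t) q) = (- 1) ^ t * q ^ (t choose 2) *
        qbin q k t * ((\<Prod>l=i..<m. 1 - q ^ l * r) * W1)"
      unfolding i_def[symmetric] Y_def i W b W2_def[symmetric] using f0 by simp
    ultimately show "qfact k q * W * (Y (m - t) / qfact (k - t) q) = (- 1) ^ t * q ^ (t choose 2) *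
        qbin q k t * ((\<Prod>i = k - t..<k. 1 - q ^ i * (q ^ n * r)) *
         (\<Prod>i = 1..<k - t. 1 - q ^ i * (q ^ (k - 1) * (q ^ n * r)\<^sup>2)))" by simp
  qed
  finally show ?thesis using W0 qfact_nonzero[of k] by (auto simp: k_def)
qed

text \<open>The left generalised eigenvector \<open>\<phi>\<close> of \<open>A\<close> starting in
place \<open>n\<close>, restricted to the places before \<open>m\<close>. There
\<open>\<phi>B\<close> vanishes, because it satisfies the recursion of \<open>\<phi>\<close> with
initial value \<open>1 + eps n = 0\<close>. This turns a kernel vector with nonzero entry in place
\<open>m\<close> into an equation.\<close>

lemma left_functional:
  assumes n: "n < m" "d n = 0" "\<And>i. n < i \<Longrightarrow> i < m \<Longrightarrow> d i \<noteq> 0" and e: "eps n = -1"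
  obtains \<phi> \<psi> where "\<phi> n = (1 :: 'k)" "\<And>H. (\<Sum>i=n..<m. \<phi> i * bop H i) = \<psi> * H m"
proof -
  define \<phi> where "\<phi> i = (\<Prod>l=Suc n..i. - beta l / d l)" for i
  have \<phi>n: "\<phi> n = 1" by (simp add: \<phi>_def)
  have \<phi>: "\<phi> (Suc i) * d (Suc i) + \<phi> i * beta (Suc i) = 0" if "n \<le> i" "Suc i < m" for i
    using n(3)[of "Suc i"] that by (simp add: \<phi>_def)
  define \<psi> where "\<psi> j = (\<Sum>i=n..<m. \<phi> i * B i j)" for j
  have low: "\<psi> j = 0" if "j < n" for j
    unfolding \<psi>_def using that by (intro sum.neutral) (auto simp: B_triangular)
  have "\<psi> j = 0" if "n \<le> j" "j < m" for j
    using that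
  proof (induction rule: dec_induct)
    case base
    have "\<psi> n = (\<Sum>i\<in>{n}. \<phi> i * B i n)"
      unfolding \<psi>_def using n(1) by (intro sum.mono_neutral_right) (auto simp: B_triangular)
    then show ?case using e by (simp add: \<phi>n B_def C_def qfact_0)
  next
    case (step j)
    then have j: "n \<le> j" "Suc j < m" "\<psi> j = 0" by auto
    obtain m' where m': "m = Suc m'" using n(1) by (cases m) auto
    have "\<psi> (Suc j) * d (Suc j) + \<psi> j * beta (Suc j) =
        (\<Sum>i=n..<m. \<phi> i * (B i (Suc j) * d (Suc j) + B i (Suc j - 1) * beta (Suc j)))"
      by (simp add: \<psi>_def sum_distrib_right sum.distrib distrib_left mult.assoc)
    also have "\<dots> = (\<Sum>i=n..<m. \<phi> i * (d i * B i (Suc j) + beta (Suc i) * B (Suc i) (Suc j)))"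
      using j(2) by (subst B_commutes) auto
    also have "\<dots> = (\<Sum>i=n..<m. \<phi> i * d i * B i (Suc j)) + (\<Sum>i=n..<m. \<phi> i * beta (Suc i) * B (Suc i) (Suc j))"
      by (simp add: sum.distrib algebra_simps)
    also have "(\<Sum>i=n..<m. \<phi> i * d i * B i (Suc j)) = (\<Sum>i=Suc n..<m. \<phi> i * d i * B i (Suc j))"
      using n(1,2) by (subst sum.atLeast_Suc_lessThan) auto
    also have "\<dots> = (\<Sum>i=n..<m'. \<phi> (Suc i) * d (Suc i) * B (Suc i) (Suc j))"
      unfolding m' by (rule sum.shift_bounds_Suc_ivl)
    also have "(\<Sum>i=n..<m. \<phi> i * beta (Suc i) * B (Suc i) (Suc j)) =
        (\<Sum>i=n..<m'. \<phi> i * beta (Suc i) * B (Suc i) (Suc j))"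
      using n(1) j(2) by (simp add: m' B_triangular)
    also have "(\<Sum>i=n..<m'. \<phi> (Suc i) * d (Suc i) * B (Suc i) (Suc j)) + \<dots> =
        (\<Sum>i=n..<m'. (\<phi> (Suc i) * d (Suc i) + \<phi> i * beta (Suc i)) * B (Suc i) (Suc j))"
      by (simp add: sum.distrib algebra_simps)
    also have "\<dots> = 0"
      by (rule sum.neutral) (use \<phi> in \<open>auto simp: m'\<close>)
    finally show ?case using n(3)[of "Suc j"] j by simp
  qed
  with low have \<psi>0: "\<psi> j = 0" if "j < m" for j using that by (cases "j < n") auto
  have "(\<Sum>i=n..<m. \<phi> i * bop H i) = \<psi> m * H m" for H
  proof -
    have "(\<Sum>i=n..<m. \<phi> i * bop H i) = (\<Sum>i=n..<m. \<Sum>j\<le>m. \<phi> i * B i j * H j)"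
      by (simp add: bop_def sum_distrib_left mult.assoc)
    also have "\<dots> = (\<Sum>j\<le>m. \<psi> j * H j)"
      by (subst sum.swap) (simp add: \<psi>_def sum_distrib_right)
    also have "\<dots> = (\<Sum>j\<in>{m}. \<psi> j * H j)"
      by (rule sum.mono_neutral_right) (auto simp: \<psi>0)
    finally show ?thesis by simp
  qed
  with that[of \<phi>] \<phi>n show ?thesis by blast
qed

text \<open>The kernel at level \<open>m\<close> is larger than the one at level \<open>m -
1\<close>.\<close>

definition new_kernel_vector :: bool where
  "new_kernel_vector \<longleftrightarrow> (\<exists>H. H m \<noteq> 0 \<and> (\<forall>i\<le>m. bop H i = 0))"

text \<open>Let \<open>y'\<close> be a vector with \<open>y'\<^sub>m = 1\<close> that
\<open>A\<close> maps to a multiple of the eigenvector \<open>y\<close> with last entry in place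
\<open>n\<close>. Then \<open>By'\<close> is again killed by \<open>A\<close>, hence a multiple of
\<open>y\<close>. If the multiple is \<open>0\<close>, then \<open>y'\<close> is a kernel vector;
otherwise \<open>left_functional\<close> excludes any other one. The multiple is the entry of
\<open>By'\<close> in place \<open>n\<close>, which is the sum in \<open>Y_sum\<close>.\<close>

lemma linked_kernel_vector:
  assumes n: "n < m" "d n = 0" and d: "\<And>i. i < m \<Longrightarrow> i \<noteq> n \<Longrightarrow> d i \<noteq> 0"
    and e: "eps n = -1" "eps m = -1"
  shows "new_kernel_vector \<longleftrightarrow> vand_sum q (q ^ n * r) (m - n) = 0"
proof -
  obtain y where y: "y n = 1" "\<And>i. n < i \<Longrightarrow> y i = 0" "\<And>i. aop y i = 0" "\<And>i. bop y i = 0"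
    using eigenvector[of n] n d e by (metis less_imp_le less_trans nat_neq_iff)
  define \<mu> where "\<mu> = beta (Suc n) * Y (Suc n)"
  \<comment> \<open>The entry in place \<open>n\<close> is arbitrary, since multiples of \<open>y\<close> may be added. With \<open>0\<close> there, \<open>By'\<close> has the desired sum as its entry in place \<open>n\<close>.\<close>
  define Z where "Z i = (if i = n \<or> m < i then 0 else Y i)" for i
  obtain y' where y': "\<forall>i\<ge>n. y' i = Z i" "\<forall>i<n. d i * y' i + beta (Suc i) * y' (Suc i) = \<mu> * y i"
    using downward_solution[of n d Z beta "\<lambda>i. \<mu> * y i"] d n by auto
  have supp: "y' i = 0" if "m < i" for i using y'(1) that n(1) by (simp add: Z_def)
  have y'm: "y' m = 1" using y'(1) n(1) by (simp add: Z_def Y_m)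
  have a: "aop y' i = \<mu> * y i" for i
  proof -
    consider "i < n" | "i = n" | "n < i" "i < m" | "i = m" | "m < i" by linarith
    then show ?thesis
    proof cases
      case 3
      then show ?thesis using y'(1) y(2)[of i] Y_step[of i] d[of i] by (simp add: aop_def Z_def)
    qed (use y' y n supp in \<open>auto simp: aop_def \<mu>_def Z_def d_m\<close>)
  qed
  have "bop (aop y') i = \<mu> * bop y i" for i
    by (simp add: a bop_def sum_distrib_left mult_ac)
  then have "bop (aop y') i = 0" for i using y(4) by simp
  then have ab: "d i * bop y' i + beta (Suc i) * bop y' (Suc i) = 0" for i
    using aop_bop[of y' i] supp unfolding aop_def[of "bop y'"] by simp
  have up: "bop y' (Suc i) = 0" if "n \<le> i" "i < m" for i
    using that
  proof (induction rule: dec_induct)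
    case base
    then show ?case using ab[of n] n beta_nonzero[of "Suc n"] by simp
  next
    case (step i)
    then show ?case using ab[of "Suc i"] beta_nonzero[of "Suc (Suc i)"] by simp
  qed
  have top: "bop y' i = 0" if "n < i" "i \<le> m" for i
    using up[of "i - 1"] that by (cases i) auto
  have "bop y' n = (\<Sum>j=Suc n..m. B n j * y' j)"
    unfolding bop_def
  proof (rule sum.mono_neutral_right)
    show "\<forall>j\<in>{..m} - {Suc n..m}. B n j * y' j = 0"
    proof
      fix j assume "j \<in> {..m} - {Suc n..m}"
      then have "j < n \<or> j = n" by auto
      then show "B n j * y' j = 0" using y'(1) by (auto simp: B_triangular Z_def)
    qed
  qed auto
  also have "\<dots> = (\<Sum>j=Suc n..m. eps n * (Y j / qfact (j - n) q))"
    by (rule sum.cong[OF refl]) (use y'(1) in \<open>auto simp: B_def C_def Z_def\<close>)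
  also have "\<dots> = - (\<Sum>j=Suc n..m. Y j / qfact (j - n) q)"
    by (simp add: e sum_negf)
  finally have \<nu>: "bop y' n = 0 \<longleftrightarrow> vand_sum q (q ^ n * r) (m - n) = 0"
    using Y_sum[OF n(1)] d by simp
  have "new_kernel_vector \<longleftrightarrow> bop y' n = 0"
  proof
    assume "new_kernel_vector"
    then obtain g where g: "g m \<noteq> 0" "\<And>i. i \<le> m \<Longrightarrow> bop g i = 0"
      by (auto simp: new_kernel_vector_def)
    obtain \<phi> \<psi> where \<phi>: "\<phi> n = 1" "\<And>H. (\<Sum>i=n..<m. \<phi> i * bop H i) = \<psi> * H m"
      using left_functional[OF n] d e by (metis less_not_refl)
    have "(\<Sum>i=n..<m. \<phi> i * bop g i) = 0" using g(2) by (intro sum.neutral) auto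
    then have "\<psi> = 0" using \<phi>(2)[of g] g(1) by simp
    moreover have "(\<Sum>i=n..<m. \<phi> i * bop y' i) = (\<Sum>i\<in>{n}. \<phi> i * bop y' i)"
      using n(1) top by (intro sum.mono_neutral_right) auto
    ultimately show "bop y' n = 0" using \<phi>(1) \<phi>(2)[of y'] by simp
  next
    assume 0: "bop y' n = 0"
    have "bop y' i = 0" if "i \<le> m" for i
      proof (cases "i \<le> n")
      case True
      then show ?thesis using downward_zero[of n d "bop y'" beta i] ab d n 0 by (metis less_trans nat_neq_iff)
    qed (use top that in simp)
    with y'm show "new_kernel_vector" unfolding new_kernel_vector_def by (intro exI[of _ y']) auto
  qed
  with \<nu> show ?thesis by simp
qed

end

section \<open>Kernel vectors and the set J\<close>

text \<open>The condition that an element \<open>n < j\<close> of \<open>J\<close> imposes on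
\<open>j\<close>.\<close>

definition J_condition :: "'k::field \<Rightarrow> 'k \<Rightarrow> nat \<Rightarrow> nat \<Rightarrow> bool" where
  "J_condition q r n j \<longleftrightarrow> (if even (j - n) then qnum ((j - n) div 2) (q ^ (n + j - 1) * r\<^sup>2) = 0
     else qnum (j - n) (- (q ^ ((n + j - 1) div 2) * r)) = 0)"

lemma choose_two_add: "(n + k) choose 2 = (n choose 2) + n * k + (k choose 2)"
  by (induction k) (simp_all add: Suc_choose_two numeral_2_eq_2)

context kernel_setup
begin

lemma in_J_iff:
  "in_J q r s j \<longleftrightarrow> eps j = -1 \<and> (\<forall>n<j. in_J q r s n \<longrightarrow> J_condition q r n j)"
  by (subst in_J.simps) (auto simp: eps_def choose_two J_condition_def)

lemma eps_even:
  "eps (n + 2 * l) = eps n * (q ^ (n + (n + 2 * l) - 1) * r\<^sup>2) ^ l"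
proof -
  have c: "(2 * l choose 2) = l * (2 * l - 1)" by (simp add: choose_two)
  have "n * (2 * l) + (2 * l choose 2) = (n + (n + 2 * l) - 1) * l"
    unfolding c by (cases l) (simp_all add: algebra_simps)
  then have "(n + 2 * l) choose 2 = (n choose 2) + (n + (n + 2 * l) - 1) * l"
    using choose_two_add[of n "2 * l"] by simp
  then show ?thesis by (simp add: eps_def power_add power_mult power_mult_distrib)
qed

lemma eps_odd:
  "eps (n + (2 * l + 1)) = eps n * (- (q ^ (n + l) * r)) ^ (2 * l + 1)"
proof -
  define k where "k = 2 * l + 1"
  have c: "(k choose 2) = l * k" by (simp add: choose_two k_def)
  have e: "(n + k) choose 2 = (n choose 2) + (n + l) * k"
    unfolding choose_two_add[of n k] c by (simp add: k_def algebra_simps)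
  have "eps (n + k) = eps n * ((q ^ (n + l)) ^ k * (- r) ^ k)"
    unfolding eps_def e power_add[of q "n choose 2"] power_add[of "- r"] power_mult
    by (simp only: mult_ac)
  also have "(q ^ (n + l)) ^ k * (- r) ^ k = (- (q ^ (n + l) * r)) ^ k"
    by (simp flip: power_mult_distrib)
  finally show ?thesis by (simp only: k_def)
qed

text \<open>Here \<open>eps j = eps n\<close> says that a power of \<open>z \<noteq> 1\<close>
equals \<open>1\<close>, so the geometric sum of \<open>z\<close> vanishes.\<close>

lemma J_condition_unlinked:
  assumes "n < j" "eps n = -1" "eps j = -1" "q ^ (n + j - 1) * r\<^sup>2 \<noteq> 1"
  shows "J_condition q r n j"
proof -
  obtain k where k: "j = n + k" using assms(1) less_imp_add_positive by blast
  show ?thesis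
  proof (cases "even k")
    case True
    then obtain l where l: "k = 2 * l" by (elim evenE)
    define z where "z = q ^ (n + j - 1) * r\<^sup>2"
    have "z ^ l = 1" using eps_even[of n l] assms(2,3) by (simp add: z_def k l)
    then have "(z - 1) * qnum l z = 0" by (simp add: qnum_times)
    then have "qnum l z = 0" using assms(4) by (simp add: z_def)
    then show ?thesis by (simp add: J_condition_def k l z_def)
  next
    case False
    then obtain l where l: "k = 2 * l + 1" by (elim oddE)
    define z where "z = - (q ^ (n + l) * r)"
    have "z ^ k = 1" using eps_odd[of n l] assms(2,3) by (simp add: z_def k l)
    then have "(z - 1) * qnum k z = 0" by (simp add: qnum_times)
    moreover have e: "n + j - 1 = (n + l) * 2" by (simp add: k l)
    have "z\<^sup>2 = q ^ (n + j - 1) * r\<^sup>2"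
      unfolding z_def e power_mult by (simp add: power_mult_distrib)
    then have "z\<^sup>2 \<noteq> 1" using assms(4) by simp
    then have "z \<noteq> 1" by auto
    ultimately have "qnum k z = 0" by simp
    moreover have "(n + j - 1) div 2 = n + l" by (simp add: k l)
    ultimately show ?thesis by (simp add: J_condition_def k l z_def)
  qed
qed

lemma J_condition_vand_sum:
  assumes "n < j" "j \<le> m"
  shows "vand_sum q (q ^ n * r) (j - n) = 0 \<longleftrightarrow> J_condition q r n j"
proof -
  obtain k where k: "j = n + k" "0 < k" using assms(1) less_imp_add_positive by blast
  have nz: "1 - q ^ i * (q ^ n * r) \<noteq> 0" if "i < k" for i
    using b_factor_nonzero[of "i + n"] that assms(2) k by (simp add: power_add mult.assoc)
  then have p: "q ^ (k choose 2) * (\<Prod>i<k. 1 - q ^ i * (q ^ n * r)) \<noteq> 0"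
    using q0 by simp
  show ?thesis
  proof (cases "even k")
    case True
    then obtain l where l: "k = 2 * l" by (elim evenE)
    have e: "n + j - 1 = 2 * l - 1 + n * 2" using k l by simp
    have "q ^ (2 * l - 1) * (q ^ n * r)\<^sup>2 = q ^ (n + j - 1) * r\<^sup>2"
      unfolding e power_add power_mult by (simp add: power_mult_distrib mult.assoc)
    then show ?thesis using vand_sum_even[of l q "q ^ n * r"] p k l
      by (simp add: J_condition_def)
  next
    case False
    then obtain l where l: "k = 2 * l + 1" by (elim oddE)
    define z where "z = q ^ l * (q ^ n * r)"
    have "(n + j - 1) div 2 = l + n" by (simp add: k l)
    then have "z = q ^ ((n + j - 1) div 2) * r" by (simp add: z_def power_add mult.assoc)
    then have "J_condition q r n j \<longleftrightarrow> qnum k (- z) = 0"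
      using False by (simp add: J_condition_def k)
    moreover have "1 - z \<noteq> 0" using nz[of l] by (simp add: z_def l)
    moreover have "(1 - z) * vand_sum q (q ^ n * r) k =
        q ^ (k choose 2) * (\<Prod>i<k. 1 - q ^ i * (q ^ n * r)) * qnum k (- z)"
      unfolding z_def l by (rule vand_sum_odd)
    moreover have "j - n = k" by (simp add: k)
    moreover have "b = 0 \<longleftrightarrow> d = 0" if "a * b = c * d" "a \<noteq> 0" "c \<noteq> 0" for a b c d :: 'k
      using that by (metis mult_eq_0_iff)
    ultimately show ?thesis using p by metis
  qed
qed

text \<open>In the odd case, \<open>q\<^bsup>n+j-1\<^esup>r\<^sup>2 = 1\<close> leaves a sign in
\<open>q\<^bsup>(n+j-1)/2\<^esup>r\<close>. It is \<open>-1\<close>, since \<open>b\<^sub>m \<noteq>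
0\<close> excludes \<open>1\<close>.\<close>

lemma linked_eps:
  assumes "n < j" "j \<le> m" "q ^ (n + j - 1) * r\<^sup>2 = 1"
  shows "eps j = eps n"
proof -
  obtain k where k: "j = n + k" using assms(1) less_imp_add_positive by blast
  show ?thesis
  proof (cases "even k")
    case True
    then obtain l where l: "k = 2 * l" by (elim evenE)
    then show ?thesis using eps_even[of n l] assms(3) by (simp add: k)
  next
    case False
    then obtain l where l: "k = 2 * l + 1" by (elim oddE)
    define z where "z = q ^ (n + l) * r"
    have e: "n + j - 1 = (n + l) * 2" by (simp add: k l)
    have "z\<^sup>2 = q ^ (n + j - 1) * r\<^sup>2"
      unfolding z_def e power_mult by (simp add: power_mult_distrib)
    then have "z\<^sup>2 = 1" using assms(3) by simp
    then have "z = 1 \<or> z = -1" by (simp add: power2_eq_1_iff)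
    moreover have "z \<noteq> 1" using b_factor_nonzero[of "n + l"] assms(2) by (auto simp: z_def k l)
    ultimately show ?thesis using eps_odd[of n l] by (simp add: k l z_def)
  qed
qed

lemma d_eq_0_iff: "i < m \<Longrightarrow> d i = 0 \<longleftrightarrow> q ^ (i + m - 1) * r\<^sup>2 = 1"
  using qnum_nonzero[of "m - i"] by (auto simp: d_def add.commute)

lemma power_q_neq_1: "q \<noteq> 1 \<Longrightarrow> 0 < i \<Longrightarrow> i \<le> m \<Longrightarrow> q ^ i \<noteq> 1"
  using qnum_nonzero[of i] qnum_times[of q i] by auto

lemma linked_unique:
  assumes "q \<noteq> 1" "i < j" "j \<le> m + i" "q ^ (i + n) * r\<^sup>2 = 1" "q ^ (j + n) * r\<^sup>2 = 1"
  shows False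
proof -
  have "q ^ (j - i) * (q ^ (i + n) * r\<^sup>2) = q ^ (j + n) * r\<^sup>2"
    using assms(2) by (simp flip: power_add mult.assoc)
  then have "q ^ (j - i) = 1" using assms(4,5) by simp
  then show False using power_q_neq_1[of "j - i"] assms(1-3) by simp
qed

text \<open>If \<open>eps m = -1\<close>, the cases are: no \<open>n < m\<close> linked to
\<open>m\<close>; the degenerate case \<open>q = 1, r = -1\<close>; exactly one linked
\<open>n\<close>. In the last case \<open>n\<close> itself lies in \<open>J\<close>, since it is not
linked to a smaller number, so its condition is the only one that can fail.\<close>

lemma new_kernel_vector_iff_in_J: "new_kernel_vector \<longleftrightarrow> in_J q r s m"
proof (cases "eps m = -1")
  case False
  then have "1 + eps m \<noteq> 0" by (simp add: add_eq_0_iff)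
  then have "\<not> new_kernel_vector" unfolding new_kernel_vector_def using bop_m by auto
  then show ?thesis using False in_J_iff[of m] by simp
next
  case e: True
  consider (unlinked) "\<forall>i<m. d i \<noteq> 0" | (one) n where "n < m" "d n = 0" "q = 1"
    | (linked) n where "n < m" "d n = 0" "q \<noteq> 1" by metis
  then show ?thesis
  proof cases
    case unlinked
    then have "\<And>i. i < m \<Longrightarrow> d i \<noteq> 0" by blast
    from eigenvector[OF le_refl d_m this e] obtain y where "y m = 1" "\<And>i. bop y i = 0" by metis
    then have "new_kernel_vector"
      unfolding new_kernel_vector_def by (intro exI[of _ y]) auto
    moreover have "J_condition q r n m" if "n < m" "in_J q r s n" for n
    proof (rule J_condition_unlinked[OF that(1) _ e])
      show "eps n = -1" using that(2) in_J_iff[of n] by blast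
      show "q ^ (n + m - 1) * r\<^sup>2 \<noteq> 1" using unlinked d_eq_0_iff[of n] that(1) by blast
    qed
    ultimately show ?thesis using in_J_iff[of m] e by simp
  next
    case one
    have "r\<^sup>2 = 1" using one d_eq_0_iff by simp
    moreover have "r \<noteq> 1" using b_factor_nonzero[of 0] one by auto
    \<comment> \<open>With \<open>r = -1\<close>, \<open>eps\<close> is constant, so \<open>0 \<in> J\<close>, and \<open>0\<close> excludes \<open>m\<close>, which is not zero in the field.\<close>
    ultimately have r: "r = -1" by (simp add: power2_eq_1_iff)
    have s: "s = -1" using e unfolding eps_def by (simp add: one(3) r)
    have eps: "eps i = -1" for i unfolding eps_def by (simp add: one(3) r s)
    have m: "0 < m" "(of_nat m :: 'k) \<noteq> 0" using qnum_nonzero[of m] one by (auto simp: qnum_def)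
    have "in_J q r s 0" using in_J_iff[of 0] eps by simp
    moreover have "\<not> J_condition q r 0 m"
    proof (cases "even m")
      case True
      then obtain l where "m = 2 * l" by (elim evenE)
      then show ?thesis using m by (simp add: J_condition_def one(3) r qnum_def)
    qed (use m in \<open>simp add: J_condition_def one(3) r qnum_def\<close>)
    ultimately have "\<not> in_J q r s m" using in_J_iff[of m] m by blast
    moreover have "\<not> new_kernel_vector"
    proof
      assume "new_kernel_vector"
      then obtain H where H: "H m \<noteq> 0" "\<And>i. i \<le> m \<Longrightarrow> bop H i = 0"
        by (auto simp: new_kernel_vector_def)
      have "bop H (m - 1) = (\<Sum>j\<in>{m - 1, m}. B (m - 1) j * H j)"
        unfolding bop_def by (rule sum.mono_neutral_right) (auto simp: B_triangular)
      also have "\<dots> = - H m"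
        using m by (simp add: B_def C_def eps qfact_def qnum_def)
      finally show False using H by simp
    qed
    ultimately show ?thesis by simp
  next
    case linked
    have z: "q ^ (n + m - 1) * r\<^sup>2 = 1" using linked d_eq_0_iff by simp
    have en: "eps n = -1" using linked_eps[of n m] linked z e by simp
    have m: "m - 1 < m" using linked(1) by simp
    have other: "d i \<noteq> 0" if "i < m" "i \<noteq> n" for i
    proof
      assume "d i = 0"
      then have "q ^ (i + (m - 1)) * r\<^sup>2 = 1" "q ^ (n + (m - 1)) * r\<^sup>2 = 1"
        using d_eq_0_iff[of i] that z m by simp_all
      then show False using linked_unique[of i n "m - 1"] linked_unique[of n i "m - 1"] that linked
        by (cases "i < n") auto
    qed
    have "in_J q r s n"
    proof -
      have "J_condition q r n' n" if n': "n' < n" "in_J q r s n'" for n'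
      proof (rule J_condition_unlinked[OF n'(1)])
        show "eps n' = -1" using n'(2) in_J_iff[of n'] by blast
        show "q ^ (n' + n - 1) * r\<^sup>2 \<noteq> 1"
        proof
          assume "q ^ (n' + n - 1) * r\<^sup>2 = 1"
          then show False using linked_unique[of n' m "n - 1"] z n'(1) linked
            by (simp add: add.commute)
        qed
      qed (rule en)
      then show ?thesis using in_J_iff[of n] en by blast
    qed
    moreover have "J_condition q r n' m" if "n' < m" "n' \<noteq> n" "in_J q r s n'" for n'
    proof (rule J_condition_unlinked[OF that(1) _ e])
      show "eps n' = -1" using that(3) in_J_iff[of n'] by blast
      show "q ^ (n' + m - 1) * r\<^sup>2 \<noteq> 1" using other[of n'] d_eq_0_iff[of n'] that by blast
    qed
    ultimately have "in_J q r s m \<longleftrightarrow> J_condition q r n m"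
      using in_J_iff[of m] e linked(1) by blast
    also have "\<dots> \<longleftrightarrow> vand_sum q (q ^ n * r) (m - n) = 0"
      using J_condition_vand_sum[of n m] linked by simp
    also have "\<dots> \<longleftrightarrow> new_kernel_vector"
      using linked_kernel_vector[of n] linked other en e by blast
    finally show ?thesis by simp
  qed
qed

end

section \<open>Skew derivations of the free algebra\<close>

abbreviation (input) "lookup \<equiv> Poly_Mapping.lookup"
abbreviation (input) "single \<equiv> Poly_Mapping.single"
abbreviation (input) "keys \<equiv> Poly_Mapping.keys"

abbreviation lin :: "(('a \<Rightarrow>\<^sub>0 'k::field) \<Rightarrow> ('b \<Rightarrow>\<^sub>0 'k)) \<Rightarrow> bool" where
  "lin \<equiv> module_hom scale scale"

lemma linI:
  assumes "\<And>a b. F (a + b) = F a + F b" "\<And>c a. F (scale c a) = scale c (F a)"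
  shows "lin F"
  unfolding module_hom_iff by (intro conjI pm.module_axioms allI assms)

lemma expand: "a = (\<Sum>w\<in>keys a. scale (lookup a w) (single w 1))"
  by (rule poly_mapping_eqI)
    (simp add: lookup_sum lookup_single when_def in_keys_iff if_distrib if_distribR cong: if_cong)

lemma lin_expand:
  assumes "lin F"
  shows "F a = (\<Sum>w\<in>keys a. scale (lookup a w) (F (single w 1)))"
  using arg_cong[OF expand[of a], of F]
  by (simp add: module_hom.sum[OF assms] module_hom.scale[OF assms])

lemma lin_eqI:
  assumes "lin F" "lin G" "\<And>w. w \<in> keys a \<Longrightarrow> F (single w 1) = G (single w 1)"
  shows "F a = G a"
  unfolding lin_expand[OF assms(1), of a] lin_expand[OF assms(2), of a]
  by (rule sum.cong) (simp_all add: assms(3))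

definition lin_ext :: "('a \<Rightarrow> ('b \<Rightarrow>\<^sub>0 'k)) \<Rightarrow> ('a \<Rightarrow>\<^sub>0 'k::field) \<Rightarrow> ('b \<Rightarrow>\<^sub>0 'k)" where
  "lin_ext f a = (\<Sum>w\<in>keys a. scale (lookup a w) (f w))"

lemma lin_ext_superset:
  "finite A \<Longrightarrow> keys a \<subseteq> A \<Longrightarrow> lin_ext f a = (\<Sum>w\<in>A. scale (lookup a w) (f w))"
  unfolding lin_ext_def by (rule sum.mono_neutral_left) (auto simp: in_keys_iff)

lemma lin_lin_ext:
  fixes f :: "'a \<Rightarrow> ('b \<Rightarrow>\<^sub>0 'k::field)"
  shows "lin (lin_ext f)"
proof (rule linI)
  fix a b :: "'a \<Rightarrow>\<^sub>0 'k"
  have "keys (a + b) \<subseteq> keys a \<union> keys b" by (rule keys_add)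
  then show "lin_ext f (a + b) = lin_ext f a + lin_ext f b"
    by (simp add: lin_ext_superset[of "keys a \<union> keys b"] Poly_Mapping.lookup_add pm.scale_left_distrib sum.distrib)
next
  fix c and a :: "'a \<Rightarrow>\<^sub>0 'k"
  have "keys (scale c a) \<subseteq> keys a" by (auto simp: in_keys_iff)
  then show "lin_ext f (scale c a) = scale c (lin_ext f a)"
    by (simp add: lin_ext_superset[of "keys a"] pm.scale_sum_right)
qed

lemma lin_ext_single: "lin_ext f (single w 1) = f w"
  by (simp add: lin_ext_def)

lemma scale_single: "scale c (single w d) = single w (c * d)"
  by (simp add: scale_def)

lemma scale_mult: "scale c a * b = scale c (a * b)" "a * scale c b = scale c (a * b)"
  for a b :: "'k::field tensor_alg"
proof -
  have s: "scale c a = single 0 c * a" for a :: "'k tensor_alg"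
    by (simp add: scale_def mult_map_scale_conv_mult)
  show "scale c a * b = scale c (a * b)" by (simp add: s mult.assoc)
  have c: "a * single 0 c = scale c a"
  proof -
    have "a * single 0 c = (\<Sum>w\<in>keys a. scale (lookup a w) (single w 1) * single 0 c)"
      using arg_cong[OF expand[of a], of "\<lambda>x. x * single 0 c"] by (simp add: sum_distrib_right)
    also have "\<dots> = (\<Sum>w\<in>keys a. scale c (scale (lookup a w) (single w 1)))"
      by (simp add: scale_single mult_single mult_ac)
    also have "\<dots> = scale c a" unfolding pm.scale_sum_right[symmetric] expand[symmetric] ..
    finally show ?thesis .
  qed
  have "a * scale c b = (a * single 0 c) * b" by (simp add: s mult.assoc)
  then show "a * scale c b = scale c (a * b)" by (simp add: c s mult.assoc)
qed

lemma single_Cons: "single (x # w) (1::'k::field) = single [x] 1 * single w 1"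
  by (simp add: mult_single plus_list_def)

lemma lookup_letter_mult:
  fixes b :: "'k::field tensor_alg"
  shows "lookup (single [x] 1 * b) v = (case v of [] \<Rightarrow> 0 | z # v' \<Rightarrow> if z = x then lookup b v' else 0)"
proof -
  have "single [x] 1 * b = (\<Sum>w\<in>keys b. single [x] 1 * scale (lookup b w) (single w 1))"
    using arg_cong[OF expand[of b], of "\<lambda>y. single [x] 1 * y"] by (simp add: sum_distrib_left)
  then have "lookup (single [x] 1 * b) v = (\<Sum>w\<in>keys b. lookup b w * (1 when x # w = v))"
    by (simp add: lookup_sum scale_mult mult_single plus_list_def lookup_single)
  also have "\<dots> = (case v of [] \<Rightarrow> 0 | z # v' \<Rightarrow> if z = x then lookup b v' else 0)"
  proof (cases v)
    case (Cons z v')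
    have "(\<Sum>w\<in>keys b. lookup b w * (1 when x # w = v)) =
        (\<Sum>w\<in>keys b. if w = v' then (if z = x then lookup b v' else 0) else 0)"
      by (rule sum.cong) (auto simp: Cons when_def)
    then show ?thesis by (simp add: Cons in_keys_iff)
  qed simp
  finally show ?thesis .
qed

definition hom :: "int \<times> int \<Rightarrow> 'k::field tensor_alg \<Rightarrow> bool" where
  "hom \<alpha> a \<longleftrightarrow> (\<forall>w. lookup a w \<noteq> 0 \<longrightarrow> deg w = \<alpha>)"

lemma hom_0: "hom \<alpha> 0" by (simp add: hom_def)
lemma hom_add: "hom \<alpha> a \<Longrightarrow> hom \<alpha> b \<Longrightarrow> hom \<alpha> (a + b)"
  by (auto simp: hom_def Poly_Mapping.lookup_add) (metis add_0)
lemma hom_scale: "hom \<alpha> a \<Longrightarrow> hom \<alpha> (scale c a)"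
  by (auto simp: hom_def)
lemma hom_diff: "hom \<alpha> a \<Longrightarrow> hom \<alpha> b \<Longrightarrow> hom \<alpha> (a - b)"
  by (auto simp: hom_def lookup_minus) (metis diff_self)
lemma hom_sum: "(\<And>i. i \<in> A \<Longrightarrow> hom \<alpha> (f i)) \<Longrightarrow> hom \<alpha> (sum f A)"
  by (induction A rule: infinite_finite_induct) (auto intro: hom_0 hom_add)
lemma hom_single: "hom (deg w) (single w c)"
  by (auto simp: hom_def lookup_single when_def)

lemma deg_append: "deg (u @ v) = deg u + deg v"
  by (induction u rule: deg.induct) (simp_all add: add.assoc)

lemma deg_Cons: "deg (x # w) = deg [x] + deg w"
  by (cases x) simp_all

lemma hom_mult:
  assumes "hom \<alpha> a" "hom \<beta> b"
  shows "hom (\<alpha> + \<beta>) (a * b)"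
proof -
  have "a * b = (\<Sum>u\<in>keys a. \<Sum>v\<in>keys b. scale (lookup a u) (single u 1) * scale (lookup b v) (single v 1))"
    using arg_cong2[OF expand[of a] expand[of b], of "(*)"] by (simp add: sum_product)
  also have "hom (\<alpha> + \<beta>) \<dots>"
  proof (intro hom_sum)
    fix u v assume "u \<in> keys a" "v \<in> keys b"
    then have "deg (u @ v) = \<alpha> + \<beta>" using assms by (simp add: hom_def in_keys_iff deg_append)
    then show "hom (\<alpha> + \<beta>) (scale (lookup a u) (single u 1) * scale (lookup b v) (single v 1))"
      using hom_single[of "u @ v"] by (simp add: scale_single mult_single plus_list_def)
  qed
  finally show ?thesis .
qed

locale braiding =
  fixes Q :: "letter \<Rightarrow> letter \<Rightarrow> 'k::field"
  assumes Q_nonzero: "\<And>i j. Q i j \<noteq> 0"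
begin

abbreviation chi :: "int \<times> int \<Rightarrow> int \<times> int \<Rightarrow> 'k" where
  "chi \<equiv> bichar Q"

lemma chi_add_right: "chi \<alpha> (\<beta> + \<beta>') = chi \<alpha> \<beta> * chi \<alpha> \<beta>'"
  by (simp add: bichar_def distrib_left power_int_add Q_nonzero)

lemma chi_0_left: "chi 0 \<beta> = 1"
  by (simp add: bichar_def)

lemma chi_0_right: "chi \<alpha> 0 = 1"
  by (simp add: bichar_def)

fun D_word :: "letter \<Rightarrow> word \<Rightarrow> 'k tensor_alg" where
  "D_word y [] = 0"
| "D_word y (x # w) = single [x] 1 * D_word y w +
     (if x = y then scale (chi (deg [x]) (deg w)) (single w 1) else 0)"

text \<open>The right skew derivations: \<open>D y a\<close> is the coefficient of \<open>y\<close>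
in the part of the coproduct of \<open>a\<close> whose right tensor factor has length 1
(\<open>D_eq_right_slice\<close>).\<close>

definition D :: "letter \<Rightarrow> 'k tensor_alg \<Rightarrow> 'k tensor_alg" where
  "D y = lin_ext (D_word y)"

lemma lin_D: "lin (D y)"
  unfolding D_def by (rule lin_lin_ext)

lemmas D_add = module_hom.add[OF lin_D]
  and D_scale = module_hom.scale[OF lin_D]
  and D_sum = module_hom.sum[OF lin_D]
  and D_0 = module_hom.zero[OF lin_D]
  and D_diff = module_hom.diff[OF lin_D]

lemma D_single: "D y (single w 1) = D_word y w"
  by (simp add: D_def lin_ext_single)

lemma D_letter_mult:
  assumes "hom \<beta> b"
  shows "D y (single [x] 1 * b) =
    single [x] 1 * D y b + (if x = y then scale (chi (deg [x]) \<beta>) b else 0)"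
proof (rule lin_eqI[where a = b and F = "\<lambda>b. D y (single [x] 1 * b)" and
    G = "\<lambda>b. single [x] 1 * D y b + (if x = y then scale (chi (deg [x]) \<beta>) b else 0)"])
  show "lin (\<lambda>b. D y (single [x] 1 * b))"
    by (rule linI) (simp_all add: distrib_left D_add scale_mult D_scale)
  show "lin (\<lambda>b. single [x] 1 * D y b + (if x = y then scale (chi (deg [x]) \<beta>) b else 0))"
    by (rule linI) (auto simp: distrib_left D_add scale_mult D_scale pm.scale_right_distrib mult.commute)
  fix w assume "w \<in> keys b"
  then have "deg w = \<beta>" using assms by (auto simp: hom_def in_keys_iff)
  then show "D y (single [x] 1 * single w 1) =
      single [x] 1 * D y (single w 1) + (if x = y then scale (chi (deg [x]) \<beta>) (single w 1) else 0)"
    by (simp add: D_single single_Cons[of x w, symmetric])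
qed

lemma D_mult:
  assumes "hom \<beta> b"
  shows "D y (a * b) = a * D y b + scale (chi (deg [y]) \<beta>) (D y a * b)"
proof (rule lin_eqI[where a = a and F = "\<lambda>a. D y (a * b)" and
    G = "\<lambda>a. a * D y b + scale (chi (deg [y]) \<beta>) (D y a * b)"])
  show "lin (\<lambda>a. D y (a * b))"
    by (rule linI) (simp_all add: distrib_right D_add scale_mult D_scale)
  show "lin (\<lambda>a. a * D y b + scale (chi (deg [y]) \<beta>) (D y a * b))"
    by (rule linI) (auto simp: distrib_right D_add scale_mult D_scale pm.scale_right_distrib mult.commute add_ac)
  fix w
  show "D y (single w 1 * b) = single w 1 * D y b + scale (chi (deg [y]) \<beta>) (D y (single w 1) * b)"
  proof (induction w)
    case Nil
    have "single [] 1 = (1 :: 'k tensor_alg)" by (simp add: zero_list_def[symmetric])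
    then show ?case using D_single[of y "[]"] by simp
  next
    case (Cons x w)
    have h: "hom (deg w + \<beta>) (single w 1 * b)" by (rule hom_mult[OF hom_single assms])
    have h': "hom (deg w) (single w (1::'k))" by (rule hom_single)
    show ?case
      unfolding single_Cons[of x w] mult.assoc D_letter_mult[OF h] D_letter_mult[OF h'] Cons.IH
      by (auto simp: distrib_left distrib_right scale_mult pm.scale_right_distrib chi_add_right mult_ac)
  qed
qed

lemma hom_D_word: "hom (deg w - deg [y]) (D_word y w)"
proof (induction w)
  case (Cons x w)
  have "hom (deg [x] + (deg w - deg [y])) (single [x] 1 * D_word y w)"
    by (rule hom_mult[OF hom_single Cons.IH])
  then have "hom (deg (x # w) - deg [y]) (single [x] 1 * D_word y w)"
    by (simp only: deg_Cons[of x w] add_diff_eq)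
  moreover have "hom (deg (y # w) - deg [y]) (scale c (single w 1))" for c :: 'k
    using hom_scale[OF hom_single[of w]] by (simp add: deg_Cons[of y w])
  ultimately show ?case by (auto intro!: hom_add hom_0 simp del: deg.simps)
qed (simp add: hom_0)

lemma hom_D:
  assumes "hom \<alpha> a"
  shows "hom (\<alpha> - deg [y]) (D y a)"
  unfolding D_def lin_ext_def
proof (intro hom_sum hom_scale)
  fix w assume "w \<in> keys a"
  then have "deg w = \<alpha>" using assms by (auto simp: hom_def in_keys_iff)
  then show "hom (\<alpha> - deg [y]) (D_word y w)" using hom_D_word[of w y] by simp
qed

end

section \<open>The Nichols ideal\<close>

text \<open>A tensor \<open>t\<close> is \<open>\<Sum> u \<otimes> slice t u\<close>, the sum being
over the words \<open>u\<close>.\<close>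

definition slice :: "'k::field tensor_sq \<Rightarrow> word \<Rightarrow> 'k tensor_alg" where
  "slice t u = Poly_Mapping.map_key (Pair u) t"

definition right_slice :: "'k::field tensor_sq \<Rightarrow> word \<Rightarrow> 'k tensor_alg" where
  "right_slice t v = Poly_Mapping.map_key (\<lambda>u. (u, v)) t"

lemma lookup_slice [simp]: "lookup (slice t u) v = lookup t (u, v)"
  by (simp add: slice_def Poly_Mapping.map_key.rep_eq inj_on_def)

lemma lookup_right_slice [simp]: "lookup (right_slice t v) u = lookup t (u, v)"
  by (simp add: right_slice_def Poly_Mapping.map_key.rep_eq inj_on_def)

lemma lin_slice: "lin (\<lambda>t. slice t u)"
  by (rule linI; rule poly_mapping_eqI) (simp_all add: Poly_Mapping.lookup_add)

lemma lin_right_slice: "lin (\<lambda>t. right_slice t v)"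
  by (rule linI; rule poly_mapping_eqI) (simp_all add: Poly_Mapping.lookup_add)

lemma lookup_tensor: "lookup (tensor b c) (u, v) = lookup b u * lookup c v"
proof -
  have "lookup (tensor b c) (u, v) =
      (\<Sum>u'\<in>keys b. \<Sum>v'\<in>keys c. if v' = v then (if u' = u then lookup b u * lookup c v else 0) else 0)"
    unfolding tensor_def lookup_sum
    by (intro sum.cong refl) (auto simp: lookup_single when_def)
  also have "\<dots> = lookup b u * lookup c v"
    by (cases "lookup c v = 0") (simp_all add: in_keys_iff)
  finally show ?thesis .
qed

lemma lin_compose: "lin F \<Longrightarrow> lin G \<Longrightarrow> lin (\<lambda>a. F (G a))"
  by (rule linI) (simp_all add: module_hom.add module_hom.scale)

lemma lin_scale_fun: "lin F \<Longrightarrow> lin (\<lambda>a. scale c (F a))"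
  by (rule linI) (simp_all add: module_hom.add module_hom.scale pm.scale_right_distrib mult.commute)

lemma lin_add_fun: "lin F \<Longrightarrow> lin G \<Longrightarrow> lin (\<lambda>a. F a + G a)"
  by (rule linI) (simp_all add: module_hom.add module_hom.scale pm.scale_right_distrib)

lemma lin_zero_fun: "lin (\<lambda>a. 0)"
  by (rule linI) simp_all

lemma lin_left_mult: "lin (\<lambda>a. x * a)" for x :: "'k::field tensor_alg"
  by (rule linI) (simp_all add: distrib_left scale_mult)

context braiding
begin

lemma lookup_coprod_Cons:
  "lookup (coprod_word Q (x # w)) (u, v) =
    (case u of [] \<Rightarrow> 0 | z # u' \<Rightarrow> if z = x then lookup (coprod_word Q w) (u', v) else 0) +
    (case v of [] \<Rightarrow> 0 | z # v' \<Rightarrow> if z = x then chi (deg [x]) (deg u) * lookup (coprod_word Q w) (u, v') else 0)"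
proof -
  define t where "t = coprod_word Q w"
  define s where "s = single ([x], []) (1::'k) + single ([], [x]) 1"
  have ks: "keys s = {([x], []), ([], [x])}"
    by (auto simp: s_def in_keys_iff Poly_Mapping.lookup_add lookup_single when_def split: if_splits)
  have ls: "lookup s ([x], []) = 1" "lookup s ([], [x]) = 1"
    by (simp_all add: s_def Poly_Mapping.lookup_add lookup_single)
  have "coprod_word Q (x # w) = braided_mult Q s t" by (simp add: s_def t_def)
  also have "\<dots> = (\<Sum>p\<in>keys t. single (x # fst p, snd p) (lookup t p)) +
     (\<Sum>p\<in>keys t. single (fst p, x # snd p) (lookup t p * chi (deg [x]) (deg (fst p))))"
    unfolding braided_mult_def ks
    by (simp add: ls case_prod_beta chi_0_left del: deg.simps(2,3))
  finally have "lookup (coprod_word Q (x # w)) (u, v) =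
      (\<Sum>p\<in>keys t. lookup t p when (x # fst p, snd p) = (u, v)) +
      (\<Sum>p\<in>keys t. lookup t p * chi (deg [x]) (deg (fst p)) when (fst p, x # snd p) = (u, v))"
    by (simp add: Poly_Mapping.lookup_add lookup_sum lookup_single del: prod.inject)
  moreover have "(\<Sum>p\<in>keys t. lookup t p when (x # fst p, snd p) = (u, v)) =
      (case u of [] \<Rightarrow> 0 | z # u' \<Rightarrow> if z = x then lookup t (u', v) else 0)"
  proof (cases u)
    case (Cons z u')
    have "(\<Sum>p\<in>keys t. lookup t p when (x # fst p, snd p) = (u, v)) =
        (\<Sum>p\<in>keys t. if p = (u', v) then (if z = x then lookup t (u', v) else 0) else 0)"
      by (rule sum.cong) (auto simp: Cons when_def)
    then show ?thesis by (simp add: Cons in_keys_iff)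
  qed simp
  moreover have "(\<Sum>p\<in>keys t. lookup t p * chi (deg [x]) (deg (fst p)) when (fst p, x # snd p) = (u, v)) =
      (case v of [] \<Rightarrow> 0 | z # v' \<Rightarrow> if z = x then chi (deg [x]) (deg u) * lookup t (u, v') else 0)"
  proof (cases v)
    case (Cons z v')
    have "(\<Sum>p\<in>keys t. lookup t p * chi (deg [x]) (deg (fst p)) when (fst p, x # snd p) = (u, v)) =
        (\<Sum>p\<in>keys t. if p = (u, v') then (if z = x then chi (deg [x]) (deg u) * lookup t (u, v') else 0) else 0)"
      by (rule sum.cong) (auto simp: Cons when_def mult.commute)
    then show ?thesis by (simp add: Cons in_keys_iff)
  qed simp
  ultimately show ?thesis by (simp only: t_def)
qed

declare coprod_word.simps(2) [simp del]

lemma coprod_lin_ext: "coprod Q = lin_ext (coprod_word Q)"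
  by (rule ext) (simp add: coprod_def lin_ext_def)

lemma lin_coprod: "lin (coprod Q)"
  unfolding coprod_lin_ext by (rule lin_lin_ext)

lemma coprod_single: "coprod Q (single w 1) = coprod_word Q w"
  unfolding coprod_lin_ext by (rule lin_ext_single)

lemma deg_coprod: "lookup (coprod_word Q w) (u, v) \<noteq> 0 \<Longrightarrow> deg w = deg u + deg v"
proof (induction w arbitrary: u v)
  case Nil
  then show ?case by (auto simp: lookup_single when_def split: if_splits)
next
  case (Cons x w)
  have ass: "deg [x] + (a + b) = (deg [x] + a) + b" "deg [x] + (a + b) = a + (deg [x] + b)" for a b :: "int \<times> int"
    by (simp_all only: add_ac)
  from Cons.prems have "(case u of [] \<Rightarrow> 0 | z # u' \<Rightarrow> if z = x then lookup (coprod_word Q w) (u', v) else 0) \<noteq> 0 \<or>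
      (case v of [] \<Rightarrow> 0 | z # v' \<Rightarrow> if z = x then chi (deg [x]) (deg u) * lookup (coprod_word Q w) (u, v') else 0) \<noteq> 0"
    unfolding lookup_coprod_Cons by auto
  then consider
    u' where "u = x # u'" "lookup (coprod_word Q w) (u', v) \<noteq> 0"
    | v' where "v = x # v'" "lookup (coprod_word Q w) (u, v') \<noteq> 0"
    by (auto split: list.splits if_splits)
  then show ?case
  proof cases
    case 1
    then show ?thesis unfolding 1(1) deg_Cons[of x w] deg_Cons[of x u'] using Cons.IH ass by metis
  next
    case 2
    then show ?thesis unfolding 2(1) deg_Cons[of x w] deg_Cons[of x v'] using Cons.IH ass by metis
  qed
qed

lemma counit_right: "lookup (coprod Q a) (u, []) = lookup a u"
proof -
  have w: "lookup (coprod_word Q w) (u, []) = (if u = w then 1 else 0)" for w u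
  proof (induction w arbitrary: u)
    case (Cons x w)
    show ?case unfolding lookup_coprod_Cons by (cases u) (auto simp: Cons.IH)
  qed (simp add: lookup_single when_def)
  have "right_slice (coprod Q a) [] = a"
  proof (rule lin_eqI[where F = "\<lambda>a. right_slice (coprod Q a) []" and G = "\<lambda>a. a"])
    show "lin (\<lambda>a. right_slice (coprod Q a) [])"
      by (rule lin_compose[OF lin_right_slice lin_coprod])
    show "lin (\<lambda>a :: 'k tensor_alg. a)" by (rule linI) simp_all
    show "right_slice (coprod Q (single u 1)) [] = single u 1" for u
      by (rule poly_mapping_eqI) (simp add: coprod_single w lookup_single when_def)
  qed
  then show ?thesis by (metis lookup_right_slice)
qed

lemma counit_left: "lookup (coprod Q a) ([], v) = lookup a v"
proof -
  have w: "lookup (coprod_word Q w) ([], v) = (if v = w then 1 else 0)" for w v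
  proof (induction w arbitrary: v)
    case (Cons x w)
    show ?case unfolding lookup_coprod_Cons by (cases v) (auto simp: Cons.IH chi_0_right)
  qed (simp add: lookup_single when_def)
  have "slice (coprod Q a) [] = a"
  proof (rule lin_eqI[where F = "\<lambda>a. slice (coprod Q a) []" and G = "\<lambda>a. a"])
    show "lin (\<lambda>a. slice (coprod Q a) [])"
      by (rule lin_compose[OF lin_slice lin_coprod])
    show "lin (\<lambda>a :: 'k tensor_alg. a)" by (rule linI) simp_all
    show "slice (coprod Q (single u 1)) [] = single u 1" for u
      by (rule poly_mapping_eqI) (simp add: coprod_single w lookup_single when_def)
  qed
  then show ?thesis by (metis lookup_slice)
qed

lemma D_eq_right_slice: "D y a = right_slice (coprod Q a) [y]"
proof (rule lin_eqI[where F = "D y" and G = "\<lambda>a. right_slice (coprod Q a) [y]"])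
  show "lin (\<lambda>a. right_slice (coprod Q a) [y])"
    by (rule lin_compose[OF lin_right_slice lin_coprod])
  have c: "lookup (coprod_word Q w) (u, []) = (if u = w then 1 else 0)" for w u
    using counit_right[of "single w 1" u] by (simp add: coprod_single lookup_single when_def)
  have "lookup (D_word y w) u = lookup (coprod_word Q w) (u, [y])" for w u
  proof (induction w arbitrary: u)
    case (Cons x w)
    show ?case unfolding lookup_coprod_Cons D_word.simps Poly_Mapping.lookup_add lookup_letter_mult
      by (cases "x = y"; cases u) (simp_all add: Cons.IH c lookup_single when_def)
  qed (simp add: lookup_single)
  then show "D y (single w 1) = right_slice (coprod Q (single w 1)) [y]" for w
    by (intro poly_mapping_eqI) (simp add: D_single coprod_single)
qed (rule lin_D)

text \<open>Multiplication by \<open>x \<otimes> 1 + 1 \<otimes> x\<close> from the left, in terms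
of slices.\<close>

definition slice_step :: "letter \<Rightarrow> word \<Rightarrow> 'k tensor_sq \<Rightarrow> 'k tensor_alg" where
  "slice_step x u t = (case u of [] \<Rightarrow> 0 | z # u' \<Rightarrow> if z = x then slice t u' else 0) +
     scale (chi (deg [x]) (deg u)) (single [x] 1 * slice t u)"

lemma lin_slice_step: "lin (slice_step x u)"
proof -
  have "lin (\<lambda>t :: 'k tensor_sq. case u of [] \<Rightarrow> 0 | z # u' \<Rightarrow> if z = x then slice t u' else 0)"
  proof (cases u)
    case (Cons z u')
    then show ?thesis by (cases "z = x") (simp_all add: lin_zero_fun lin_slice)
  qed (simp add: lin_zero_fun)
  then show ?thesis unfolding slice_step_def
    by (intro lin_add_fun lin_scale_fun lin_compose[OF lin_left_mult lin_slice])
qed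

lemma slice_coprod_letter_mult:
  "slice (coprod Q (single [x] 1 * a)) u = slice_step x u (coprod Q a)"
proof (rule lin_eqI[where F = "\<lambda>a. slice (coprod Q (single [x] 1 * a)) u"
      and G = "\<lambda>a. slice_step x u (coprod Q a)"])
  show "lin (\<lambda>a. slice (coprod Q (single [x] 1 * a)) u)"
    by (rule lin_compose[OF lin_compose[OF lin_slice lin_coprod] lin_left_mult])
  show "lin (\<lambda>a. slice_step x u (coprod Q a))"
    by (rule lin_compose[OF lin_slice_step lin_coprod])
  fix w
  show "slice (coprod Q (single [x] 1 * single w 1)) u = slice_step x u (coprod Q (single w 1))"
    unfolding single_Cons[symmetric] coprod_single
    by (rule poly_mapping_eqI)
      (auto simp: lookup_coprod_Cons slice_step_def Poly_Mapping.lookup_add lookup_letter_mult split: list.split)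
qed

text \<open>Coassociativity for right tensor factors of length 1: \<open>(id \<otimes>
D\<^sub>y)\<Delta> = \<Delta>D\<^sub>y\<close>.\<close>

lemma slice_coprod_D: "slice (coprod Q (D y a)) u = D y (slice (coprod Q a) u)"
proof (rule lin_eqI[where F = "\<lambda>a. slice (coprod Q (D y a)) u"
      and G = "\<lambda>a. D y (slice (coprod Q a) u)"])
  show "lin (\<lambda>a. slice (coprod Q (D y a)) u)"
    by (rule lin_compose[OF lin_compose[OF lin_slice lin_coprod] lin_D])
  show "lin (\<lambda>a. D y (slice (coprod Q a) u))"
    by (rule lin_compose[OF lin_D lin_compose[OF lin_slice lin_coprod]])
  fix w
  show "slice (coprod Q (D y (single w 1))) u = D y (slice (coprod Q (single w 1)) u)"
    unfolding D_single coprod_single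
  proof (induction w arbitrary: u)
    case Nil
    have "slice (coprod_word Q []) u = (if u = [] then single [] 1 else 0)"
      by (rule poly_mapping_eqI) (auto simp: lookup_single when_def)
    then have "D y (slice (coprod_word Q []) u) = 0"
      by (simp add: D_single D_0)
    then show ?case
      by (simp add: module_hom.zero[OF lin_coprod] module_hom.zero[OF lin_slice])
  next
    case (Cons x w)
    define t where "t = coprod_word Q w"
    have h: "hom (deg w - deg u) (slice t u)"
      using deg_coprod[of w u] by (auto simp: hom_def t_def)
    have st: "slice (coprod_word Q (x # w)) u = slice_step x u t"
      using slice_coprod_letter_mult[of x "single w 1" u]
      by (simp add: t_def coprod_single single_Cons[of x w, symmetric])
    have c: "chi (deg [x]) b * chi (deg [x]) (deg w - b) = chi (deg [x]) (deg w)" for x b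
      by (simp flip: chi_add_right)
    have "D y (slice_step x u t) = slice_step x u (coprod Q (D_word y w)) +
        (if x = y then scale (chi (deg [x]) (deg w)) (slice t u) else 0)"
      using D_letter_mult[OF h, of y x]
      by (cases "x = y"; cases u) (simp_all add: slice_step_def D_add D_scale D_0 Cons.IH[folded t_def]
        pm.scale_right_distrib c chi_0_left chi_0_right add_ac del: deg.simps)
    also have "\<dots> = slice (coprod Q (D_word y (x # w))) u"
      by (simp add: module_hom.add[OF lin_coprod] module_hom.add[OF lin_slice] slice_coprod_letter_mult
        module_hom.scale[OF lin_coprod] module_hom.scale[OF lin_slice] module_hom.zero[OF lin_coprod]
        module_hom.zero[OF lin_slice] coprod_single t_def del: deg.simps)
    finally show ?case unfolding st by simp
  qed
qed

definition D_kernel :: "'k tensor_alg set" where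
  "D_kernel = {c. lookup c [] = 0 \<and> (\<forall>y. D y c = 0)}"

text \<open>By \<open>slice_coprod_D\<close>, the derivations kill the right factors in
\<open>\<Delta>c = \<Sum> u \<otimes> d\<^sub>u\<close>. The constant term of
\<open>d\<^sub>u\<close> is the coefficient of \<open>u\<close> in \<open>c\<close>, so after
splitting off \<open>c \<otimes> 1\<close> all right factors lie in \<open>D_kernel\<close>.\<close>

lemma coprod_D_kernel:
  assumes "c \<in> D_kernel"
  shows "coprod Q c \<in> pm.span {tensor b d | b d. b \<in> D_kernel \<or> d \<in> D_kernel}"
proof -
  define d where "d u = slice (coprod Q c) u - single [] (lookup c u)" for u
  have d: "d u \<in> D_kernel" for u
  proof -
    have "lookup (d u) [] = 0" by (simp add: d_def lookup_minus counit_right)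
    moreover have "D y (d u) = 0" for y
    proof -
      have e: "single [] (lookup c u) = scale (lookup c u) (single [] 1)" by (simp add: scale_single)
      have "D y (single [] (lookup c u)) = 0" unfolding e D_scale D_single by simp
      moreover have "D y c = 0" using assms by (simp add: D_kernel_def)
      then have "D y (slice (coprod Q c) u) = 0"
        using slice_coprod_D[of y c u]
        by (simp add: module_hom.zero[OF lin_coprod] module_hom.zero[OF lin_slice])
      ultimately show ?thesis by (simp add: d_def D_diff)
    qed
    ultimately show ?thesis by (simp add: D_kernel_def)
  qed
  define U where "U = fst ` keys (coprod Q c) \<union> keys c"
  have U: "finite U" by (simp add: U_def)
  have "coprod Q c = tensor c (single [] 1) + (\<Sum>u\<in>U. tensor (single u 1) (d u))"
  proof (rule poly_mapping_eqI)
    fix p :: "word \<times> word"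
    obtain u v where p: "p = (u, v)" by force
    have "lookup (\<Sum>u\<in>U. tensor (single u 1) (d u)) p = (\<Sum>u'\<in>U. if u' = u then lookup (d u) v else 0)"
      unfolding lookup_sum p lookup_tensor
      by (rule sum.cong) (auto simp: lookup_single when_def)
    also have "\<dots> = (if u \<in> U then lookup (d u) v else 0)" using U by simp
    also have "\<dots> = lookup (coprod Q c) p - lookup c u * (1 when [] = v)"
    proof (cases "u \<in> U")
      case True
      then show ?thesis by (simp add: d_def lookup_minus lookup_single p when_def)
    next
      case False
      then have "p \<notin> keys (coprod Q c)" "u \<notin> keys c" by (force simp: U_def p)+
      then show ?thesis using False by (simp add: in_keys_iff)
    qed
    finally show "lookup (coprod Q c) p =
        lookup (tensor c (single [] 1) + (\<Sum>u\<in>U. tensor (single u 1) (d u))) p"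
      by (simp add: Poly_Mapping.lookup_add p lookup_tensor lookup_single)
  qed
  also have "\<dots> \<in> pm.span {tensor b d | b d. b \<in> D_kernel \<or> d \<in> D_kernel}"
    using assms d by (intro pm.span_add pm.span_sum pm.span_base) auto
  finally show ?thesis .
qed

lemma subspace_D_kernel: "pm.subspace D_kernel"
  by (rule pm.subspaceI) (auto simp: D_kernel_def D_0 D_add D_scale Poly_Mapping.lookup_add)

lemma D_kernel_subset_nichols_ideal: "D_kernel \<subseteq> nichols_ideal Q"
proof -
  have "2 \<le> length w" if "a \<in> D_kernel" "w \<in> keys a" for a w
  proof -
    have "lookup a [y] = 0" for y
    proof -
      have "lookup (D y a) [] = 0" using that(1) by (simp add: D_kernel_def)
      then show ?thesis by (simp add: D_eq_right_slice counit_left)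
    qed
    moreover have "lookup a [] = 0" using that(1) by (simp add: D_kernel_def)
    ultimately have "w \<noteq> []" "\<And>y. w \<noteq> [y]" using that(2) by (auto simp: in_keys_iff)
    then show ?thesis by (metis One_nat_def Suc_1 Suc_leI length_0_conv length_greater_0_conv length_Suc_conv linorder_neqE_nat less_Suc_eq not_less)
  qed
  moreover have "coideal Q D_kernel"
    using subspace_D_kernel coprod_D_kernel by (simp add: coideal_def) (simp add: D_kernel_def)
  ultimately show ?thesis unfolding nichols_ideal_def by (blast intro: pm.span_base)
qed

definition DD :: "word \<Rightarrow> 'k tensor_alg \<Rightarrow> 'k tensor_alg" where
  "DD Y = foldr D Y"

lemma DD_simps: "DD [] a = a" "DD (y # Y) a = D y (DD Y a)"
  by (simp_all add: DD_def)

lemma DD_append: "DD (Y @ Z) a = DD Y (DD Z a)"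
  by (simp add: DD_def)

lemma lin_DD: "lin (DD Y)"
proof (induction Y)
  case Nil
  show ?case unfolding DD_def by (rule linI) simp_all
next
  case (Cons y Y)
  have "DD (y # Y) = (\<lambda>a. D y (DD Y a))" by (rule ext) (simp add: DD_simps)
  then show ?case using lin_compose[OF lin_D Cons.IH] by simp
qed

lemma hom_DD: "hom \<alpha> a \<Longrightarrow> hom (\<alpha> - deg Y) (DD Y a)"
proof (induction Y)
  case (Cons y Y)
  then have "hom (\<alpha> - deg Y - deg [y]) (DD (y # Y) a)" unfolding DD_simps by (intro hom_D)
  moreover have "\<alpha> - deg Y - deg [y] = \<alpha> - deg (y # Y)"
    unfolding deg_Cons[of y Y] by (simp only: diff_diff_add add.commute)
  ultimately show ?case by simp
qed (simp add: DD_simps)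

text \<open>An upper bound for the Nichols ideal (\<open>nichols_ideal_subset_radical\<close>) that
is visibly compatible with the grading.\<close>

definition radical :: "'k tensor_alg set" where
  "radical = {a. \<forall>Y. lookup (DD Y a) [] = 0}"

lemma subspace_radical: "pm.subspace radical"
  by (rule pm.subspaceI)
    (auto simp: radical_def module_hom.zero[OF lin_DD] module_hom.add[OF lin_DD] module_hom.scale[OF lin_DD]
      Poly_Mapping.lookup_add)

lemma DD_radical: "a \<in> radical \<Longrightarrow> DD Y a \<in> radical"
  by (simp add: radical_def flip: DD_append)

text \<open>The map \<open>id \<otimes> (coefficient of y)\<close> sends \<open>J \<otimes> T + T
\<otimes> J\<close> to \<open>J\<close>, as the words in \<open>J\<close> have length at least
2.\<close>

lemma coideal_D:
  assumes "coideal Q J" "\<And>a w. a \<in> J \<Longrightarrow> w \<in> keys a \<Longrightarrow> 2 \<le> length w" "a \<in> J"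
  shows "D y a \<in> J"
proof -
  have J: "pm.subspace J" using assms(1) by (simp add: coideal_def)
  have "coprod Q a \<in> pm.span {tensor b c | b c. b \<in> J \<or> c \<in> J}"
    using assms(1,3) by (simp add: coideal_def)
  then have "right_slice (coprod Q a) [y] \<in> J"
  proof (induction rule: pm.span_induct)
    case base
    show ?case
      by (rule pm.subspaceI)
        (auto simp: module_hom.zero[OF lin_right_slice] module_hom.add[OF lin_right_slice]
          module_hom.scale[OF lin_right_slice] pm.subspace_0[OF J] pm.subspace_add[OF J] pm.subspace_scale[OF J])
  next
    case (step t)
    then obtain b c where t: "t = tensor b c" "b \<in> J \<or> c \<in> J" by blast
    have e: "right_slice t [y] = scale (lookup c [y]) b"
      by (rule poly_mapping_eqI) (simp add: t lookup_tensor)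
    have "lookup c [y] = 0" if "c \<in> J" using assms(2)[OF that, of "[y]"] by (auto simp: in_keys_iff)
    then show ?case using t(2) e pm.subspace_0[OF J] pm.subspace_scale[OF J] by auto
  qed
  then show ?thesis by (simp add: D_eq_right_slice)
qed

lemma nichols_ideal_subset_radical: "nichols_ideal Q \<subseteq> radical"
  unfolding nichols_ideal_def
proof (rule pm.span_minimal[OF _ subspace_radical])
  show "\<Union>{J. coideal Q J \<and> (\<forall>a\<in>J. \<forall>w\<in>keys a. 2 \<le> length w)} \<subseteq> radical"
  proof (rule subsetI, elim UnionE)
    fix a J assume J: "J \<in> {J. coideal Q J \<and> (\<forall>a\<in>J. \<forall>w\<in>keys a. 2 \<le> length w)}" and a: "a \<in> J"
    have "DD Y a \<in> J" for Y
    proof (induction Y)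
      case (Cons y Y)
      then show ?case unfolding DD_simps using coideal_D[of J] J by blast
    qed (simp add: DD_simps a)
    then show "a \<in> radical" using J by (auto simp: radical_def coideal_def)
  qed
qed

definition proj :: "int \<times> int \<Rightarrow> 'k tensor_alg \<Rightarrow> 'k tensor_alg" where
  "proj \<alpha> = Poly_Mapping.mapp (\<lambda>w c. if deg w = \<alpha> then c else 0)"

lemma lookup_proj [simp]: "lookup (proj \<alpha> a) w = (if deg w = \<alpha> then lookup a w else 0)"
  by (simp add: proj_def Poly_Mapping.lookup_mapp when_def in_keys_iff)

lemma lin_proj: "lin (proj \<alpha>)"
  by (rule linI; rule poly_mapping_eqI) (simp_all add: Poly_Mapping.lookup_add)

lemma proj_hom: "hom \<alpha> a \<Longrightarrow> proj \<alpha> a = a"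
  by (rule poly_mapping_eqI) (auto simp: hom_def)

lemma proj_hom_other: "hom \<beta> a \<Longrightarrow> \<beta> \<noteq> \<alpha> \<Longrightarrow> proj \<alpha> a = 0"
  by (rule poly_mapping_eqI) (auto simp: hom_def)

lemma DD_constant_term:
  assumes "\<And>w. w \<in> keys a \<Longrightarrow> deg w \<noteq> deg Y"
  shows "lookup (DD Y a) [] = 0"
proof -
  have "lookup (DD Y (single w 1)) [] = 0" if "w \<in> keys a" for w
    using hom_DD[OF hom_single[of w "1::'k"], of Y] assms[OF that] by (auto simp: hom_def)
  then show ?thesis unfolding lin_expand[OF lin_DD, of Y a] lookup_sum by simp
qed

text \<open>The constant term of an iterated derivative along \<open>Y\<close> only depends on the
component of degree \<open>deg Y\<close>.\<close>

lemma proj_radical: "a \<in> radical \<Longrightarrow> proj \<alpha> a \<in> radical"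
proof -
  assume a: "a \<in> radical"
  have "lookup (DD Y (proj \<alpha> a)) [] = 0" for Y
  proof (cases "\<alpha> = deg Y")
    case True
    have "lookup (DD Y (a - proj \<alpha> a)) [] = 0"
      by (rule DD_constant_term) (auto simp: True in_keys_iff lookup_minus split: if_splits)
    then show ?thesis using a by (simp add: module_hom.diff[OF lin_DD] lookup_minus radical_def)
  next
    case False
    then show ?thesis by (intro DD_constant_term) (auto simp: in_keys_iff split: if_splits)
  qed
  then show "proj \<alpha> a \<in> radical" by (simp add: radical_def)
qed

end

section \<open>Products of two super-letters with one letter x2\<close>

lemma qnum_Suc_left: "qnum (Suc k) t = 1 + t * qnum k t"
  by (simp add: qnum_def sum.lessThan_Suc_shift sum_distrib_left del: sum.lessThan_Suc)

lemma bprod_Suc: "bprod q r (Suc k) = bprod q r k * (1 - q ^ k * r)"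
  by (simp add: bprod_def)

locale rank_two = braiding Q for Q :: "letter \<Rightarrow> letter \<Rightarrow> 'k::field" +
  fixes q q12 q21 r s :: 'k and m :: nat
  assumes Q_q: "Q X1 X1 = q" and Q_q12: "Q X1 X2 = q12" and Q_q21: "Q X2 X1 = q21"
    and Q_s: "Q X2 X2 = s" and r_eq: "r = q12 * q21"
    and qfact_m: "qfact m q \<noteq> 0" and bprod_m: "bprod q r m \<noteq> 0"
begin

sublocale K: kernel_setup q r s m
  using Q_nonzero[of X1 X1] qfact_m bprod_m by unfold_locales (simp_all add: Q_q)

lemma chi_nat: "chi (int a, int b) (int a', int b') =
    q ^ (a * a') * q12 ^ (a * b') * q21 ^ (b * a') * s ^ (b * b')"
  unfolding bichar_def fst_conv snd_conv of_nat_mult[symmetric] power_int_of_nat Q_q Q_q12 Q_q21 Q_s ..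

lemma chi_1: "chi (1, 0) (int a', int b') = q ^ a' * q12 ^ b'"
  using chi_nat[of 1 0 a' b'] by simp

lemma chi_2: "chi (0, 1) (int a', int b') = q21 ^ a' * s ^ b'"
  using chi_nat[of 0 1 a' b'] by simp

abbreviation x1 :: "'k tensor_alg" where "x1 \<equiv> single [X1] 1"
abbreviation x2 :: "'k tensor_alg" where "x2 \<equiv> single [X2] 1"

text \<open>The super-letter of \<open>x\<^sub>1\<^sup>ix\<^sub>2\<close> (lemma
\<open>super_letter_block\<close>), that is, \<open>(ad
x\<^sub>1)\<^sup>i(x\<^sub>2)\<close>.\<close>

fun u :: "nat \<Rightarrow> 'k tensor_alg" where
  "u 0 = x2"
| "u (Suc i) = x1 * u i - scale (q ^ i * q12) (u i * x1)"

lemma deg_letters: "deg [X1] = (1, 0)" "deg [X2] = (0, 1)"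
  by (simp_all add: zero_prod_def)

lemma hom_x1: "hom (1, 0) x1" and hom_x2: "hom (0, 1) x2"
  using hom_single[of "[X1]" "1::'k"] hom_single[of "[X2]" "1::'k"] by (simp_all add: deg_letters del: deg.simps)

lemma hom_u: "hom (int i, 1) (u i)"
proof (induction i)
  case (Suc i)
  have "hom ((1, 0) + (int i, 1)) (x1 * u i)" "hom ((int i, 1) + (1, 0)) (u i * x1)"
    by (rule hom_mult[OF hom_x1 Suc] hom_mult[OF Suc hom_x1])+
  then show ?case by (simp add: hom_diff hom_scale add.commute)
qed (simp add: hom_x2)

lemma single_Nil: "single [] 1 = (1 :: 'k tensor_alg)"
  by (simp add: zero_list_def[symmetric])

lemma D_x: "D X1 x1 = 1" "D X2 x1 = 0" "D X1 x2 = 0" "D X2 x2 = 1"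
  by (simp_all add: D_single chi_0_right single_Nil)

lemma D_1: "D y 1 = 0"
  using D_single[of y "[]"] by (simp add: single_Nil)

lemma D1_times_x1: "D X1 (a * x1) = a + scale q (D X1 a * x1)"
  using D_mult[OF hom_x1, of X1 a] chi_1[of 1 0] by (simp add: D_x deg_letters del: deg.simps)

lemma D2_times_x1: "D X2 (a * x1) = scale q21 (D X2 a * x1)"
  using D_mult[OF hom_x1, of X2 a] chi_2[of 1 0] by (simp add: D_x deg_letters del: deg.simps)

lemma D1_times_u: "D X1 (a * u j) = a * D X1 (u j) + scale (q ^ j * q12) (D X1 a * u j)"
  using D_mult[OF hom_u, of X1 a j] chi_1[of j 1] by (simp add: deg_letters del: deg.simps)

lemma D2_times_u: "D X2 (a * u j) = a * D X2 (u j) + scale (q21 ^ j * s) (D X2 a * u j)"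
  using D_mult[OF hom_u, of X2 a j] chi_2[of j 1] by (simp add: deg_letters del: deg.simps)

lemma D1_u: "D X1 (u i) = 0"
proof (induction i)
  case (Suc i)
  then show ?case by (simp add: D_diff D_scale D1_times_u D1_times_x1 D_x)
qed (simp add: D_x)

lemma D2_u: "D X2 (u i) = scale (bprod q r i) (x1 ^ i)"
proof (induction i)
  case (Suc i)
  then show ?case
    by (simp add: D_diff D_scale D2_times_u D2_times_x1 D_x scale_mult bprod_Suc r_eq
      power_commutes algebra_simps flip: pm.scale_left_diff_distrib)
qed (simp add: D_x bprod_def)

lemma D1_x1_power: "D X1 (x1 ^ k) = scale (qnum k q) (x1 ^ (k - 1))"
proof (induction k)
  case (Suc k)
  have "D X1 (x1 ^ Suc k) = x1 ^ k + scale (q * qnum k q) (x1 ^ (k - 1) * x1)"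
    unfolding power_Suc2 D1_times_x1 Suc.IH by (simp add: scale_mult)
  also have "\<dots> = scale (qnum (Suc k) q) (x1 ^ k)"
  proof (cases k)
    case (Suc j)
    then show ?thesis
      by (simp add: qnum_Suc_left[of "Suc j"] pm.scale_left_distrib power_commutes)
  qed (simp add: qnum_def)
  finally show ?case by simp
qed (simp add: D_1 qnum_def)

lemma D1_u_power: "D X1 (u i * x1 ^ l) = scale (qnum l q) (u i * x1 ^ (l - 1))"
proof (induction l)
  case (Suc l)
  have "D X1 (u i * x1 ^ Suc l) = u i * x1 ^ l + scale (q * qnum l q) (u i * (x1 ^ (l - 1) * x1))"
    unfolding power_Suc2 mult.assoc[symmetric] D1_times_x1 Suc.IH by (simp add: scale_mult mult.assoc)
  also have "\<dots> = scale (qnum (Suc l) q) (u i * x1 ^ l)"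
  proof (cases l)
    case (Suc j)
    then show ?thesis
      by (simp add: qnum_Suc_left[of "Suc j"] pm.scale_left_distrib power_commutes)
  qed (simp add: qnum_def)
  finally show ?case by simp
qed (simp add: D1_u qnum_def)

definition Phi :: "nat \<Rightarrow> (nat \<Rightarrow> 'k) \<Rightarrow> 'k tensor_alg" where
  "Phi n f = (\<Sum>i\<le>n. scale (f i) (u i * u (n - i)))"

text \<open>The image of \<open>Phi n f\<close> under \<open>id \<otimes> D\<^sub>2\<close>, if
\<open>u\<^sub>iu\<^bsub>n-i\<^esub>\<close> is read as \<open>u\<^sub>i \<otimes>
u\<^bsub>n-i\<^esub>\<close>.\<close>

definition Theta :: "nat \<Rightarrow> (nat \<Rightarrow> 'k) \<Rightarrow> 'k tensor_alg" where
  "Theta n f = (\<Sum>i\<le>n. scale (f i * bprod q r (n - i)) (u i * x1 ^ (n - i)))"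

text \<open>The action of \<open>ad x\<^sub>1\<close> on coefficients with respect to the products
\<open>u\<^sub>iu\<^bsub>n-i\<^esub>\<close>. The formula is the same at every level
\<open>n\<close>.\<close>

definition ad_op :: "(nat \<Rightarrow> 'k) \<Rightarrow> nat \<Rightarrow> 'k" where
  "ad_op f i = (case i of 0 \<Rightarrow> 0 | Suc j \<Rightarrow> f j) + q ^ i * q12 * f i"

lemma ad_op_supp: "(\<And>i. n < i \<Longrightarrow> f i = 0) \<Longrightarrow> Suc n < i \<Longrightarrow> ad_op f i = 0"
  by (cases i) (auto simp: ad_op_def)

lemma ad_op_power_supp: "(\<And>i. n < i \<Longrightarrow> f i = 0) \<Longrightarrow> n + l < i \<Longrightarrow> (ad_op ^^ l) f i = 0"
proof (induction l arbitrary: i)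
  case (Suc l)
  then show ?case using ad_op_supp[of "n + l" "(ad_op ^^ l) f" i] by simp
qed simp

lemma ad_op_sum:
  assumes "f (Suc n) = 0"
  shows "(\<Sum>i\<le>Suc n. scale (ad_op f i) (T i)) =
    (\<Sum>i\<le>n. scale (f i) (T (Suc i)) + scale (q ^ i * q12 * f i) (T i))"
proof -
  have "(\<Sum>i\<le>Suc n. scale (ad_op f i) (T i)) =
      (\<Sum>i\<le>Suc n. scale (case i of 0 \<Rightarrow> 0 | Suc j \<Rightarrow> f j) (T i)) + (\<Sum>i\<le>Suc n. scale (q ^ i * q12 * f i) (T i))"
    by (simp only: ad_op_def pm.scale_left_distrib sum.distrib)
  also have "(\<Sum>i\<le>Suc n. scale (case i of 0 \<Rightarrow> 0 | Suc j \<Rightarrow> f j) (T i)) = (\<Sum>i\<le>n. scale (f i) (T (Suc i)))"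
    unfolding sum.atMost_Suc_shift by simp
  also have "(\<Sum>i\<le>Suc n. scale (q ^ i * q12 * f i) (T i)) = (\<Sum>i\<le>n. scale (q ^ i * q12 * f i) (T i))"
    using assms by simp
  finally show ?thesis by (simp add: sum.distrib)
qed

lemma x1_u: "x1 * u i = u (Suc i) + scale (q ^ i * q12) (u i * x1)"
  by simp

text \<open>The braided commutator with \<open>x\<^sub>1\<close> is a skew derivation, so on
\<open>u\<^sub>iu\<^sub>j\<close> it gives \<open>u\<^bsub>i+1\<^esub>u\<^sub>j +
q\<^sup>iq\<^sub>1\<^sub>2u\<^sub>iu\<^bsub>j+1\<^esub>\<close>.\<close>

lemma ad_Phi:
  assumes "f (Suc n) = 0"
  shows "x1 * Phi n f - scale (q ^ n * q12 ^ 2) (Phi n f * x1) = Phi (Suc n) (ad_op f)"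
proof -
  have "x1 * (u i * u j) - scale (q ^ (i + j) * q12 ^ 2) ((u i * u j) * x1) =
      u (Suc i) * u j + scale (q ^ i * q12) (u i * u (Suc j))" for i j
  proof -
    have "x1 * (u i * u j) = u (Suc i) * u j + scale (q ^ i * q12) (u i * (x1 * u j))"
      unfolding mult.assoc[symmetric] x1_u[of i] by (simp only: distrib_right scale_mult mult.assoc)
    also have "u i * (x1 * u j) = u i * u (Suc j) + scale (q ^ j * q12) (u i * u j * x1)"
      unfolding x1_u[of j] by (simp only: distrib_left scale_mult mult.assoc)
    finally show ?thesis
      by (simp add: pm.scale_right_distrib power_add power2_eq_square mult_ac del: u.simps)
  qed
  note t = this
  have "x1 * Phi n f - scale (q ^ n * q12 ^ 2) (Phi n f * x1) =
      (\<Sum>i\<le>n. scale (f i) (x1 * (u i * u (n - i)) - scale (q ^ (i + (n - i)) * q12 ^ 2) ((u i * u (n - i)) * x1)))"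
    by (simp add: Phi_def sum_distrib_left sum_distrib_right scale_mult pm.scale_sum_right
      pm.scale_right_diff_distrib sum_subtractf mult.commute mult.left_commute del: u.simps)
  also have "\<dots> = (\<Sum>i\<le>n. scale (f i) (u (Suc i) * u (Suc n - Suc i)) + scale (q ^ i * q12 * f i) (u i * u (Suc n - i)))"
    unfolding t by (rule sum.cong) (auto simp: pm.scale_right_distrib Suc_diff_le mult.commute simp del: u.simps)
  also have "\<dots> = Phi (Suc n) (ad_op f)"
    unfolding Phi_def ad_op_sum[of f n "\<lambda>i. u i * u (Suc n - i)", OF assms] ..
  finally show ?thesis .
qed

text \<open>The operator on the left is what \<open>ad x\<^sub>1\<close> becomes after applying
\<open>D\<^sub>2\<close>. That it acts on coefficients as before uses \<open>b\<^bsub>j+1\<^esub> =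
b\<^sub>j(1 - q\<^sup>jr)\<close>.\<close>

lemma ad_Theta:
  assumes "f (Suc n) = 0"
  shows "x1 * Theta n f - scale (q ^ n * q12 ^ 2 * q21) (Theta n f * x1) = Theta (Suc n) (ad_op f)"
proof -
  have "scale (bprod q r j) (x1 * (u i * x1 ^ j) - scale (q ^ (i + j) * q12 ^ 2 * q21) ((u i * x1 ^ j) * x1)) =
      scale (bprod q r j) (u (Suc i) * x1 ^ j) + scale (q ^ i * q12 * bprod q r (Suc j)) (u i * x1 ^ Suc j)" for i j
  proof -
    have "x1 * (u i * x1 ^ j) = u (Suc i) * x1 ^ j + scale (q ^ i * q12) (u i * x1 ^ Suc j)"
      unfolding mult.assoc[symmetric] x1_u[of i] by (simp add: distrib_right scale_mult mult.assoc del: u.simps)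
    moreover have "u i * x1 ^ j * x1 = u i * x1 ^ Suc j"
      by (simp only: mult.assoc power_Suc2)
    ultimately show ?thesis
      by (simp add: pm.scale_right_distrib pm.scale_right_diff_distrib bprod_Suc r_eq power_add power2_eq_square
        algebra_simps pm.scale_left_diff_distrib del: u.simps power_Suc)
  qed
  note t = this
  have "x1 * Theta n f - scale (q ^ n * q12 ^ 2 * q21) (Theta n f * x1) =
      (\<Sum>i\<le>n. scale (f i) (scale (bprod q r (n - i)) (x1 * (u i * x1 ^ (n - i)) -
        scale (q ^ (i + (n - i)) * q12 ^ 2 * q21) ((u i * x1 ^ (n - i)) * x1))))"
    by (simp add: Theta_def sum_distrib_left sum_distrib_right scale_mult pm.scale_sum_right
      pm.scale_right_diff_distrib sum_subtractf mult.commute mult.left_commute del: u.simps)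
  also have "\<dots> = (\<Sum>i\<le>n. scale (f i) (scale (bprod q r (Suc n - Suc i)) (u (Suc i) * x1 ^ (Suc n - Suc i))) +
      scale (q ^ i * q12 * f i) (scale (bprod q r (Suc n - i)) (u i * x1 ^ (Suc n - i))))"
    unfolding t by (rule sum.cong) (auto simp: pm.scale_right_distrib Suc_diff_le mult_ac simp del: u.simps)
  also have "\<dots> = (\<Sum>i\<le>Suc n. scale (ad_op f i) (scale (bprod q r (Suc n - i)) (u i * x1 ^ (Suc n - i))))"
    unfolding ad_op_sum[of f n "\<lambda>i. scale (bprod q r (Suc n - i)) (u i * x1 ^ (Suc n - i))", OF assms] ..
  finally show ?thesis by (simp only: Theta_def pm.scale_scale)
qed

definition \<delta> :: "nat \<Rightarrow> nat \<Rightarrow> 'k" where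
  "\<delta> j i = (if i = j then 1 else 0)"

lemma Phi_delta: "j \<le> n \<Longrightarrow> Phi n (\<delta> j) = u j * u (n - j)"
proof -
  assume "j \<le> n"
  have "Phi n (\<delta> j) = (\<Sum>i\<le>n. if i = j then u j * u (n - j) else 0)"
    unfolding Phi_def by (rule sum.cong) (auto simp: \<delta>_def)
  then show ?thesis using \<open>j \<le> n\<close> by simp
qed

lemma Theta_delta: "j \<le> n \<Longrightarrow> Theta n (\<delta> j) = scale (bprod q r (n - j)) (u j * x1 ^ (n - j))"
proof -
  assume "j \<le> n"
  have "Theta n (\<delta> j) = (\<Sum>i\<le>n. if i = j then scale (bprod q r (n - j)) (u j * x1 ^ (n - j)) else 0)"
    unfolding Theta_def by (rule sum.cong) (auto simp: \<delta>_def)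
  then show ?thesis using \<open>j \<le> n\<close> by simp
qed

lemma Phi_linear: "Phi n (\<lambda>i. \<Sum>j\<in>A. g j * F j i) = (\<Sum>j\<in>A. scale (g j) (Phi n (F j)))"
  unfolding Phi_def pm.scale_sum_right pm.scale_sum_left sum.swap[of _ A] by simp

lemma Theta_linear: "Theta n (\<lambda>i. \<Sum>j\<in>A. g j * F j i) = (\<Sum>j\<in>A. scale (g j) (Theta n (F j)))"
  unfolding Theta_def pm.scale_sum_right pm.scale_sum_left sum_distrib_right sum.swap[of _ A]
  by (simp add: mult.assoc)

lemma hom_Phi: "hom (int n, 2) (Phi n f)"
  unfolding Phi_def
proof (intro hom_sum hom_scale)
  fix i assume "i \<in> {..n}"
  then show "hom (int n, 2) (u i * u (n - i))"
    using hom_mult[OF hom_u[of i] hom_u[of "n - i"]] by (simp add: of_nat_diff)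
qed

text \<open>For \<open>l = 0\<close> this is \<open>D\<^sub>2(x\<^sub>2u\<^sub>j) = (id \<otimes>
D\<^sub>2)(1 + c)(x\<^sub>2 \<otimes> u\<^sub>j)\<close>, where \<open>c(x\<^sub>2 \<otimes>
u\<^sub>j)\<close> is a multiple of \<open>u\<^sub>j \<otimes> x\<^sub>2\<close>. As
\<open>c\<close> commutes with \<open>ad x\<^sub>1\<close>, applying \<open>(ad
x\<^sub>1)\<^sup>l\<close> gives the general case.\<close>

lemma D2_Phi_power:
  "D X2 (Phi (j + l) ((ad_op ^^ l) (\<delta> 0))) = Theta (j + l) ((ad_op ^^ l) (\<lambda>i. \<delta> 0 i + q21 ^ j * s * \<delta> j i))"
proof (induction l)
  case 0
  have "Theta j (\<lambda>i. \<delta> 0 i + q21 ^ j * s * \<delta> j i) = Theta j (\<delta> 0) + scale (q21 ^ j * s) (Theta j (\<delta> j))"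
    by (simp add: Theta_def pm.scale_left_distrib distrib_right sum.distrib pm.scale_sum_right mult.assoc)
  then show ?case
    by (simp add: Phi_delta Theta_delta D2_times_u D_x D2_u scale_mult) (simp add: bprod_def)
next
  case (Suc l)
  define f where "f = (ad_op ^^ l) (\<delta> 0)"
  define g where "g = (ad_op ^^ l) (\<lambda>i. \<delta> 0 i + q21 ^ j * s * \<delta> j i)"
  have f0: "f (Suc (j + l)) = 0" unfolding f_def by (rule ad_op_power_supp[of 0]) (simp_all add: \<delta>_def)
  have g0: "g (Suc (j + l)) = 0" unfolding g_def by (rule ad_op_power_supp[of j]) (simp_all add: \<delta>_def)
  have "D X2 (x1 * a) = x1 * D X2 a" if "hom \<beta> a" for a \<beta>
    using D_mult[OF that, of X2 x1] by (simp add: D_x)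
  moreover have "hom (int (j + l), 2) (Phi (j + l) f)" by (rule hom_Phi)
  ultimately have "D X2 (x1 * Phi (j + l) f - scale (q ^ (j + l) * q12 ^ 2) (Phi (j + l) f * x1)) =
      x1 * D X2 (Phi (j + l) f) - scale (q ^ (j + l) * q12 ^ 2 * q21) (D X2 (Phi (j + l) f) * x1)"
    by (simp add: D_diff D_scale D2_times_x1)
  then have "D X2 (Phi (Suc (j + l)) (ad_op f)) = Theta (Suc (j + l)) (ad_op g)"
    unfolding ad_Phi[of f "j + l", OF f0] Suc.IH[folded f_def g_def] ad_Theta[of g "j + l", OF g0] .
  then show ?case by (simp add: f_def g_def)
qed

lemma D1_Phi: "D X1 (Phi n f) = 0"
  by (simp add: Phi_def D_sum D_scale D1_times_u D1_u)

lemma DD_replicate_Suc: "DD (replicate (Suc k) x) a = DD (replicate k x) (D x a)"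
  using DD_append[of "replicate k x" "[x]" a] replicate_append_same[of k x] by (simp add: DD_simps)

lemma DD_u_power:
  "DD (replicate k X1) (u i * x1 ^ l) = (if l < k then 0 else if l = k then scale (qfact k q) (u i)
    else DD (replicate k X1) (u i * x1 ^ l))"
proof -
  have e: "DD (replicate k X1) (u i * x1 ^ k) = scale (qfact k q) (u i)" for k
  proof (induction k)
    case (Suc k)
    then show ?case unfolding DD_replicate_Suc D1_u_power
      by (simp add: module_hom.scale[OF lin_DD] qfact_Suc mult.commute)
  qed (simp add: DD_simps qfact_0)
  have "DD (replicate k X1) (u i * x1 ^ l) = 0" if "l < k"
  proof -
    obtain d where d: "k = d + Suc l" using \<open>l < k\<close> less_imp_Suc_add by (metis add.commute add_Suc_right)
    have "DD (replicate (Suc l) X1) (u i * x1 ^ l) = 0"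
      by (simp add: DD_simps e D_scale D1_u)
    then show ?thesis unfolding d replicate_add DD_append by (simp add: module_hom.zero[OF lin_DD])
  qed
  with e show ?thesis by auto
qed

lemma DD_x1_power: "DD (replicate k X1) (x1 ^ k) = scale (qfact k q) 1"
proof (induction k)
  case (Suc k)
  then show ?case unfolding DD_replicate_Suc D1_x1_power
    by (simp add: module_hom.scale[OF lin_DD] qfact_Suc mult.commute)
qed (simp add: DD_simps qfact_0)

lemma DD_power_u:
  assumes "l \<le> k"
  shows "DD (replicate k X1) (x1 ^ l * u j) = (if l = k then scale (qfact k q * (q ^ j * q12) ^ k) (u j) else 0)"
proof -
  have m: "DD (replicate k X1) (a * u j) = scale ((q ^ j * q12) ^ k) (DD (replicate k X1) a * u j)" for k a
    by (induction k) (simp_all add: DD_simps D_scale D1_times_u D1_u mult.commute)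
  have z: "DD (replicate k X1) (x1 ^ l) = 0" if "l < k"
  proof -
    obtain d where d: "k = d + Suc l" using \<open>l < k\<close> less_imp_Suc_add by (metis add.commute add_Suc_right)
    have "DD (replicate (Suc l) X1) (x1 ^ l) = 0"
      by (simp add: DD_simps DD_x1_power D_scale D_1)
    then show ?thesis unfolding d replicate_add DD_append by (simp add: module_hom.zero[OF lin_DD])
  qed
  show ?thesis using DD_x1_power z assms by (auto simp: m scale_mult mult.commute)
qed

lemma bprod_nonzero: "i \<le> m \<Longrightarrow> bprod q r i \<noteq> 0"
  using K.b_factor_nonzero by (auto simp: bprod_def)

lemma scale_u_radical:
  assumes "scale k (u i) \<in> radical" "i \<le> m"
  shows "k = 0"
proof -
  have "DD (replicate i X1 @ [X2]) (scale k (u i)) = scale (k * bprod q r i * qfact i q) 1"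
    unfolding DD_append by (simp add: DD_simps D_scale D2_u module_hom.scale[OF lin_DD] DD_x1_power mult_ac)
  moreover have "lookup (DD (replicate i X1 @ [X2]) (scale k (u i))) [] = 0"
    using assms(1) unfolding radical_def by blast
  ultimately have "k * bprod q r i * qfact i q = 0"
    by (simp add: lookup_one zero_list_def)
  then show ?thesis using bprod_nonzero K.qfact_nonzero assms(2) by simp
qed

text \<open>The products \<open>u\<^sub>ix\<^sub>1\<^bsup>m-i\<^esup>\<close> are linearly
independent modulo the radical: if \<open>i\<close> is the least index with \<open>h\<^sub>i
\<noteq> 0\<close>, then \<open>D\<^sub>1\<^bsup>m-i\<^esup>\<close> leaves only a nonzero multiple
of \<open>u\<^sub>i\<close>.\<close>

lemma Theta_radical:
  assumes "Theta m h \<in> radical" "i \<le> m"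
  shows "h i = 0"
  using assms(2)
proof (induction i rule: less_induct)
  case (less i)
  have t: "scale (h j * bprod q r (m - j)) (DD (replicate (m - i) X1) (u j * x1 ^ (m - j))) =
      (if j = i then scale (h i * bprod q r (m - i) * qfact (m - i) q) (u i) else 0)" if "j \<le> m" for j
  proof -
    consider "j < i" | "j = i" | "i < j" by linarith
    then show ?thesis
    proof cases
      case 3
      then have "m - j < m - i" using that by simp
      then show ?thesis using 3 DD_u_power[of "m - i" j "m - j"] by simp
    qed (use less DD_u_power[of "m - i" i "m - i"] in \<open>simp_all\<close>)
  qed
  have "DD (replicate (m - i) X1) (Theta m h) =
      (\<Sum>j\<le>m. if j = i then scale (h i * bprod q r (m - i) * qfact (m - i) q) (u i) else 0)"
    unfolding Theta_def module_hom.sum[OF lin_DD] module_hom.scale[OF lin_DD]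
    by (rule sum.cong[OF refl]) (use t in simp)
  then have "DD (replicate (m - i) X1) (Theta m h) = scale (h i * bprod q r (m - i) * qfact (m - i) q) (u i)"
    using less.prems by simp
  then have "scale (h i * bprod q r (m - i) * qfact (m - i) q) (u i) \<in> radical"
    using DD_radical[OF assms(1), of "replicate (m - i) X1"] by simp
  then have "h i * bprod q r (m - i) * qfact (m - i) q = 0"
    using less.prems by (rule scale_u_radical)
  then show ?case using bprod_nonzero[of "m - i"] K.qfact_nonzero[of "m - i"] by simp
qed

text \<open>The iterated derivative \<open>D\<^sub>1\<^sup>aD\<^sub>2\<close> of the relation is a
multiple of \<open>u\<^bsub>m-a\<^esub>\<close>, to which only the products
\<open>u\<^bsub>m-a\<^esub>u\<^sub>a\<close> and \<open>u\<^sub>au\<^bsub>m-a\<^esub>\<close>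
contribute. For \<open>a = m - a\<close> these coincide.\<close>

lemma relation_ends:
  assumes rel: "Phi m f \<in> radical" and a: "a \<le> m" "m \<le> 2 * a"
    and supp: "\<And>k. a < k \<Longrightarrow> f k = 0" "\<And>k. k < m - a \<Longrightarrow> f k = 0"
  shows "a = m - a \<Longrightarrow> f a * (1 + q21 ^ a * s * (q ^ a * q12) ^ a) = 0"
    and "a \<noteq> m - a \<Longrightarrow> f (m - a) = - (q21 ^ (m - a) * s * (q ^ (m - a) * q12) ^ a) * f a"
proof -
  define b where "b = m - a"
  define \<kappa> where "\<kappa> = q21 ^ b * s * (q ^ b * q12) ^ a"
  have ab: "b \<le> a" "m - b = a" using a by (auto simp: b_def)
  define k1 where "k1 = bprod q r a * qfact a q"
  have t: "scale (f i) (DD (replicate a X1) (D X2 (u i * u (m - i)))) =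
      (if i = b then scale (f b * k1) (u b) else 0) + (if i = a then scale (f a * \<kappa> * k1) (u b) else 0)"
    if "i \<le> m" for i
  proof -
    have D: "D X2 (u i * u (m - i)) = scale (bprod q r (m - i)) (u i * x1 ^ (m - i)) +
        scale (q21 ^ (m - i) * s * bprod q r i) (x1 ^ i * u (m - i))"
      by (simp add: D2_times_u D2_u scale_mult)
    consider "i < b \<or> a < i" | "b \<le> i" "i \<le> a" by linarith
    then show ?thesis
    proof cases
      case 1
      then have "f i = 0" "i \<noteq> b" "i \<noteq> a" using supp ab by (auto simp: b_def)
      then show ?thesis by simp
    next
      case 2
      have 1: "DD (replicate a X1) (u i * x1 ^ (m - i)) = (if i = b then scale (qfact a q) (u b) else 0)"
      proof (cases "i = b")
        case False
        then have "m - i < a" using 2 ab that by simp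
        then show ?thesis using False DD_u_power[of a i "m - i"] by simp
      qed (use ab DD_u_power[of a b a] in simp)
      have 2: "DD (replicate a X1) (x1 ^ i * u (m - i)) =
          (if i = a then scale (qfact a q * (q ^ b * q12) ^ a) (u b) else 0)"
        using DD_power_u[OF 2(2), of "m - i"] by (simp add: b_def)
      show ?thesis unfolding D module_hom.add[OF lin_DD] module_hom.scale[OF lin_DD] 1 2
        by (auto simp: k1_def \<kappa>_def ab b_def[symmetric] pm.scale_right_distrib mult_ac)
    qed
  qed
  have "DD (replicate a X1 @ [X2]) (Phi m f) =
      (\<Sum>i\<le>m. (if i = b then scale (f b * k1) (u b) else 0) + (if i = a then scale (f a * \<kappa> * k1) (u b) else 0))"
    unfolding DD_append DD_simps Phi_def D_sum D_scale module_hom.sum[OF lin_DD] module_hom.scale[OF lin_DD]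
    by (rule sum.cong[OF refl]) (use t in simp)
  also have "\<dots> = scale ((f b + f a * \<kappa>) * k1) (u b)"
    using ab a by (simp add: sum.distrib distrib_right pm.scale_left_distrib)
  finally have "scale ((f b + f a * \<kappa>) * k1) (u b) \<in> radical"
    using DD_radical[OF rel, of "replicate a X1 @ [X2]"] by simp
  then have "(f b + f a * \<kappa>) * k1 = 0" by (rule scale_u_radical) (use ab a in simp)
  then have e: "f b + f a * \<kappa> = 0"
    using bprod_nonzero[of a] K.qfact_nonzero[of a] a by (simp add: k1_def)
  show "a = m - a \<Longrightarrow> f a * (1 + q21 ^ a * s * (q ^ a * q12) ^ a) = 0"
    using e by (simp add: \<kappa>_def b_def[symmetric] distrib_left)
  show "a \<noteq> m - a \<Longrightarrow> f (m - a) = - (q21 ^ (m - a) * s * (q ^ (m - a) * q12) ^ a) * f a"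
    using e by (simp add: \<kappa>_def b_def[symmetric] eq_neg_iff_add_eq_0 mult.commute)
qed

text \<open>By \<open>relation_ends\<close>, a nonzero coefficient in a place \<open>k < m -
a\<close>, for the least such \<open>k\<close>, would force one in place \<open>m - k >
a\<close>.\<close>

lemma relation_support:
  assumes rel: "Phi m f \<in> radical" and a: "a \<le> m" "m \<le> 2 * a" and supp: "\<And>k. a < k \<Longrightarrow> f k = 0"
    and k: "k < m - a"
  shows "f k = 0"
  using k
proof (induction k rule: less_induct)
  case (less k)
  define a' where "a' = m - k"
  have a': "a < a'" "a' \<le> m" "m \<le> 2 * a'" "m - a' = k" "a' \<noteq> m - a'" using less.prems a by (auto simp: a'_def)
  have "f j = 0" if "j < m - a'" for j using less that a' by simp
  then have "f (m - a') = - (q21 ^ (m - a') * s * (q ^ (m - a') * q12) ^ a') * f a'"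
    using relation_ends(2)[OF rel a'(2,3)] supp a' by auto
  then show ?case using supp[OF a'(1)] a'(4) by simp
qed

end

section \<open>The dimension of the space of relations\<close>

lemma smult_sum_right: "smult c (\<Sum>i\<in>A. P i) = (\<Sum>i\<in>A. smult c (P i))"
  by (induction A rule: infinite_finite_induct) (simp_all add: smult_add_right)

text \<open>For a flag cut out by linear functionals, each step increases the dimension by 0 or 1,
and by 1 precisely if the step has a leading vector. Two such flags of the same space will be
compared.\<close>

lemma (in vector_space) dim_eq_card_leading:
  fixes \<phi> :: "nat \<Rightarrow> 'b \<Rightarrow> 'a"
  assumes R: "subspace R"
    and add: "\<And>i x y. \<phi> i (x + y) = \<phi> i x + \<phi> i y"
    and sc: "\<And>i c x. \<phi> i (scale c x) = c * \<phi> i x"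
    and inj: "\<And>x. x \<in> R \<Longrightarrow> (\<And>i. i < N \<Longrightarrow> \<phi> i x = 0) \<Longrightarrow> x = 0"
  shows "dim R = card {i. i < N \<and> (\<exists>x\<in>R. \<phi> i x \<noteq> 0 \<and> (\<forall>k. i < k \<and> k < N \<longrightarrow> \<phi> k x = 0))}"
proof -
  define L where "L = {i. i < N \<and> (\<exists>x\<in>R. \<phi> i x \<noteq> 0 \<and> (\<forall>k. i < k \<and> k < N \<longrightarrow> \<phi> k x = 0))}"
  define F where "F j = {x\<in>R. \<forall>k. j \<le> k \<and> k < N \<longrightarrow> \<phi> k x = 0}" for j
  have z: "\<phi> i 0 = 0" for i using sc[of i 0 0] by simp
  have "\<exists>B. independent B \<and> finite B \<and> span B = F j \<and> card B = card (L \<inter> {..<j})" if "j \<le> N" for j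
    using that
  proof (induction j)
    case 0
    have "F 0 = {0}" using inj subspace_0[OF R] z by (auto simp: F_def)
    then show ?case by (intro exI[of _ "{}"]) (simp add: independent_empty)
  next
    case (Suc j)
    then obtain B where B: "independent B" "finite B" "span B = F j" "card B = card (L \<inter> {..<j})"
      by auto
    have sub: "F j \<subseteq> F (Suc j)" by (auto simp: F_def)
    show ?case
    proof (cases "j \<in> L")
      case False
      have "F (Suc j) = F j"
      proof (rule antisym[OF subsetI sub])
        fix x assume x: "x \<in> F (Suc j)"
        then have "\<phi> j x = 0" using False Suc.prems by (auto simp: L_def F_def Suc_le_eq)
        then show "x \<in> F j" using x by (auto simp: F_def) (metis le_neq_implies_less Suc_leI)
      qed
      moreover have "L \<inter> {..<Suc j} = L \<inter> {..<j}" using False by (auto simp: less_Suc_eq)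
      ultimately show ?thesis using B by auto
    next
      case True
      then obtain x where x: "x \<in> R" "\<phi> j x \<noteq> 0" "\<forall>k. j < k \<and> k < N \<longrightarrow> \<phi> k x = 0"
        by (auto simp: L_def)
      then have xF: "x \<in> F (Suc j)" by (auto simp: F_def Suc_le_eq)
      have nF: "x \<notin> span B" using x(2) Suc.prems by (auto simp: B(3) F_def)
      then have nB: "x \<notin> B" using span_base by blast
      have "span (insert x B) = F (Suc j)"
      proof (rule antisym)
        have "subspace (F (Suc j))"
          using R add sc z
          by (auto simp: subspace_def F_def)
        then show "span (insert x B) \<subseteq> F (Suc j)"
          using xF sub B(3) span_base by (intro span_minimal) blast+
        show "F (Suc j) \<subseteq> span (insert x B)"
        proof
          fix y assume y: "y \<in> F (Suc j)"
          define c where "c = \<phi> j y / \<phi> j x"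
          have neg: "\<phi> i (- z) = - \<phi> i z" for i z
            using add[of i z "- z"] \<open>\<And>i. \<phi> i 0 = 0\<close> by (simp add: eq_neg_iff_add_eq_0 add.commute)
          have df: "\<phi> i (y - scale c x) = \<phi> i y - c * \<phi> i x" for i
            using add[of i y "- scale c x"] neg[of i "scale c x"] sc by simp
          have "y - scale c x \<in> R"
            using y x(1) R by (auto simp: F_def intro!: subspace_diff subspace_scale)
          moreover have "\<phi> k (y - scale c x) = 0" if "j \<le> k" "k < N" for k
          proof (cases "k = j")
            case True
            then show ?thesis unfolding df using x(2) by (simp add: c_def)
          next
            case False
            then show ?thesis using x(3) y that by (auto simp: df F_def)
          qed
          ultimately have "y - scale c x \<in> span B" by (auto simp: B(3) F_def)
          then have "y - scale c x \<in> span (insert x B)" using span_mono[of B "insert x B"] by blast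
          moreover have "scale c x \<in> span (insert x B)" by (intro span_scale span_base) simp
          ultimately have "(y - scale c x) + scale c x \<in> span (insert x B)" by (rule span_add)
          then show "y \<in> span (insert x B)" by simp
        qed
      qed
      moreover have "independent (insert x B)" using nF B(1) by (rule independent_insertI)
      moreover have "L \<inter> {..<Suc j} = insert j (L \<inter> {..<j})" using True by (auto simp: less_Suc_eq)
      ultimately show ?thesis using B nB by (intro exI[of _ "insert x B"]) simp
    qed
  qed
  from this[of N] obtain B where B: "independent B" "span B = F N" "card B = card (L \<inter> {..<N})" by auto
  have "F N = R" by (auto simp: F_def)
  then have "span B = span R" using B(2) R by (metis span_eq_iff)
  then have "dim R = card B" using B(1) by (rule dim_eq_card)
  moreover have "L \<inter> {..<N} = L" by (auto simp: L_def)
  ultimately show ?thesis using B(3) by (simp add: L_def)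
qed

interpretation seqs: vector_space "\<lambda>(c::'k::field) f (i::nat). c * f i"
  by unfold_locales (auto simp: fun_eq_iff algebra_simps)

context rank_two
begin

text \<open>The sequence of coefficients \<open>f\<close> of \<open>\<Sum> f\<^sub>i
u\<^sub>iu\<^bsub>n-i\<^esub>\<close> is encoded by the polynomial \<open>\<Sum> f\<^sub>i newton
i\<close>. Then \<open>ad_op\<close> is multiplication by the variable, and the elements \<open>(ad
x\<^sub>1)\<^bsup>n-j\<^esup>(x\<^sub>2u\<^sub>j)\<close> correspond to the monomials.\<close>

definition newton :: "nat \<Rightarrow> 'k poly" where
  "newton i = (\<Prod>k<i. [:- (q ^ k * q12), 1:])"

lemma newton_Suc: "newton (Suc i) = pCons 0 (newton i) - smult (q ^ i * q12) (newton i)"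
  by (simp add: newton_def)

lemma coeff_newton_above: "i < k \<Longrightarrow> coeff (newton i) k = 0"
proof (induction i arbitrary: k)
  case (Suc i)
  then show ?case by (cases k) (simp_all add: newton_Suc)
qed (simp add: newton_def)

text \<open>The q-binomial theorem.\<close>

lemma coeff_newton: "n \<le> j \<Longrightarrow> coeff (newton j) (j - n) = (- q12) ^ n * q ^ (n choose 2) * qbin q j n"
proof (induction j arbitrary: n)
  case 0
  then show ?case by (simp add: newton_def numeral_2_eq_2)
next
  case (Suc j)
  show ?case
  proof (cases n)
    case 0
    then show ?thesis using Suc.IH[of 0] coeff_newton_above[of j "Suc j"] by (simp add: newton_Suc numeral_2_eq_2)
  next
    case (Suc n')
    then have n': "n' \<le> j" using Suc.prems by simp
    have "q ^ j = q ^ n' * q ^ (j - n')" using n' by (simp flip: power_add)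
    then have t: "q ^ j * q12 * coeff (newton j) (j - n') =
        - ((- q12) ^ n * q ^ (n choose 2) * (q ^ (j - n') * qbin q j n'))"
      using Suc.IH[OF n'] by (simp add: Suc Suc_choose_two power_add)
    show ?thesis
    proof (cases "n' = j")
      case True
      then have "coeff (newton (Suc j)) (Suc j - n) = - (q ^ j * q12 * coeff (newton j) (j - n'))"
        by (simp add: newton_Suc Suc)
      then show ?thesis unfolding t using True by (simp add: Suc qbin_eq_0)
    next
      case False
      then obtain i where i: "j - n' = Suc i" "j - n = i" "n \<le> j" using n' Suc
        by (metis Suc_diff_Suc Suc_leI le_neq_implies_less)
      have "coeff (newton (Suc j)) (Suc j - n) = coeff (newton j) (j - n) - q ^ j * q12 * coeff (newton j) (j - n')"
        using i by (simp add: newton_Suc Suc)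
      then show ?thesis unfolding t Suc.IH[OF i(3)] by (simp add: Suc algebra_simps)
    qed
  qed
qed

lemma coeff_newton_top: "coeff (newton j) j = 1"
  using coeff_newton[of 0 j] by (simp add: numeral_2_eq_2)

definition newton_poly :: "nat \<Rightarrow> (nat \<Rightarrow> 'k) \<Rightarrow> 'k poly" where
  "newton_poly n f = (\<Sum>i\<le>n. smult (f i) (newton i))"

lemma coeff_newton_poly_above: "n < i \<Longrightarrow> coeff (newton_poly n f) i = 0"
  by (simp add: newton_poly_def coeff_sum coeff_newton_above)

lemma newton_poly_ad_op:
  assumes "f (Suc n) = 0"
  shows "newton_poly (Suc n) (ad_op f) = pCons 0 (newton_poly n f)"
proof -
  have "newton_poly (Suc n) (ad_op f) = (\<Sum>i\<le>Suc n. smult (case i of 0 \<Rightarrow> 0 | Suc j \<Rightarrow> f j) (newton i)) +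
      (\<Sum>i\<le>Suc n. smult (q ^ i * q12 * f i) (newton i))"
    by (simp only: newton_poly_def ad_op_def smult_add_left sum.distrib)
  also have "(\<Sum>i\<le>Suc n. smult (case i of 0 \<Rightarrow> 0 | Suc j \<Rightarrow> f j) (newton i)) = (\<Sum>i\<le>n. smult (f i) (newton (Suc i)))"
    unfolding sum.atMost_Suc_shift by simp
  also have "(\<Sum>i\<le>Suc n. smult (q ^ i * q12 * f i) (newton i)) = (\<Sum>i\<le>n. smult (q ^ i * q12 * f i) (newton i))"
    using assms by simp
  also have "(\<Sum>i\<le>n. smult (f i) (newton (Suc i))) + \<dots> = (\<Sum>i\<le>n. pCons 0 (smult (f i) (newton i)))"
    unfolding sum.distrib[symmetric]
    by (rule sum.cong) (simp_all add: newton_Suc smult_diff_right mult.commute)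
  also have "\<dots> = pCons 0 (newton_poly n f)"
    unfolding newton_poly_def by (induction n) simp_all
  finally show ?thesis .
qed

lemma newton_poly_ad_op_power:
  assumes "\<And>i. n < i \<Longrightarrow> f i = 0"
  shows "newton_poly (n + l) ((ad_op ^^ l) f) = monom 1 l * newton_poly n f"
proof (induction l)
  case (Suc l)
  have "newton_poly (Suc (n + l)) (ad_op ((ad_op ^^ l) f)) = pCons 0 (newton_poly (n + l) ((ad_op ^^ l) f))"
    by (rule newton_poly_ad_op, rule ad_op_power_supp[of n]) (use assms in auto)
  then show ?case using Suc by (simp add: monom_Suc)
qed simp

lemma newton_poly_delta: "j \<le> n \<Longrightarrow> newton_poly n (\<delta> j) = newton j"
proof -
  assume "j \<le> n"
  have "newton_poly n (\<delta> j) = (\<Sum>i\<le>n. if i = j then newton j else 0)"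
    unfolding newton_poly_def by (rule sum.cong) (auto simp: \<delta>_def)
  then show ?thesis using \<open>j \<le> n\<close> by simp
qed

lemma newton_poly_linear: "newton_poly n (\<lambda>i. \<Sum>j\<in>A. g j * F j i) = (\<Sum>j\<in>A. smult (g j) (newton_poly n (F j)))"
  unfolding newton_poly_def smult_sum_right smult_sum sum.swap[of _ A] by simp

lemma newton_poly_diff: "newton_poly n (\<lambda>i. f i - g i) = newton_poly n f - newton_poly n g"
  by (simp add: newton_poly_def smult_diff_left sum_subtractf)

lemma newton_poly_add: "newton_poly n (\<lambda>i. f i + g i) = newton_poly n f + newton_poly n g"
  by (simp add: newton_poly_def smult_add_left sum.distrib)

lemma newton_poly_scale: "newton_poly n (\<lambda>i. c * f i) = smult c (newton_poly n f)"
  by (simp add: newton_poly_def smult_sum_right)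

lemma newton_poly_inj: "newton_poly n f = 0 \<Longrightarrow> i \<le> n \<Longrightarrow> f i = 0"
proof (induction n arbitrary: i)
  case 0
  then show ?case by (simp add: newton_poly_def newton_def)
next
  case (Suc n)
  have "coeff (newton_poly (Suc n) f) (Suc n) = f (Suc n)"
    using coeff_newton_poly_above[of n "Suc n" f] by (simp add: newton_poly_def coeff_newton_top)
  then have f: "f (Suc n) = 0" using Suc.prems by simp
  then have "newton_poly n f = 0" using Suc.prems by (simp add: newton_poly_def)
  then show ?case using Suc.IH Suc.prems f by (cases "i = Suc n") auto
qed

lemma newton_poly_surj: "(\<And>i. n < i \<Longrightarrow> coeff P i = 0) \<Longrightarrow> \<exists>f. (\<forall>i>n. f i = 0) \<and> newton_poly n f = P"
proof (induction n arbitrary: P)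
  case 0
  have "P = [:coeff P 0:]" by (rule poly_eqI) (use 0 in \<open>auto simp: coeff_pCons split: nat.split\<close>)
  then show ?case by (intro exI[of _ "\<lambda>i. if i = 0 then coeff P 0 else 0"]) (simp add: newton_poly_def newton_def)
next
  case (Suc n)
  define P' where "P' = P - smult (coeff P (Suc n)) (newton (Suc n))"
  have "coeff P' i = 0" if "n < i" for i
    using that Suc.prems[of i] coeff_newton_above[of "Suc n" i]
    by (cases "i = Suc n") (simp_all add: P'_def coeff_newton_top)
  then obtain f where f: "\<forall>i>n. f i = 0" "newton_poly n f = P'" using Suc.IH by blast
  define f' where "f' = f(Suc n := coeff P (Suc n))"
  have "newton_poly n f' = newton_poly n f" unfolding newton_poly_def by (rule sum.cong) (auto simp: f'_def)
  then have "newton_poly (Suc n) f' = P" using f(2) by (simp add: newton_poly_def f'_def P'_def)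
  moreover have "\<forall>i>Suc n. f' i = 0" using f(1) by (simp add: f'_def)
  ultimately show ?case by blast
qed

text \<open>The coordinate of \<open>Phi m f\<close> with respect to \<open>(ad
x\<^sub>1)\<^bsup>m-j\<^esup>(x\<^sub>2u\<^sub>j)\<close>.\<close>

definition ad_coord :: "(nat \<Rightarrow> 'k) \<Rightarrow> nat \<Rightarrow> 'k" where
  "ad_coord f j = coeff (newton_poly m f) (m - j)"

text \<open>The rescaling that turns the matrix of the braiding into \<open>C\<close>.\<close>

definition scaled_coord :: "(nat \<Rightarrow> 'k) \<Rightarrow> nat \<Rightarrow> 'k" where
  "scaled_coord f j = qfact j q * q21 ^ j * ad_coord f j"

lemma q21_nonzero: "q21 \<noteq> 0"
  using Q_nonzero[of X2 X1] by (simp add: Q_q21)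

lemma scaled_coord_eq_0_iff: "j \<le> m \<Longrightarrow> scaled_coord f j = 0 \<longleftrightarrow> ad_coord f j = 0"
  using K.qfact_nonzero q21_nonzero by (simp add: scaled_coord_def)

text \<open>The coefficients of \<open>(1 + c)\<close> applied to \<open>\<Sum> f\<^sub>i u\<^sub>i
\<otimes> u\<^bsub>m-i\<^esub>\<close>, computed with \<open>c(x\<^sub>2 \<otimes> u\<^sub>j) =
q\<^sub>2\<^sub>1\<^sup>js u\<^sub>j \<otimes> x\<^sub>2\<close>.\<close>

definition id_plus_c :: "(nat \<Rightarrow> 'k) \<Rightarrow> nat \<Rightarrow> 'k" where
  "id_plus_c f i = (\<Sum>j\<le>m. ad_coord f j * (ad_op ^^ (m - j)) (\<lambda>i. \<delta> 0 i + q21 ^ j * s * \<delta> j i) i)"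

lemma ad_op_basis:
  assumes "\<And>i. m < i \<Longrightarrow> f i = 0"
  shows "f i = (\<Sum>j\<le>m. ad_coord f j * (ad_op ^^ (m - j)) (\<delta> 0) i)"
proof (cases "i \<le> m")
  case False
  then have "(ad_op ^^ (m - j)) (\<delta> 0) i = 0" for j
    by (intro ad_op_power_supp[of 0]) (auto simp: \<delta>_def)
  then show ?thesis using assms False by simp
next
  case True
  define F where "F i = (\<Sum>j\<le>m. ad_coord f j * (ad_op ^^ (m - j)) (\<delta> 0) i)" for i
  have x: "newton_poly m ((ad_op ^^ (m - j)) (\<delta> 0)) = monom 1 (m - j)" if "j \<le> m" for j
  proof -
    define g where "g = (ad_op ^^ (m - j)) (\<delta> 0)"
    have "newton_poly (0 + (m - j)) g = monom 1 (m - j) * newton_poly 0 (\<delta> 0)"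
      unfolding g_def by (rule newton_poly_ad_op_power) (simp add: \<delta>_def)
    moreover have "newton_poly 0 (\<delta> 0) = 1" by (simp add: newton_poly_delta newton_def)
    moreover have "newton_poly m g = newton_poly (m - j) g"
      unfolding newton_poly_def
    proof (rule sum.mono_neutral_right)
      show "\<forall>i\<in>{..m} - {..m - j}. smult (g i) (newton i) = 0"
        using ad_op_power_supp[of 0 "\<delta> 0" "m - j"] by (auto simp: g_def \<delta>_def)
    qed auto
    ultimately show ?thesis by (simp add: g_def)
  qed
  have "newton_poly m F = (\<Sum>j\<le>m. smult (ad_coord f j) (monom 1 (m - j)))"
    unfolding F_def newton_poly_linear by (rule sum.cong) (simp_all add: x)
  also have "\<dots> = (\<Sum>j\<le>m. monom (coeff (newton_poly m f) j) j)"
    by (rule sum.reindex_bij_witness[of _ "\<lambda>j. m - j" "\<lambda>j. m - j"]) (auto simp: ad_coord_def smult_monom)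
  also have "\<dots> = newton_poly m f"
  proof (rule poly_eqI)
    fix i
    have "coeff (\<Sum>j\<le>m. monom (coeff (newton_poly m f) j) j) i = (\<Sum>j\<le>m. if j = i then coeff (newton_poly m f) i else 0)"
      unfolding coeff_sum by (rule sum.cong) auto
    then show "coeff (\<Sum>j\<le>m. monom (coeff (newton_poly m f) j) j) i = coeff (newton_poly m f) i"
      using coeff_newton_poly_above[of m i f] by (cases "i \<le> m") auto
  qed
  finally have "newton_poly m (\<lambda>i. f i - F i) = 0" by (simp add: newton_poly_diff)
  then have "f i - F i = 0" using True by (rule newton_poly_inj)
  then show ?thesis by (simp add: F_def)
qed

lemma D2_Phi:
  assumes "\<And>i. m < i \<Longrightarrow> f i = 0"
  shows "D X2 (Phi m f) = Theta m (id_plus_c f)"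
proof -
  have "f = (\<lambda>i. \<Sum>j\<le>m. ad_coord f j * (ad_op ^^ (m - j)) (\<delta> 0) i)"
    by (rule ext) (rule ad_op_basis, rule assms)
  then have "Phi m f = Phi m (\<lambda>i. \<Sum>j\<le>m. ad_coord f j * (ad_op ^^ (m - j)) (\<delta> 0) i)" by (rule arg_cong)
  also have "\<dots> = (\<Sum>j\<le>m. scale (ad_coord f j) (Phi m ((ad_op ^^ (m - j)) (\<delta> 0))))"
    by (rule Phi_linear)
  finally have "D X2 (Phi m f) = (\<Sum>j\<le>m. scale (ad_coord f j) (D X2 (Phi m ((ad_op ^^ (m - j)) (\<delta> 0)))))"
    by (simp add: D_sum D_scale)
  also have "\<dots> = (\<Sum>j\<le>m. scale (ad_coord f j) (Theta m ((ad_op ^^ (m - j)) (\<lambda>i. \<delta> 0 i + q21 ^ j * s * \<delta> j i))))"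
  proof (rule sum.cong[OF refl])
    fix j assume "j \<in> {..m}"
    then show "scale (ad_coord f j) (D X2 (Phi m ((ad_op ^^ (m - j)) (\<delta> 0)))) =
        scale (ad_coord f j) (Theta m ((ad_op ^^ (m - j)) (\<lambda>i. \<delta> 0 i + q21 ^ j * s * \<delta> j i)))"
      using D2_Phi_power[of j "m - j"] by simp
  qed
  also have "\<dots> = Theta m (id_plus_c f)"
    unfolding id_plus_c_def Theta_linear ..
  finally show ?thesis .
qed

text \<open>At level \<open>m\<close>, the braiding replaces \<open>X\<^bsup>m-j\<^esup>\<close> by
\<open>q\<^sub>2\<^sub>1\<^sup>jsX\<^bsup>m-j\<^esup>newton j\<close>, and the q-binomial theorem
expands the latter into monomials.\<close>

lemma coeff_newton_poly_id_plus_c: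
  assumes "n \<le> m"
  shows "qfact n q * q21 ^ n * coeff (newton_poly m (id_plus_c f)) (m - n) = K.bop (scaled_coord f) n"
proof -
  define F where "F j = (\<lambda>i. \<delta> 0 i + q21 ^ j * s * \<delta> j i)" for j
  have F: "newton_poly m ((ad_op ^^ (m - j)) (F j)) = monom 1 (m - j) * (1 + smult (q21 ^ j * s) (newton j))" if "j \<le> m" for j
  proof -
    have "newton_poly (j + (m - j)) ((ad_op ^^ (m - j)) (F j)) = monom 1 (m - j) * newton_poly j (F j)"
      by (rule newton_poly_ad_op_power) (simp add: F_def \<delta>_def)
    moreover have "newton_poly j (F j) = 1 + smult (q21 ^ j * s) (newton j)"
      unfolding F_def newton_poly_add newton_poly_scale by (simp add: newton_poly_delta newton_def)
    ultimately show ?thesis using that by simp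
  qed
  have "newton_poly m (id_plus_c f) = (\<Sum>j\<le>m. smult (ad_coord f j) (newton_poly m ((ad_op ^^ (m - j)) (F j))))"
    unfolding id_plus_c_def newton_poly_linear F_def ..
  also have "\<dots> = (\<Sum>j\<le>m. smult (ad_coord f j) (monom 1 (m - j) * (1 + smult (q21 ^ j * s) (newton j))))"
    by (rule sum.cong) (simp_all add: F)
  finally have "qfact n q * q21 ^ n * coeff (newton_poly m (id_plus_c f)) (m - n) = (\<Sum>j\<le>m. qfact n q * q21 ^ n *
      (ad_coord f j * coeff (monom 1 (m - j) * (1 + smult (q21 ^ j * s) (newton j))) (m - n)))"
    by (simp add: coeff_sum sum_distrib_left)
  also have "\<dots> = (\<Sum>j\<le>m. K.B n j * scaled_coord f j)"
  proof (rule sum.cong[OF refl])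
    fix j assume "j \<in> {..m}"
    then have j: "j \<le> m" by simp
    show "qfact n q * q21 ^ n * (ad_coord f j * coeff (monom 1 (m - j) * (1 + smult (q21 ^ j * s) (newton j))) (m - n)) =
      K.B n j * scaled_coord f j"
    proof (cases "n \<le> j")
      case False
      then have "m - n < m - j" using assms j by simp
      then show ?thesis using False by (simp add: coeff_monom_mult K.B_def K.C_def)
    next
      case True
      have e: "m - n - (m - j) = j - n" "m - j \<le> m - n" using True j by auto
      have "coeff (monom 1 (m - j) * (1 + smult (q21 ^ j * s) (newton j))) (m - n) =
          coeff (1 + smult (q21 ^ j * s) (newton j)) (j - n)"
        unfolding coeff_monom_mult e(1) using e(2) by simp
      also have "\<dots> = (if n = j then 1 else 0) + q21 ^ j * s * coeff (newton j) (j - n)"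
        using True by (cases "n = j") simp_all
      finally have c: "coeff (monom 1 (m - j) * (1 + smult (q21 ^ j * s) (newton j))) (m - n) =
          (if n = j then 1 else 0) + q21 ^ j * s * ((- q12) ^ n * q ^ (n choose 2) * qbin q j n)"
        unfolding coeff_newton[OF True] .
      have f: "qfact j q = qbin q j n * (qfact n q * qfact (j - n) q)"
        using qbin_qfact[OF True, of q] by simp
      have "(- r) ^ n = (- q12) ^ n * q21 ^ n" by (simp add: r_eq flip: power_mult_distrib)
      then have eps: "K.eps n = q ^ (n choose 2) * ((- q12) ^ n * q21 ^ n) * s" by (simp add: K.eps_def)
      have nz: "qfact (j - n) q \<noteq> 0" using K.qfact_nonzero j by simp
      have "K.C n j * scaled_coord f j = qfact n q * q21 ^ n * (ad_coord f j * (q21 ^ j * s * ((- q12) ^ n * q ^ (n choose 2) * qbin q j n)))"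
        using True nz by (simp add: K.C_def eps scaled_coord_def f)
      moreover have "(if n = j then 1 else 0) * scaled_coord f j = qfact n q * q21 ^ n * (ad_coord f j * (if n = j then 1 else 0))"
        by (simp add: scaled_coord_def)
      ultimately show ?thesis unfolding c K.B_def by (simp only: distrib_left distrib_right)
    qed
  qed
  finally show ?thesis by (simp add: K.bop_def)
qed

definition relations :: "(nat \<Rightarrow> 'k) set" where
  "relations = {f. (\<forall>i>m. f i = 0) \<and> Phi m f \<in> radical}"

lemma Phi_in_D_kernel:
  assumes "D X2 (Phi m f) = 0"
  shows "Phi m f \<in> D_kernel"
proof -
  have "lookup (Phi m f) [] = 0" using hom_Phi[of m f] by (auto simp: hom_def zero_prod_def)
  moreover have "D y (Phi m f) = 0" for y
    using assms D1_Phi by (cases y) auto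
  ultimately show ?thesis by (simp add: D_kernel_def)
qed

text \<open>A relation has \<open>D\<^sub>2(Phi m f)\<close> in the radical, hence
\<open>D\<^sub>2(Phi m f) = 0\<close> already in the free algebra by \<open>Theta_radical\<close>.
Conversely, \<open>Phi m f\<close> then lies in \<open>D_kernel\<close>, a subset of the Nichols
ideal.\<close>

lemma relation_iff:
  assumes supp: "\<And>i. m < i \<Longrightarrow> f i = 0"
  shows "Phi m f \<in> radical \<longleftrightarrow> (\<forall>n\<le>m. K.bop (scaled_coord f) n = 0)"
    and "Phi m f \<in> radical \<Longrightarrow> Phi m f \<in> nichols_ideal Q"
proof -
  have a: "\<forall>n\<le>m. K.bop (scaled_coord f) n = 0" "D X2 (Phi m f) = 0" if "Phi m f \<in> radical"
  proof -
    have "D X2 (Phi m f) \<in> radical" using DD_radical[OF that, of "[X2]"] by (simp add: DD_simps)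
    then have "id_plus_c f i = 0" if "i \<le> m" for i
      using Theta_radical[of "id_plus_c f"] that by (simp add: D2_Phi[OF supp])
    then show "D X2 (Phi m f) = 0" by (simp add: D2_Phi[OF supp] Theta_def)
    have "newton_poly m (id_plus_c f) = 0" using \<open>\<And>i. i \<le> m \<Longrightarrow> id_plus_c f i = 0\<close> by (simp add: newton_poly_def)
    then show "\<forall>n\<le>m. K.bop (scaled_coord f) n = 0" using coeff_newton_poly_id_plus_c[of _ f] by auto
  qed
  have b: "D X2 (Phi m f) = 0" if k: "\<forall>n\<le>m. K.bop (scaled_coord f) n = 0"
  proof -
    have "coeff (newton_poly m (id_plus_c f)) i = 0" for i
    proof (cases "i \<le> m")
      case True
      then show ?thesis
        using coeff_newton_poly_id_plus_c[of "m - i" f] k K.qfact_nonzero[of "m - i"] q21_nonzero by simp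
    qed (simp add: coeff_newton_poly_above)
    then have "newton_poly m (id_plus_c f) = 0" by (intro poly_eqI) simp
    then have "id_plus_c f i = 0" if "i \<le> m" for i using that by (rule newton_poly_inj)
    then show ?thesis by (simp add: D2_Phi[OF supp] Theta_def)
  qed
  have i: "Phi m f \<in> nichols_ideal Q" if "D X2 (Phi m f) = 0"
    using Phi_in_D_kernel[OF that] D_kernel_subset_nichols_ideal by blast
  show "Phi m f \<in> radical \<longleftrightarrow> (\<forall>n\<le>m. K.bop (scaled_coord f) n = 0)"
    using a(1) i b nichols_ideal_subset_radical by blast
  show "Phi m f \<in> radical \<Longrightarrow> Phi m f \<in> nichols_ideal Q"
    using a(2) i by blast
qed

lemma subspace_relations: "seqs.subspace relations"
proof (rule seqs.subspaceI)
  have 0: "Phi m (\<lambda>i. 0) = 0" by (simp add: Phi_def)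
  show "0 \<in> relations"
    using pm.subspace_0[OF subspace_radical] by (simp add: relations_def zero_fun_def 0)
next
  fix f g assume "f \<in> relations" "g \<in> relations"
  moreover have "Phi m (\<lambda>i. f i + g i) = Phi m f + Phi m g"
    by (simp add: Phi_def pm.scale_left_distrib sum.distrib)
  ultimately show "f + g \<in> relations"
    using pm.subspace_add[OF subspace_radical] by (simp add: relations_def plus_fun_def)
next
  fix c f assume "f \<in> relations"
  moreover have "Phi m (\<lambda>i. c * f i) = scale c (Phi m f)"
    by (simp add: Phi_def pm.scale_sum_right)
  ultimately show "(\<lambda>i. c * f i) \<in> relations"
    using pm.subspace_scale[OF subspace_radical] by (simp add: relations_def)
qed

text \<open>The largest indices of nonzero coefficients in relations. That the restriction to
indices at least \<open>m/2\<close> loses nothing follows from \<open>relation_ends\<close>.\<close>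

definition leading :: "nat set" where
  "leading = {a. a \<le> m \<and> m \<le> 2 * a \<and> (\<exists>f\<in>relations. f a \<noteq> 0 \<and> (\<forall>k>a. f k = 0))}"

lemma relation_eq_0:
  assumes f: "f \<in> relations" and 0: "\<And>i. i \<le> m \<Longrightarrow> m \<le> 2 * i \<Longrightarrow> f i = 0"
  shows "f k = 0"
proof -
  have rel: "Phi m f \<in> radical" and supp: "\<And>i. m < i \<Longrightarrow> f i = 0" using f by (auto simp: relations_def)
  define a where "a = (m + 1) div 2"
  have a: "a \<le> m" "m \<le> 2 * a" by (auto simp: a_def)
  have top: "f k = 0" if "m \<le> 2 * k" for k using 0[of k] supp[of k] that by linarith
  have above: "f k = 0" if "a < k" for k using top that a by simp
  have below: "f k = 0" if "k < m - a" for k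
    using relation_support[OF rel a above] that by blast
  consider "m \<le> 2 * k" | "k < m - a" | "k = m - a" "a \<noteq> m - a" by (auto simp: a_def) linarith
  then show ?thesis
  proof cases
    case 3
    then show ?thesis using relation_ends(2)[OF rel a above below] top[OF a(2)] by simp
  qed (use top below in auto)
qed

text \<open>The flag given by the coefficients in the places \<open>m, m - 1, \<dots>\<close> down
to \<open>m/2\<close>; the remaining coefficients are determined by
\<open>relation_ends\<close>.\<close>

lemma dim_relations_leading: "seqs.dim relations = card leading"
proof -
  define \<phi> where "\<phi> i f = (if m \<le> 2 * i then f i else 0)" for i and f :: "nat \<Rightarrow> 'k"
  have "seqs.dim relations = card {i. i < Suc m \<and> (\<exists>f\<in>relations. \<phi> i f \<noteq> 0 \<and> (\<forall>k. i < k \<and> k < Suc m \<longrightarrow> \<phi> k f = 0))}"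
  proof (rule seqs.dim_eq_card_leading[OF subspace_relations])
    fix f assume f: "f \<in> relations" and z: "\<And>i. i < Suc m \<Longrightarrow> \<phi> i f = 0"
    have "f i = 0" if "i \<le> m" "m \<le> 2 * i" for i using z[of i] that by (simp add: \<phi>_def)
    then have "f k = 0" for k using relation_eq_0[OF f] by blast
    then show "f = 0" by (simp add: fun_eq_iff)
  qed (auto simp: \<phi>_def)
  also have "{i. i < Suc m \<and> (\<exists>f\<in>relations. \<phi> i f \<noteq> 0 \<and> (\<forall>k. i < k \<and> k < Suc m \<longrightarrow> \<phi> k f = 0))} = leading"
    (is "?A = _")
  proof (intro antisym subsetI)
    fix i assume "i \<in> ?A"
    then obtain f where f: "i \<le> m" "f \<in> relations" "\<phi> i f \<noteq> 0" "\<forall>k. i < k \<and> k < Suc m \<longrightarrow> \<phi> k f = 0"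
      by auto
    then have i: "m \<le> 2 * i" "f i \<noteq> 0" by (auto simp: \<phi>_def split: if_splits)
    have "f k = 0" if "i < k" for k
      using f(2,4) that i(1) by (cases "k \<le> m") (auto simp: \<phi>_def relations_def)
    with f i show "i \<in> leading" by (auto simp: leading_def)
  next
    fix i assume "i \<in> leading"
    then show "i \<in> ?A" by (auto simp: leading_def \<phi>_def)
  qed
  finally show ?thesis .
qed

text \<open>As \<open>B\<close> is upper triangular and does not depend on \<open>m\<close>, a
kernel vector whose last nonzero entry is in place \<open>j\<close> is a kernel vector at level
\<open>j\<close>.\<close>

lemma kernel_top_iff_in_J:
  assumes j: "j \<le> m"
  shows "(\<exists>H. H j \<noteq> 0 \<and> (\<forall>k. j < k \<and> k \<le> m \<longrightarrow> H k = 0) \<and> (\<forall>n\<le>m. K.bop H n = 0)) \<longleftrightarrow> in_J q r s j"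
proof -
  interpret J: kernel_setup q r s j
    using K.q0 K.qfact_nonzero[OF j] bprod_nonzero[OF j] by unfold_locales
  have e: "K.bop H n = J.bop H n" if "\<And>k. j < k \<Longrightarrow> k \<le> m \<Longrightarrow> H k = 0" for H n
    unfolding K.bop_def J.bop_def by (rule sum.mono_neutral_right) (use that j in auto)
  have "(\<exists>H. H j \<noteq> 0 \<and> (\<forall>k. j < k \<and> k \<le> m \<longrightarrow> H k = 0) \<and> (\<forall>n\<le>m. K.bop H n = 0)) \<longleftrightarrow> J.new_kernel_vector"
  proof
    assume "\<exists>H. H j \<noteq> 0 \<and> (\<forall>k. j < k \<and> k \<le> m \<longrightarrow> H k = 0) \<and> (\<forall>n\<le>m. K.bop H n = 0)"
    then obtain H where H: "H j \<noteq> 0" "\<And>k. j < k \<Longrightarrow> k \<le> m \<Longrightarrow> H k = 0" "\<And>n. n \<le> m \<Longrightarrow> K.bop H n = 0"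
      by auto
    then have "J.bop H n = 0" if "n \<le> j" for n using e[of H n] j that by simp
    then show "J.new_kernel_vector" using H(1) unfolding J.new_kernel_vector_def by blast
  next
    assume "J.new_kernel_vector"
    then obtain H where H: "H j \<noteq> 0" "\<And>n. n \<le> j \<Longrightarrow> J.bop H n = 0"
      unfolding J.new_kernel_vector_def by auto
    define H' where "H' k = (if k \<le> j then H k else 0)" for k
    have "K.bop H' n = 0" if "n \<le> m" for n
    proof (cases "n \<le> j")
      case True
      have "K.bop H' n = J.bop H' n" by (rule e) (simp add: H'_def)
      also have "\<dots> = J.bop H n" unfolding J.bop_def by (rule sum.cong) (auto simp: H'_def)
      finally show ?thesis using H(2)[OF True] by simp
    next
      case False
      then show ?thesis using K.bop_above[of j H' n] by (simp add: H'_def)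
    qed
    then show "\<exists>H. H j \<noteq> 0 \<and> (\<forall>k. j < k \<and> k \<le> m \<longrightarrow> H k = 0) \<and> (\<forall>n\<le>m. K.bop H n = 0)"
      using H(1) by (intro exI[of _ H']) (simp add: H'_def)
  qed
  also have "\<dots> \<longleftrightarrow> in_J q r s j" by (rule J.new_kernel_vector_iff_in_J)
  finally show ?thesis .
qed

text \<open>The flag given by the coordinates \<open>ad_coord\<close>.\<close>

lemma dim_relations_J: "seqs.dim relations = card (J_set q r s \<inter> {0..m})"
proof -
  have "seqs.dim relations = card {j. j < Suc m \<and> (\<exists>f\<in>relations. ad_coord f j \<noteq> 0 \<and> (\<forall>k. j < k \<and> k < Suc m \<longrightarrow> ad_coord f k = 0))}"
  proof (rule seqs.dim_eq_card_leading[OF subspace_relations, of "\<lambda>j f. ad_coord f j"])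
    fix f assume f: "f \<in> relations" and z: "\<And>i. i < Suc m \<Longrightarrow> ad_coord f i = 0"
    have "coeff (newton_poly m f) i = 0" for i
      using z[of "m - i"] coeff_newton_poly_above[of m i f] by (cases "i \<le> m") (auto simp: ad_coord_def)
    then have "newton_poly m f = 0" by (intro poly_eqI) simp
    then have "f i = 0" if "i \<le> m" for i using that by (rule newton_poly_inj)
    moreover have "f i = 0" if "m < i" for i using f that by (simp add: relations_def)
    ultimately show "f = 0" by (simp add: fun_eq_iff) (metis not_le)
  qed (simp_all add: ad_coord_def plus_fun_def newton_poly_add newton_poly_scale)
  also have "{j. j < Suc m \<and> (\<exists>f\<in>relations. ad_coord f j \<noteq> 0 \<and> (\<forall>k. j < k \<and> k < Suc m \<longrightarrow> ad_coord f k = 0))} =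
      J_set q r s \<inter> {0..m}"
    (is "?A = ?B")
  proof (intro antisym subsetI)
    fix j assume "j \<in> ?A"
    then obtain f where f: "j \<le> m" "f \<in> relations" "ad_coord f j \<noteq> 0"
      "\<And>k. j < k \<Longrightarrow> k \<le> m \<Longrightarrow> ad_coord f k = 0" by (auto simp: less_Suc_eq_le)
    then have "\<forall>n\<le>m. K.bop (scaled_coord f) n = 0" using relation_iff(1)[of f] by (simp add: relations_def)
    moreover have "scaled_coord f j \<noteq> 0" "\<forall>k. j < k \<and> k \<le> m \<longrightarrow> scaled_coord f k = 0"
      using f scaled_coord_eq_0_iff by auto
    ultimately have "in_J q r s j" using kernel_top_iff_in_J[OF f(1)] by blast
    then show "j \<in> ?B" using f(1) by (simp add: J_set_def)
  next
    fix j assume "j \<in> ?B"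
    then have j: "j \<le> m" "in_J q r s j" by (auto simp: J_set_def)
    then obtain H where H: "H j \<noteq> 0" "\<And>k. j < k \<Longrightarrow> k \<le> m \<Longrightarrow> H k = 0" "\<And>n. n \<le> m \<Longrightarrow> K.bop H n = 0"
      using kernel_top_iff_in_J[OF j(1)] by blast
    define P where "P = (\<Sum>k\<le>m. monom (H k / (qfact k q * q21 ^ k)) (m - k))"
    have P: "coeff P i = (if i \<le> m then H (m - i) / (qfact (m - i) q * q21 ^ (m - i)) else 0)" for i
    proof -
      have "coeff P i = (\<Sum>k\<le>m. if k = m - i then (if i \<le> m then H (m - i) / (qfact (m - i) q * q21 ^ (m - i)) else 0) else 0)"
        unfolding P_def coeff_sum by (rule sum.cong) auto
      then show ?thesis by simp
    qed
    then obtain f where f: "\<forall>i>m. f i = 0" "newton_poly m f = P" using newton_poly_surj[of m P] by auto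
    have "scaled_coord f k = H k" if "k \<le> m" for k
      using that K.qfact_nonzero[OF that] q21_nonzero by (simp add: scaled_coord_def ad_coord_def f(2) P)
    then have "K.bop (scaled_coord f) n = K.bop H n" for n unfolding K.bop_def by (intro sum.cong) auto
    then have "f \<in> relations" using relation_iff(1)[of f] f(1) H(3) by (simp add: relations_def)
    moreover have "ad_coord f j \<noteq> 0" "\<forall>k. j < k \<and> k < Suc m \<longrightarrow> ad_coord f k = 0"
      using scaled_coord_eq_0_iff \<open>\<And>k. k \<le> m \<Longrightarrow> scaled_coord f k = H k\<close> H(1,2) j(1) by (metis, metis less_Suc_eq_le)
    ultimately show "j \<in> ?A" using j(1) by auto
  qed
  finally show ?thesis .
qed

lemma card_leading: "card leading = card (J_set q r s \<inter> {0..m})"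
  using dim_relations_leading dim_relations_J by simp

end

section \<open>Words with at most two letters x2\<close>

definition block :: "nat \<Rightarrow> word" where
  "block a = replicate a X1 @ [X2]"

lemma block_simps: "block 0 = [X2]" "block (Suc a) = X1 # block a"
  by (simp_all add: block_def)

lemma block_neq_Nil: "block a \<noteq> []"
  by (simp add: block_def)

lemma length_block: "length (block a) = Suc a"
  by (simp add: block_def)

lemma lex_less_simps:
  "\<not> u <\<^sub>l\<^sub>e\<^sub>x []" "[] <\<^sub>l\<^sub>e\<^sub>x v \<longleftrightarrow> v \<noteq> []"
  "x # u <\<^sub>l\<^sub>e\<^sub>x y # v \<longleftrightarrow> x = X1 \<and> y = X2 \<or> x = y \<and> u <\<^sub>l\<^sub>e\<^sub>x v"
  by (auto simp: lex_less_def neq_Nil_conv)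

lemma lex_less_irrefl: "\<not> u <\<^sub>l\<^sub>e\<^sub>x u"
  by (induction u) (simp_all add: lex_less_simps)

lemma block_append_less: "block a @ t <\<^sub>l\<^sub>e\<^sub>x block b @ t' \<longleftrightarrow> b < a \<or> a = b \<and> t <\<^sub>l\<^sub>e\<^sub>x t'"
proof (induction a arbitrary: b)
  case 0
  show ?case by (cases b) (simp_all add: block_simps lex_less_simps)
next
  case (Suc a)
  show ?case by (cases b) (simp_all add: block_simps lex_less_simps Suc)
qed

lemma block_append_less_block: "block a @ t <\<^sub>l\<^sub>e\<^sub>x block b \<longleftrightarrow> b < a"
  using block_append_less[of a t b "[]"] by (simp add: lex_less_simps)

lemma block_less_block: "block a <\<^sub>l\<^sub>e\<^sub>x block b \<longleftrightarrow> b < a"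
  using block_append_less_block[of a "[]"] by simp

lemma block_append_not_less_replicate: "\<not> block a @ t <\<^sub>l\<^sub>e\<^sub>x replicate j X1"
proof (induction a arbitrary: j)
  case 0
  show ?case by (cases j) (simp_all add: block_simps lex_less_simps)
next
  case (Suc a)
  show ?case by (cases j) (simp_all add: block_simps lex_less_simps Suc)
qed

lemma deg_eq_count: "deg w = (int (count_list w X1), int (count_list w X2))"
  by (induction w rule: deg.induct) (simp_all add: zero_prod_def)

lemma no_X2: "count_list w X2 = 0 \<Longrightarrow> w = replicate (length w) X1"
proof (induction w)
  case (Cons x w)
  then show ?case by (cases x) auto
qed simp

lemma split_at_X2: "count_list w X2 \<noteq> 0 \<Longrightarrow> \<exists>a w'. w = block a @ w'"
proof (induction w)
  case (Cons x w)
  show ?case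
  proof (cases x)
    case X1
    then obtain a w' where "w = block a @ w'" using Cons by auto
    then have "x # w = block (Suc a) @ w'" by (simp add: block_simps X1)
    then show ?thesis by blast
  next
    case X2
    then have "x # w = block 0 @ w" by (simp add: block_simps)
    then show ?thesis by blast
  qed
qed simp

lemma count_replicate: "count_list (replicate n x) y = (if x = y then n else 0)"
  by (cases "x = y"; induction n) simp_all

lemma count_block: "count_list (block a) X1 = a" "count_list (block a) X2 = 1"
  by (simp_all add: block_def count_replicate)

lemma lyndon_no_trailing_X1:
  assumes "lyndon (u @ replicate c X1)" "u \<noteq> []"
  shows "c = 0"
proof (cases c)
  case (Suc c')
  then have e: "u @ replicate c X1 = (u @ replicate c' X1) @ [X1]"
    by (simp add: replicate_append_same)
  then have "u @ replicate c X1 <\<^sub>l\<^sub>e\<^sub>x [X1]" using assms unfolding lyndon_def by (metis append_is_Nil_conv not_Cons_self2)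
  then show ?thesis using assms(2) by (cases u) (simp_all add: lex_less_simps)
qed

lemma lyndon_X1: "lyndon [X1]"
  by (auto simp: lyndon_def Cons_eq_append_conv)

lemma not_lyndon_replicate: "\<not> lyndon (replicate (Suc (Suc n)) X1)"
proof
  assume "lyndon (replicate (Suc (Suc n)) X1)"
  moreover have "replicate (Suc (Suc n)) X1 = replicate (Suc n) X1 @ replicate 1 X1"
    by (simp add: replicate_append_same)
  ultimately have "lyndon (replicate (Suc n) X1 @ replicate 1 X1)" by (simp only:)
  from lyndon_no_trailing_X1[OF this] show False by simp
qed

lemma suffix_block: "block a = u @ v \<Longrightarrow> v \<noteq> [] \<Longrightarrow> \<exists>b. v = block b \<and> a = length u + b"
proof (induction u arbitrary: a)
  case Nil
  then show ?case by auto
next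
  case (Cons x u)
  then obtain a' where "a = Suc a'" by (cases a) (auto simp: block_simps append_eq_Cons_conv)
  then show ?case using Cons by (auto simp: block_simps)
qed

lemma lyndon_block: "lyndon (block a)"
  unfolding lyndon_def
proof (intro conjI allI impI, rule block_neq_Nil)
  fix u v assume "block a = u @ v \<and> u \<noteq> [] \<and> v \<noteq> []"
  then obtain b where "v = block b" "a = length u + b" "u \<noteq> []" using suffix_block by blast
  then show "block a <\<^sub>l\<^sub>e\<^sub>x v" by (simp add: block_less_block)
qed

text \<open>A proper suffix is
\<open>x\<^sub>1\<^bsup>a'\<^esup>x\<^sub>2x\<^sub>1\<^sup>bx\<^sub>2\<close> with \<open>a' <
a\<close> or \<open>x\<^sub>1\<^bsup>b'\<^esup>x\<^sub>2\<close> with \<open>b' \<le>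
b\<close>.\<close>

lemma lyndon_block_block: "lyndon (block a @ block b) \<longleftrightarrow> b < a"
proof
  assume "lyndon (block a @ block b)"
  then have "block a @ block b <\<^sub>l\<^sub>e\<^sub>x block b" using block_neq_Nil unfolding lyndon_def by blast
  then show "b < a" by (simp add: block_append_less_block)
next
  assume b: "b < a"
  show "lyndon (block a @ block b)"
    unfolding lyndon_def
  proof (intro conjI allI impI)
    show "block a @ block b \<noteq> []" using block_neq_Nil by simp
    fix u v assume uv: "block a @ block b = u @ v \<and> u \<noteq> [] \<and> v \<noteq> []"
    then consider t where "block a = u @ t" "v = t @ block b" "t \<noteq> []" | t where "block b = t @ v"
      unfolding append_eq_append_conv2 by (metis append_Nil)
    then show "block a @ block b <\<^sub>l\<^sub>e\<^sub>x v"
    proof cases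
      case 1
      then obtain a' where "t = block a'" "a = length u + a'" using suffix_block by blast
      moreover have "u \<noteq> []" using uv by simp
      ultimately show ?thesis unfolding 1(2) by (simp add: block_append_less)
    next
      case 2
      then obtain b' where "v = block b'" "b = length t + b'" using suffix_block uv by blast
      then show ?thesis using b by (simp add: block_append_less_block)
    qed
  qed
qed

lemma lyndon_one_X2:
  assumes "lyndon w" "count_list w X2 = 1"
  shows "w = block (count_list w X1)"
proof -
  obtain a w' where w: "w = block a @ w'" using split_at_X2[of w] assms(2) by auto
  then have "count_list w' X2 = 0" using assms(2) by (simp add: count_block)
  then have "w' = replicate (length w') X1" by (rule no_X2)
  then have "w' = []" using lyndon_no_trailing_X1[of "block a" "length w'"] assms(1) w block_neq_Nil by auto
  then show ?thesis using w by (simp add: count_block)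
qed

lemma lyndon_two_X2:
  assumes "lyndon w" "count_list w X2 = 2"
  shows "\<exists>a b. b < a \<and> w = block a @ block b"
proof -
  obtain a w' where w: "w = block a @ w'" using split_at_X2[of w] assms(2) by auto
  then have "count_list w' X2 = 1" using assms(2) by (simp add: count_block)
  then obtain b w'' where w': "w' = block b @ w''" "count_list w'' X2 = 0"
    using split_at_X2[of w'] by (auto simp: count_block)
  then have "w'' = replicate (length w'') X1" by (intro no_X2)
  then have "w'' = []"
    using lyndon_no_trailing_X1[of "block a @ block b" "length w''"] assms(1) w w'(1) block_neq_Nil by auto
  then have "w = block a @ block b" using w w' by simp
  then show ?thesis using assms(1) lyndon_block_block by blast
qed

lemma count_word_power: "count_list (word_power v k) x = k * count_list v x"
  by (induction k) (simp_all add: word_power_def)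

lemma word_power_1: "word_power v (Suc 0) = v"
  by (simp add: word_power_def)

lemma word_power_2: "word_power v 2 = v @ v"
  by (simp add: word_power_def numeral_2_eq_2)

lemma shirshovI:
  assumes "lyndon_split w n" "\<And>k. lyndon_split w k \<Longrightarrow> n \<le> k"
  shows "shirshov_left w = take n w" "shirshov_right w = drop n w"
proof -
  have "(LEAST n. lyndon_split w n) = n" using assms by (rule Least_equality)
  then show "shirshov_left w = take n w" "shirshov_right w = drop n w"
    by (simp_all add: shirshov_left_def shirshov_right_def)
qed

lemma split_X1: "lyndon w \<Longrightarrow> lyndon_split (X1 # w) 1"
  using lyndon_X1 by (auto simp: lyndon_split_def lyndon_def)

lemma shirshov_X1:
  assumes "lyndon w"
  shows "shirshov_left (X1 # w) = [X1]" "shirshov_right (X1 # w) = w"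
  using shirshovI[OF split_X1[OF assms]] by (auto simp: lyndon_split_def Suc_le_eq)

lemma split_consecutive: "lyndon_split (block (Suc b) @ block b) (Suc (Suc b))"
  using lyndon_block by (simp add: lyndon_split_def length_block)

text \<open>For a smaller left factor, either it is a power of \<open>x\<^sub>1\<close> or the right
factor is a square.\<close>

lemma shirshov_consecutive:
  "shirshov_left (block (Suc b) @ block b) = block (Suc b)" "shirshov_right (block (Suc b) @ block b) = block b"
proof -
  have "Suc (Suc b) \<le> k" if k: "lyndon_split (block (Suc b) @ block b) k" for k
  proof (rule ccontr)
    assume "\<not> Suc (Suc b) \<le> k"
    then have kb: "k \<le> Suc b" by simp
    show False
    proof (cases "k = 1")
      case True
      then have "drop k (block (Suc b) @ block b) = block b @ block b" by (simp add: block_simps)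
      then show False using k lyndon_block_block by (simp add: lyndon_split_def)
    next
      case False
      then obtain j where j: "k = Suc (Suc j)" using k by (metis One_nat_def lyndon_split_def not0_implies_Suc not_less_zero)
      have "take k (block (Suc b) @ block b) = replicate k X1" using kb by (simp add: block_def min_def del: replicate.simps)
      then show False using k not_lyndon_replicate j by (simp add: lyndon_split_def)
    qed
  qed
  from shirshovI[OF split_consecutive this]
  show "shirshov_left (block (Suc b) @ block b) = block (Suc b)" "shirshov_right (block (Suc b) @ block b) = block b"
    by (simp_all add: length_block)
qed

lemma no_split_letter: "\<not> lyndon_split [x] n"
  by (auto simp: lyndon_split_def)

lemma super_letter_letter: "super_letter Q [x] = Poly_Mapping.single [x] 1"
proof -
  have "Ex (lyndon_split [x]) = False" using no_split_letter by blast
  then show ?thesis by (subst super_letter.simps) (simp only: if_False)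
qed

lemma mult_order_eq_2: "mult_order x = enat 2 \<longleftrightarrow> x\<^sup>2 = 1 \<and> x \<noteq> (1 :: 'k::field)"
proof
  assume a: "mult_order x = enat 2"
  then have ex: "\<exists>n>0. x ^ n = 1" and l: "(LEAST n. 0 < n \<and> x ^ n = 1) = 2"
    by (auto simp: mult_order_def split: if_splits)
  have "x\<^sup>2 = 1" using LeastI_ex[of "\<lambda>n. 0 < n \<and> x ^ n = 1"] ex l by simp
  moreover have "x \<noteq> 1" using not_less_Least[of 1 "\<lambda>n. 0 < n \<and> x ^ n = 1"] l by auto
  ultimately show "x\<^sup>2 = 1 \<and> x \<noteq> 1" ..
next
  assume a: "x\<^sup>2 = 1 \<and> x \<noteq> 1"
  have "(LEAST n. 0 < n \<and> x ^ n = 1) = 2"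
  proof (rule Least_equality)
    fix n assume "0 < n \<and> x ^ n = 1"
    then show "2 \<le> n" using a by (cases "n = 1") auto
  qed (use a in simp)
  moreover have "\<exists>n>0. x ^ n = 1" using a by (intro exI[of _ 2]) simp
  ultimately show "mult_order x = enat 2" by (simp add: mult_order_def)
qed

lemma mult_order_eq_1: "mult_order x = enat 1 \<longleftrightarrow> (x :: 'k::field) = 1"
proof
  assume "mult_order x = enat 1"
  then have ex: "\<exists>n>0. x ^ n = 1" and l: "(LEAST n. 0 < n \<and> x ^ n = 1) = 1"
    by (auto simp: mult_order_def split: if_splits)
  then show "x = 1" using LeastI_ex[of "\<lambda>n. 0 < n \<and> x ^ n = 1"] by simp
next
  assume x: "x = 1"
  have "(LEAST n::nat. 0 < n \<and> (1::'k) ^ n = 1) = 1" by (rule Least_equality) auto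
  then show "mult_order x = enat 1" using x by (auto simp: mult_order_def)
qed

lemma one_in_root_orders: "enat (Suc 0) \<in> root_orders Q \<alpha>"
  by (auto simp: root_orders_def Let_def one_enat_def)

text \<open>Orders of roots of unity: \<open>2\<close> is \<open>o\<^sub>\<alpha>\<close> if
\<open>\<chi>(\<alpha>,\<alpha>) = -1 \<noteq> 1\<close>, and \<open>2 = o\<^sub>\<alpha>p\<close>
if \<open>p = 2\<close> and \<open>\<chi>(\<alpha>,\<alpha>) = 1 = -1\<close>.\<close>

lemma two_in_root_orders: "enat 2 \<in> root_orders Q \<alpha> \<longleftrightarrow> bichar Q \<alpha> \<alpha> = (-1 :: 'k::field)"
proof -
  define x where "x = bichar Q \<alpha> \<alpha>"
  define n where "n = mult_order x"
  have m: "x = -1 \<longleftrightarrow> (x\<^sup>2 = 1 \<and> x \<noteq> 1) \<or> (x = 1 \<and> (2::'k) = 0)"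
  proof -
    have "x\<^sup>2 = 1 \<longleftrightarrow> x = 1 \<or> x = -1" by (rule power2_eq_1_iff)
    moreover have "(1::'k) = -1 \<longleftrightarrow> (2::'k) = 0"
      by (simp add: eq_neg_iff_add_eq_0)
    ultimately show ?thesis by blast
  qed
  have char2: "(2::'k) = 0 \<longleftrightarrow> CHAR('k) = 2"
  proof
    assume "(2::'k) = 0"
    then have "CHAR('k) dvd 2" using of_nat_eq_0_iff_char_dvd[where ?'a = 'k, of 2] by simp
    then have "CHAR('k) \<le> 2" by (rule dvd_imp_le) simp
    moreover have "CHAR('k) \<noteq> 0"
    proof
      assume "CHAR('k) = 0"
      with \<open>CHAR('k) dvd 2\<close> show False by simp
    qed
    moreover have "CHAR('k) \<noteq> 1" using CHAR_not_1 by auto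
    ultimately show "CHAR('k) = 2" by linarith
  next
    assume "CHAR('k) = 2"
    then show "(2::'k) = 0" using of_nat_CHAR[where ?'a = 'k] by simp
  qed
  show ?thesis
  proof (cases "n = \<infinity> \<or> CHAR('k) = 0")
    case True
    then have "enat 2 \<in> root_orders Q \<alpha> \<longleftrightarrow> n = enat 2"
      unfolding root_orders_def x_def[symmetric] n_def[symmetric] Let_def by (auto simp: one_enat_def)
    also have "\<dots> \<longleftrightarrow> x = -1"
    proof (cases "n = \<infinity>")
      case True
      then have "x \<noteq> 1" using mult_order_eq_1[of x] by (auto simp: n_def)
      then show ?thesis unfolding n_def mult_order_eq_2 m by blast
    next
      case False
      then have "CHAR('k) = 0" using \<open>n = \<infinity> \<or> CHAR('k) = 0\<close> by blast
      then have "(2::'k) \<noteq> 0" using char2 by simp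
      then show ?thesis unfolding n_def mult_order_eq_2 m by blast
    qed
    finally show ?thesis by (simp add: x_def)
  next
    case False
    define p where "p = CHAR('k)"
    have p: "p \<noteq> 0" "p \<noteq> 1" using False CHAR_not_1 by (auto simp: p_def)
    obtain j where j: "n = enat j" using False by auto
    have "enat 2 \<in> root_orders Q \<alpha> \<longleftrightarrow> (\<exists>k. 2 = j * p ^ k)"
      using False unfolding root_orders_def x_def[symmetric] n_def[symmetric] Let_def
      by (auto simp: one_enat_def j p_def)
    also have "\<dots> \<longleftrightarrow> j = 2 \<or> j = 1 \<and> p = 2"
    proof
      assume "\<exists>k. 2 = j * p ^ k"
      then obtain k where k: "2 = j * p ^ k" ..
      show "j = 2 \<or> j = 1 \<and> p = 2"
      proof (cases k)
        case (Suc i)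
        then have "p dvd 2" using k by (metis dvd_mult dvd_triv_left power_Suc)
        then have "p \<le> 2" by (rule dvd_imp_le) simp
        then have "p = 2" using p by linarith
        then have "2 = j * 2 ^ Suc i" using k unfolding Suc by (simp only:)
        then have "j * 2 ^ i = 1" by simp
        then show ?thesis using \<open>p = 2\<close> by simp
      qed (use k in simp)
    next
      assume "j = 2 \<or> j = 1 \<and> p = 2"
      then show "\<exists>k. 2 = j * p ^ k"
      proof
        assume "j = 2"
        then show ?thesis by (intro exI[of _ 0]) simp
      next
        assume "j = 1 \<and> p = 2"
        then show ?thesis by (intro exI[of _ 1]) simp
      qed
    qed
    also have "\<dots> \<longleftrightarrow> x = -1"
      using mult_order_eq_2[of x] mult_order_eq_1[of x] m char2 j by (simp add: n_def p_def)
    finally show ?thesis by (simp add: x_def)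
  qed
qed

lemma candidate_block: "root_vector_candidate Q (block a)"
  unfolding root_vector_candidate_def
  using lyndon_block one_in_root_orders word_power_1[of "block a"] block_neq_Nil by metis

lemma candidate_block_block: "b < a \<Longrightarrow> root_vector_candidate Q (block a @ block b)"
  unfolding root_vector_candidate_def
  using lyndon_block_block one_in_root_orders word_power_1[of "block a @ block b"] block_neq_Nil by (metis append_is_Nil_conv)

lemma candidate_one_X2:
  assumes "root_vector_candidate Q w" "count_list w X2 = 1"
  shows "w = block (count_list w X1)"
proof -
  obtain v k where v: "lyndon v" "w = word_power v k" using assms(1) by (auto simp: root_vector_candidate_def)
  then have "k = 1" "count_list v X2 = 1" using assms(2) by (simp_all add: count_word_power)
  then show ?thesis using lyndon_one_X2[of v] v by (simp add: word_power_1)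
qed

lemma candidate_two_X2:
  assumes "root_vector_candidate Q w" "count_list w X2 = 2"
  shows "\<exists>a b. w = block a @ block b \<and> b \<le> a"
proof -
  obtain v k where v: "lyndon v" "w = word_power v k" using assms(1) by (auto simp: root_vector_candidate_def)
  have "k * count_list v X2 = 2" using assms(2) v by (simp add: count_word_power)
  then have "k = 1 \<and> count_list v X2 = 2 \<or> k = 2 \<and> count_list v X2 = 1"
  proof -
    have "k dvd 2" using \<open>k * count_list v X2 = 2\<close> by (metis dvd_triv_left)
    then have "k \<le> 2" by (rule dvd_imp_le) simp
    then consider "k = 0" | "k = 1" | "k = 2" by linarith
    then show ?thesis using \<open>k * count_list v X2 = 2\<close> by cases auto
  qed
  then show ?thesis
  proof
    assume "k = 1 \<and> count_list v X2 = 2"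
    then show ?thesis using lyndon_two_X2[OF v(1)] v(2)
      by (metis One_nat_def less_imp_le word_power_1)
  next
    assume "k = 2 \<and> count_list v X2 = 1"
    then show ?thesis using lyndon_one_X2[OF v(1)] v(2) by (metis word_power_2 order_refl)
  qed
qed

lemma candidate_square: "root_vector_candidate Q (block a @ block a) \<longleftrightarrow> enat 2 \<in> root_orders Q (deg (block a))"
proof
  assume "root_vector_candidate Q (block a @ block a)"
  then obtain v k where v: "lyndon v" "enat k \<in> root_orders Q (deg v)" "word_power (block a) 2 = word_power v k"
    by (auto simp: root_vector_candidate_def word_power_2)
  have "1 \<le> k" using v(3) block_neq_Nil by (cases k) (auto simp: word_power_2, auto simp: word_power_def)
  then have "block a = v \<and> 2 = k" using lyndon_power_unique[OF lyndon_block v(1) _ _ v(3)] by simp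
  then show "enat 2 \<in> root_orders Q (deg (block a))" using v(2) by simp
next
  assume "enat 2 \<in> root_orders Q (deg (block a))"
  then show "root_vector_candidate Q (block a @ block a)"
    unfolding root_vector_candidate_def using lyndon_block word_power_2[of "block a"] block_neq_Nil
    by (metis append_is_Nil_conv)
qed

lemma bracket_lyndon: "lyndon v \<Longrightarrow> bracket Q v = super_letter Q v"
  using bracket_word_power[of v "Suc 0" Q] by (simp add: word_power_1)

lemma bracket_square: "bracket Q (block a @ block a) = super_letter Q (block a) ^ 2"
  using bracket_word_power[OF lyndon_block, of 2 Q a] by (simp add: word_power_2)

section \<open>Root vectors with two letters x2\<close>

lemma hom_one: "hom 0 (1 :: 'k::field tensor_alg)"
  by (simp add: hom_def lookup_one when_def zero_list_def)

lemma hom_power: "hom (deg v) a \<Longrightarrow> hom (deg (word_power v k)) (a ^ k)"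
proof (induction k)
  case (Suc k)
  then have "hom (deg v + deg (word_power v k)) (a * a ^ k)" by (intro hom_mult) auto
  then show ?case by (simp add: word_power_def deg_append)
qed (simp add: word_power_def hom_one)

lemma hom_super_letter: "hom (deg w) (super_letter Q w)"
proof (induction Q w rule: super_letter.induct)
  case (1 Q w)
  show ?case
  proof (cases "\<exists>n. lyndon_split w n")
    case True
    have w: "w = shirshov_left w @ shirshov_right w"
      by (simp add: shirshov_left_def shirshov_right_def)
    have l: "hom (deg (shirshov_left w)) (super_letter Q (shirshov_left w))"
      and r: "hom (deg (shirshov_right w)) (super_letter Q (shirshov_right w))"
      using 1 True by blast+
    have d: "deg w = deg (shirshov_left w) + deg (shirshov_right w)"
      using arg_cong[OF w, of deg] by (simp only: deg_append)
    have "hom (deg w) (super_letter Q (shirshov_left w) * super_letter Q (shirshov_right w))"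
      unfolding d by (rule hom_mult[OF l r])
    moreover have "hom (deg w) (super_letter Q (shirshov_right w) * super_letter Q (shirshov_left w))"
      unfolding d add.commute[of "deg (shirshov_left w)"] by (rule hom_mult[OF r l])
    ultimately show ?thesis using True
      by (subst super_letter.simps) (simp add: hom_diff hom_scale)
  next
    case False
    then have "Ex (lyndon_split w) = False" by blast
    then show ?thesis by (subst super_letter.simps) (simp only: if_False hom_single)
  qed
qed

lemma hom_bracket:
  assumes "root_vector_candidate Q v"
  shows "hom (deg v) (bracket Q v)"
proof -
  obtain u k where v: "v \<noteq> []" "lyndon u" "v = word_power u k"
    using assms by (auto simp: root_vector_candidate_def)
  then have "1 \<le> k" by (cases k) (auto simp: word_power_def)
  then show ?thesis
    using v bracket_word_power[of u k Q] hom_power[OF hom_super_letter[of u Q], of k] by simp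
qed

text \<open>A word with the degree of the product that the list stands for.\<close>

definition total_word :: "(word \<times> nat) list \<Rightarrow> word" where
  "total_word vms = concat (map (\<lambda>(v, k). word_power v k) vms)"

definition factors_product :: "(letter \<Rightarrow> letter \<Rightarrow> 'k::field) \<Rightarrow> (word \<times> nat) list \<Rightarrow> 'k tensor_alg" where
  "factors_product Q vms = prod_list (rev (map (\<lambda>(v, m). bracket Q v ^ m) vms))"

lemma hom_factors_product:
  assumes "\<And>v k. (v, k) \<in> set vms \<Longrightarrow> root_vector_candidate Q v"
  shows "hom (deg (total_word vms)) (factors_product Q vms)"
  using assms
proof (induction vms)
  case Nil
  show ?case by (simp add: total_word_def factors_product_def hom_one)
next
  case (Cons p vms)
  obtain v k where p: "p = (v, k)" by force
  have "hom (deg (total_word vms) + deg (word_power v k)) (factors_product Q vms * bracket Q v ^ k)"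
    using Cons by (intro hom_mult hom_power hom_bracket) (auto simp: p)
  then show ?case by (simp add: p total_word_def factors_product_def deg_append add.commute)
qed

lemma larger_products_alt:
  "larger_products Q w = {factors_product Q vms | vms.
     (\<forall>(v, m)\<in>set vms. root_vector_candidate Q v \<and> 0 < m) \<and> sorted_wrt (<\<^sub>l\<^sub>e\<^sub>x) (w # map fst vms)}"
  by (simp add: larger_products_def factors_product_def)

context rank_two
begin

lemma deg_block: "deg (block a) = (int a, 1)"
  by (simp add: deg_eq_count count_block)

lemma deg_block_block: "deg (block a @ block b) = (int (a + b), 2)"
  by (simp add: deg_append deg_block)

lemma super_letter_block: "super_letter Q (block a) = u a"
proof (induction a)
  case 0
  show ?case by (simp add: block_simps super_letter_letter)
next
  case (Suc a)
  have "\<exists>n. lyndon_split (X1 # block a) n" using split_X1[OF lyndon_block] by blast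
  then show ?case
    using chi_1[of a 1]
    by (subst super_letter.simps)
      (simp add: block_simps shirshov_X1[OF lyndon_block] super_letter_letter Suc deg_letters deg_block del: deg.simps)
qed

text \<open>The coefficient of \<open>u\<^sub>bu\<^sub>a\<close> in the bracket of
\<open>x\<^sub>1\<^sup>ax\<^sub>2x\<^sub>1\<^sup>bx\<^sub>2\<close>. It is also the ratio in
\<open>relation_ends\<close>.\<close>

definition kappa :: "nat \<Rightarrow> nat \<Rightarrow> 'k" where
  "kappa a b = - (q21 ^ b * s * (q ^ b * q12) ^ a)"

text \<open>The Shirshov decompositions show that this super-letter is \<open>(ad
x\<^sub>1)\<^bsup>a-b-1\<^esup>\<close> applied to the braided commutator of
\<open>u\<^bsub>b+1\<^esub>\<close> and \<open>u\<^sub>b\<close>.\<close>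

lemma super_letter_block_block:
  assumes "b < a"
  shows "\<exists>f. super_letter Q (block a @ block b) = Phi (a + b) f \<and> (\<forall>k. a < k \<longrightarrow> f k = 0) \<and> (\<forall>k<b. f k = 0) \<and>
    f a = 1 \<and> f b = kappa a b"
  using Suc_leI[OF assms]
proof (induction a rule: dec_induct)
  case base
  define f where "f i = \<delta> (Suc b) i + kappa (Suc b) b * \<delta> b i" for i
  have "\<exists>n. lyndon_split (block (Suc b) @ block b) n" using split_consecutive by blast
  then have "super_letter Q (block (Suc b) @ block b) = u (Suc b) * u b -
      scale (chi (int (Suc b), 1) (int b, 1)) (u b * u (Suc b))"
    by (subst super_letter.simps) (simp add: shirshov_consecutive super_letter_block deg_block del: u.simps)
  also have "chi (int (Suc b), 1) (int b, 1) = - kappa (Suc b) b"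
    using chi_nat[of "Suc b" 1 b 1]
    by (simp add: kappa_def power_mult_distrib power_mult[symmetric] power_add mult_ac)
  also have "u (Suc b) * u b - scale (- kappa (Suc b) b) (u b * u (Suc b)) = Phi (Suc b + b) f"
  proof -
    have "Phi (Suc b + b) f = Phi (Suc b + b) (\<delta> (Suc b)) + scale (kappa (Suc b) b) (Phi (Suc b + b) (\<delta> b))"
      by (simp add: Phi_def f_def pm.scale_left_distrib sum.distrib pm.scale_sum_right del: u.simps sum.atMost_Suc add_Suc)
    also have "\<dots> = u (Suc b) * u b + scale (kappa (Suc b) b) (u b * u (Suc b))"
      using Phi_delta[of "Suc b" "Suc b + b"] Phi_delta[of b "Suc b + b"] by (simp del: u.simps)
    finally show ?thesis by (simp del: u.simps)
  qed
  finally have "super_letter Q (block (Suc b) @ block b) = Phi (Suc b + b) f" .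
  moreover have "\<forall>k. Suc b < k \<longrightarrow> f k = 0" "\<forall>k<b. f k = 0" "f (Suc b) = 1" "f b = kappa (Suc b) b"
    by (auto simp: f_def \<delta>_def)
  ultimately show ?case by blast
next
  case (step a)
  then obtain f where f: "super_letter Q (block a @ block b) = Phi (a + b) f"
    "\<forall>k. a < k \<longrightarrow> f k = 0" "\<forall>k<b. f k = 0" "f a = 1" "f b = kappa a b" by blast
  have ly: "lyndon (block a @ block b)" using step by (simp add: lyndon_block_block)
  have "\<exists>n. lyndon_split (X1 # block a @ block b) n" using split_X1[OF ly] by blast
  then have "super_letter Q (block (Suc a) @ block b) = x1 * Phi (a + b) f -
      scale (chi (1, 0) (int (a + b), 2)) (Phi (a + b) f * x1)"
    by (subst super_letter.simps)
      (simp add: block_simps shirshov_X1[OF ly] super_letter_letter f(1) deg_letters deg_block_block del: deg.simps of_nat_add)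
  also have "chi (1, 0) (int (a + b), 2) = q ^ (a + b) * q12 ^ 2"
    using chi_1[of "a + b" 2] by simp
  also have "x1 * Phi (a + b) f - scale (q ^ (a + b) * q12 ^ 2) (Phi (a + b) f * x1) = Phi (Suc (a + b)) (ad_op f)"
    using ad_Phi[of f "a + b"] f(2) by simp
  finally have "super_letter Q (block (Suc a) @ block b) = Phi (Suc a + b) (ad_op f)" by simp
  moreover have "\<forall>k. Suc a < k \<longrightarrow> ad_op f k = 0" using ad_op_supp[of a f] f(2) by blast
  moreover have "\<forall>k<b. ad_op f k = 0" using f(3) by (auto simp: ad_op_def split: nat.split)
  moreover have "ad_op f (Suc a) = 1" using f by (simp add: ad_op_def)
  moreover have "ad_op f b = kappa (Suc a) b"
    using f(3,5) by (cases b) (auto simp: ad_op_def kappa_def)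
  ultimately show ?case by blast
qed

lemma bracket_block_block:
  assumes "a \<le> m" "m \<le> 2 * a"
  shows "\<exists>f. bracket Q (block a @ block (m - a)) = Phi m f \<and> (\<forall>k. a < k \<longrightarrow> f k = 0) \<and> (\<forall>k<m - a. f k = 0) \<and>
    f a = 1 \<and> (a \<noteq> m - a \<longrightarrow> f (m - a) = kappa a (m - a))"
proof (cases "m - a < a")
  case True
  have "bracket Q (block a @ block (m - a)) = super_letter Q (block a @ block (m - a))"
    using True by (intro bracket_lyndon) (simp add: lyndon_block_block)
  then show ?thesis using super_letter_block_block[OF True] assms by auto
next
  case False
  then have a: "m - a = a" using assms by simp
  have "bracket Q (block a @ block (m - a)) = u a * u (m - a)"
    unfolding a bracket_square super_letter_block power2_eq_square ..
  also have "\<dots> = Phi m (\<delta> a)" by (rule Phi_delta[symmetric, OF assms(1)])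
  finally show ?thesis by (intro exI[of _ "\<delta> a"]) (simp add: a \<delta>_def)
qed

text \<open>By \<open>proj_span_larger_products\<close> and \<open>inner_subset_span\<close>, these
are the combinations of products larger than
\<open>x\<^sub>1\<^sup>ax\<^sub>2x\<^sub>1\<^bsup>m-a\<^esup>x\<^sub>2\<close> in degree
\<open>m\<alpha>\<^sub>1 + 2\<alpha>\<^sub>2\<close>.\<close>

definition inner :: "nat \<Rightarrow> 'k tensor_alg set" where
  "inner a = {Phi m f | f. \<forall>k. f k \<noteq> 0 \<longrightarrow> m - a < k \<and> k < a}"

lemma subspace_inner: "pm.subspace (inner a)"
proof (rule pm.subspaceI)
  show "0 \<in> inner a" unfolding inner_def
    by (rule CollectI, rule exI[of _ "\<lambda>_. 0"]) (simp add: Phi_def)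
next
  fix x y assume "x \<in> inner a" "y \<in> inner a"
  then obtain f g where f: "x = Phi m f" "\<forall>k. f k \<noteq> 0 \<longrightarrow> m - a < k \<and> k < a"
    and g: "y = Phi m g" "\<forall>k. g k \<noteq> 0 \<longrightarrow> m - a < k \<and> k < a" by (auto simp: inner_def)
  have "x + y = Phi m (\<lambda>i. f i + g i)"
    by (simp add: f g Phi_def pm.scale_left_distrib sum.distrib)
  moreover have "\<forall>k. f k + g k \<noteq> 0 \<longrightarrow> m - a < k \<and> k < a" using f(2) g(2) by (metis add_0)
  ultimately show "x + y \<in> inner a" unfolding inner_def by blast
next
  fix c x assume "x \<in> inner a"
  then obtain f where f: "x = Phi m f" "\<forall>k. f k \<noteq> 0 \<longrightarrow> m - a < k \<and> k < a" by (auto simp: inner_def)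
  have "scale c x = Phi m (\<lambda>i. c * f i)" by (simp add: f Phi_def pm.scale_sum_right)
  moreover have "\<forall>k. c * f k \<noteq> 0 \<longrightarrow> m - a < k \<and> k < a" using f(2) by auto
  ultimately show "scale c x \<in> inner a" unfolding inner_def by blast
qed

lemma product_in_inner:
  assumes "i + j = m" "i < a" "j < a" "a \<le> m"
  shows "u i * u j \<in> inner a"
proof -
  have "u i * u j = Phi m (\<delta> i)" using Phi_delta[of i m] assms(1) by force
  moreover have "\<forall>k. \<delta> i k \<noteq> 0 \<longrightarrow> m - a < k \<and> k < a" using assms by (auto simp: \<delta>_def)
  ultimately show ?thesis unfolding inner_def by blast
qed

text \<open>A word larger than
\<open>x\<^sub>1\<^sup>ax\<^sub>2x\<^sub>1\<^bsup>m-a\<^esup>x\<^sub>2\<close> contains the letter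
\<open>x\<^sub>2\<close>. So the product is the bracket of a single word with two letters
\<open>x\<^sub>2\<close>, the square of some \<open>u\<^sub>c\<close>, or a product
\<open>u\<^sub>du\<^sub>c\<close>, and the indices that occur are less than
\<open>a\<close>.\<close>

lemma factors_product_in_inner:
  assumes a: "a \<le> m" "m \<le> 2 * a"
    and cand: "\<And>v k. (v, k) \<in> set vms \<Longrightarrow> root_vector_candidate Q v \<and> 0 < k"
    and sorted: "sorted_wrt (<\<^sub>l\<^sub>e\<^sub>x) ((block a @ block (m - a)) # map fst vms)"
    and deg: "deg (total_word vms) = (int m, 2)"
  shows "factors_product Q vms \<in> inner a"
proof -
  have larger: "block a @ block (m - a) <\<^sub>l\<^sub>e\<^sub>x v" if "(v, k) \<in> set vms" for v k
    using sorted that by force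
  have cnt: "count_list (total_word vms) X2 = 2" "count_list (total_word vms) X1 = m"
    using deg by (simp_all add: deg_eq_count)
  have pos: "1 \<le> k * count_list v X2" if "(v, k) \<in> set vms" for v k
  proof -
    have "count_list v X2 \<noteq> 0"
    proof
      assume "count_list v X2 = 0"
      then have "v = replicate (length v) X1" by (rule no_X2)
      then show False using larger[OF that] block_append_not_less_replicate by metis
    qed
    then show ?thesis using cand[OF that] by simp
  qed
  have one: "\<exists>c. v = block c \<and> c < a" if "(v, k) \<in> set vms" "count_list v X2 = 1" for v k
  proof -
    have "v = block (count_list v X1)" using candidate_one_X2[OF _ that(2)] cand[OF that(1)] by blast
    then show ?thesis using larger[OF that(1)] block_append_less_block by metis
  qed
  obtain v k vms' where vms: "vms = (v, k) # vms'"
    using cnt(1) by (cases vms) (auto simp: total_word_def)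
  have v: "(v, k) \<in> set vms" by (simp add: vms)
  have tw: "total_word vms = word_power v k @ total_word vms'" by (simp add: vms total_word_def)
  show ?thesis
  proof (cases vms')
    case Nil
    have c: "k * count_list v X2 = 2" "k * count_list v X1 = m"
      using cnt unfolding tw Nil by (simp_all add: total_word_def count_word_power)
    have P: "factors_product Q vms = bracket Q v ^ k" by (simp add: vms Nil factors_product_def)
    have "k dvd 2" using c(1) by (metis dvd_triv_left)
    then have "k \<le> 2" by (rule dvd_imp_le) simp
    then consider "k = 1" | "k = 2" using cand[OF v] by linarith
    then show ?thesis
    proof cases
      case 1
      obtain a' b' where ab: "v = block a' @ block b'" "b' \<le> a'"
        using candidate_two_X2[of Q v] cand[OF v] c 1 by auto
      then have m: "a' + b' = m" using c(2) 1 by (simp add: count_block)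
      have "block a @ block (m - a) <\<^sub>l\<^sub>e\<^sub>x block a' @ block b'" using larger[OF v] ab by simp
      then have "a' < a" using m lex_less_irrefl by (auto simp: block_append_less)
      moreover have "m - a' = b'" using m by simp
      moreover obtain f where "bracket Q (block a' @ block (m - a')) = Phi m f"
        "\<forall>k. a' < k \<longrightarrow> f k = 0" "\<forall>k<m - a'. f k = 0"
        using bracket_block_block[of a'] m ab(2) by auto
      ultimately have "factors_product Q vms = Phi m f" "\<forall>k. f k \<noteq> 0 \<longrightarrow> m - a < k \<and> k < a"
        using a m by (simp_all add: P 1 ab(1)) (metis diff_less_mono2 le_add1 less_le_trans not_le order_le_less_trans)
      then show ?thesis unfolding inner_def by blast
    next
      case 2
      then obtain c' where c': "v = block c'" "c' < a" using one[OF v] c(1) by auto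
      then have "c' + c' = m" using c(2) 2 by (simp add: count_block)
      moreover have "factors_product Q vms = u c' * u c'"
        using P 2 c'(1) by (simp add: bracket_lyndon[OF lyndon_block] super_letter_block power2_eq_square)
      ultimately show ?thesis using product_in_inner[of c' c' a] c'(2) a(1) by simp
    qed
  next
    case (Cons p vms'')
    obtain v' k' where p: "p = (v', k')" by force
    have v': "(v', k') \<in> set vms" by (simp add: vms Cons p)
    have tw': "total_word vms = word_power v k @ word_power v' k' @ total_word vms''"
      by (simp add: vms Cons p total_word_def)
    have c: "k * count_list v X2 + k' * count_list v' X2 + count_list (total_word vms'') X2 = 2"
      using cnt by (simp add: tw' count_word_power)
    have k: "k * count_list v X2 = 1" "k' * count_list v' X2 = 1" "count_list (total_word vms'') X2 = 0"
      using c pos[OF v] pos[OF v'] by linarith+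
    have "vms'' = []"
    proof (cases vms'')
      case (Cons p' l)
      obtain v'' k'' where p': "p' = (v'', k'')" by force
      have "1 \<le> k'' * count_list v'' X2" by (rule pos) (simp add: vms \<open>vms' = p # vms''\<close> Cons p')
      then have False using k(3) by (simp add: Cons p' total_word_def count_word_power)
      then show ?thesis ..
    qed simp
    have kk: "k = 1" "count_list v X2 = 1" "k' = 1" "count_list v' X2 = 1" using k by simp_all
    obtain c where c: "v = block c" "c < a" using one[OF v kk(2)] by blast
    obtain d where d: "v' = block d" "d < a" using one[OF v' kk(4)] by blast
    have "c + d = m" using cnt(2) by (simp add: tw' \<open>vms'' = []\<close> kk c d count_word_power count_block) (simp add: total_word_def)
    moreover have "factors_product Q vms = u d * u c"
      by (simp add: vms Cons p \<open>vms'' = []\<close> kk c d factors_product_def bracket_lyndon[OF lyndon_block] super_letter_block)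
    ultimately show ?thesis using product_in_inner[of d c a] c(2) d(2) a(1) by simp
  qed
qed

text \<open>All products of brackets are homogeneous, so the projection keeps those of degree
\<open>m\<alpha>\<^sub>1 + 2\<alpha>\<^sub>2\<close> and kills the others.\<close>

lemma proj_span_larger_products:
  assumes a: "a \<le> m" "m \<le> 2 * a" and y: "y \<in> pm.span (larger_products Q (block a @ block (m - a)))"
  shows "proj (int m, 2) y \<in> inner a"
  using y
proof (induction rule: pm.span_induct)
  case base
  show ?case
    by (rule pm.subspaceI)
      (auto simp: module_hom.zero[OF lin_proj] module_hom.add[OF lin_proj] module_hom.scale[OF lin_proj]
        pm.subspace_0[OF subspace_inner] pm.subspace_add[OF subspace_inner] pm.subspace_scale[OF subspace_inner])
next
  case (step y)
  then obtain vms where vms: "y = factors_product Q vms"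
    "\<And>v k. (v, k) \<in> set vms \<Longrightarrow> root_vector_candidate Q v \<and> 0 < k"
    "sorted_wrt (<\<^sub>l\<^sub>e\<^sub>x) ((block a @ block (m - a)) # map fst vms)"
    unfolding larger_products_alt by blast
  have h: "hom (deg (total_word vms)) y"
    unfolding vms(1) using vms(2) by (intro hom_factors_product) blast
  show ?case
  proof (cases "deg (total_word vms) = (int m, 2)")
    case True
    then have "proj (int m, 2) y = y" using h proj_hom by metis
    then show ?thesis using factors_product_in_inner[OF a vms(2,3) True] vms(1) by simp
  next
    case False
    then show ?thesis using proj_hom_other[OF h] pm.subspace_0[OF subspace_inner] by simp
  qed
qed

text \<open>For \<open>i \<le> m - i\<close> the product is itself one of the larger products.
Otherwise the bracket of
\<open>x\<^sub>1\<^sup>ix\<^sub>2x\<^sub>1\<^bsup>m-i\<^esup>x\<^sub>2\<close> is available, which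
is \<open>u\<^sub>iu\<^bsub>m-i\<^esub>\<close> up to products with smaller first index.\<close>

lemma product_in_span:
  assumes a: "a \<le> m" "m \<le> 2 * a" and i: "m - a < i" "i < a" "i \<le> m"
  shows "u i * u (m - i) \<in> pm.span (larger_products Q (block a @ block (m - a)))"
  using i
proof (induction i rule: less_induct)
  case (less i)
  let ?S = "larger_products Q (block a @ block (m - a))"
  have j: "m - i < a" using less.prems a by simp
  consider "i < m - i" | "i = m - i" | "m - i < i" by linarith
  then show ?case
  proof cases
    case 1
    have "factors_product Q [(block (m - i), 1), (block i, 1)] = u i * u (m - i)"
      by (simp add: factors_product_def bracket_lyndon[OF lyndon_block] super_letter_block)
    moreover have "factors_product Q [(block (m - i), 1), (block i, 1)] \<in> ?S"
      unfolding larger_products_alt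
      by (rule CollectI, rule exI[of _ "[(block (m - i), 1), (block i, 1)]"])
        (use 1 j less.prems in \<open>simp add: candidate_block block_append_less_block block_less_block\<close>)
    ultimately show ?thesis by (simp add: pm.span_base)
  next
    case 2
    have "factors_product Q [(block i, 2)] = u i * u (m - i)"
      using 2 by (simp add: factors_product_def bracket_lyndon[OF lyndon_block] super_letter_block power2_eq_square)
    moreover have "factors_product Q [(block i, 2)] \<in> ?S"
      unfolding larger_products_alt
      by (rule CollectI, rule exI[of _ "[(block i, 2)]"])
        (use less.prems in \<open>simp add: candidate_block block_append_less_block\<close>)
    ultimately show ?thesis by (simp add: pm.span_base)
  next
    case 3
    obtain f where f: "bracket Q (block i @ block (m - i)) = Phi m f" "\<forall>k. i < k \<longrightarrow> f k = 0"
      "\<forall>k<m - i. f k = 0" "f i = 1"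
    proof -
      have "m \<le> 2 * i" using 3 by simp
      then show thesis using bracket_block_block[OF less.prems(3)] that by blast
    qed
    have "factors_product Q [(block i @ block (m - i), 1)] \<in> ?S"
      unfolding larger_products_alt
      by (rule CollectI, rule exI[of _ "[(block i @ block (m - i), 1)]"])
        (use 3 less.prems in \<open>simp add: candidate_block_block block_append_less\<close>)
    then have b: "Phi m f \<in> pm.span ?S" using f(1) by (simp add: factors_product_def pm.span_base)
    have "Phi m f = u i * u (m - i) + (\<Sum>k\<in>{..m} - {i}. scale (f k) (u k * u (m - k)))"
      unfolding Phi_def using less.prems by (subst sum.remove[of _ i]) (simp_all add: f(4))
    moreover have "(\<Sum>k\<in>{..m} - {i}. scale (f k) (u k * u (m - k))) \<in> pm.span ?S"
    proof (rule pm.span_sum)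
      fix k assume k: "k \<in> {..m} - {i}"
      show "scale (f k) (u k * u (m - k)) \<in> pm.span ?S"
      proof (cases "f k = 0")
        case False
        then have "m - i \<le> k" "k \<le> i" using f(2,3) by (auto simp: not_less[symmetric])
        then have "m - a < k" "k < i" "k < a" "k \<le> m" using k less.prems a by auto
        then show ?thesis using less.IH[of k] by (intro pm.span_scale) blast
      qed (simp add: pm.span_zero)
    qed
    ultimately have "u i * u (m - i) = Phi m f - (\<Sum>k\<in>{..m} - {i}. scale (f k) (u k * u (m - k)))"
      by simp
    then show ?thesis using b \<open>(\<Sum>k\<in>{..m} - {i}. scale (f k) (u k * u (m - k))) \<in> pm.span ?S\<close>
      by (simp add: pm.span_diff)
  qed
qed

lemma inner_subset_span:
  assumes a: "a \<le> m" "m \<le> 2 * a"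
  shows "inner a \<subseteq> pm.span (larger_products Q (block a @ block (m - a)))"
proof
  fix x assume "x \<in> inner a"
  then obtain f where f: "x = Phi m f" "\<forall>k. f k \<noteq> 0 \<longrightarrow> m - a < k \<and> k < a" by (auto simp: inner_def)
  show "x \<in> pm.span (larger_products Q (block a @ block (m - a)))"
    unfolding f(1) Phi_def
  proof (rule pm.span_sum)
    fix k assume "k \<in> {..m}"
    then show "scale (f k) (u k * u (m - k)) \<in> pm.span (larger_products Q (block a @ block (m - a)))"
      using product_in_span[OF a, of k] f(2) by (cases "f k = 0") (auto simp: pm.span_zero intro: pm.span_scale)
  qed
qed

lemma Phi_diff: "Phi n (\<lambda>i. f i - g i) = Phi n f - Phi n g"
  by (simp add: Phi_def pm.scale_left_diff_distrib sum_subtractf)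

text \<open>A linear combination of larger products that equals the bracket gives a relation with
leading index \<open>a\<close>. Conversely, scale a relation with leading index \<open>a\<close> so
that its coefficient there is 1. By \<open>relation_ends\<close> it agrees with the bracket in place
\<open>m - a\<close> as well, so the difference lies in \<open>inner a\<close>.\<close>

lemma lin_comb_iff_leading:
  assumes a: "a \<le> m" "m \<le> 2 * a"
  shows "nichols_lin_comb Q (larger_products Q (block a @ block (m - a))) (bracket Q (block a @ block (m - a))) \<longleftrightarrow> a \<in> leading"
proof -
  define w where "w = block a @ block (m - a)"
  obtain f where f: "bracket Q w = Phi m f" "\<forall>k. a < k \<longrightarrow> f k = 0" "\<forall>k<m - a. f k = 0"
    "f a = 1" "a \<noteq> m - a \<longrightarrow> f (m - a) = kappa a (m - a)"
    using bracket_block_block[OF a] unfolding w_def by blast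
  show ?thesis unfolding w_def[symmetric]
  proof
    assume "nichols_lin_comb Q (larger_products Q w) (bracket Q w)"
    then obtain y where y: "y \<in> pm.span (larger_products Q w)" "bracket Q w - y \<in> nichols_ideal Q"
      by (auto simp: nichols_lin_comb_def)
    have "proj (int m, 2) y \<in> inner a" using proj_span_larger_products[OF a] y(1) by (simp add: w_def)
    then obtain g where g: "proj (int m, 2) y = Phi m g" "\<forall>k. g k \<noteq> 0 \<longrightarrow> m - a < k \<and> k < a"
      by (auto simp: inner_def)
    have "proj (int m, 2) (bracket Q w - y) \<in> radical"
      using y(2) nichols_ideal_subset_radical proj_radical by blast
    moreover have "proj (int m, 2) (bracket Q w - y) = Phi m (\<lambda>i. f i - g i)"
      by (simp add: module_hom.diff[OF lin_proj] g(1) f(1) proj_hom[OF hom_Phi] Phi_diff)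
    moreover have "f k - g k = 0" if "a < k" for k using f(2) g(2) that by (metis diff_self less_asym)
    moreover have "f a - g a = 1" using f(4) g(2) by (metis diff_zero less_irrefl)
    ultimately show "a \<in> leading"
      unfolding leading_def relations_def using a
      by (intro CollectI conjI bexI[of _ "\<lambda>i. f i - g i"]) auto
  next
    assume "a \<in> leading"
    then obtain g where g: "\<And>i. m < i \<Longrightarrow> g i = 0" "Phi m g \<in> radical" "g a \<noteq> 0" "\<And>k. a < k \<Longrightarrow> g k = 0"
      by (auto simp: leading_def relations_def)
    define h where "h i = inverse (g a) * g i" for i
    have "Phi m h = scale (inverse (g a)) (Phi m g)"
      by (simp add: h_def Phi_def pm.scale_sum_right)
    then have hn: "Phi m h \<in> radical" using g(2) pm.subspace_scale[OF subspace_radical] by simp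
    have h: "h a = 1" "\<And>k. a < k \<Longrightarrow> h k = 0" "\<And>k. m < k \<Longrightarrow> h k = 0" using g by (auto simp: h_def)
    have low: "h k = 0" if "k < m - a" for k
      using relation_support[OF hn a h(2)] that by blast
    have fin: "h (m - a) = kappa a (m - a)" if "a \<noteq> m - a"
      using relation_ends(2)[OF hn a h(2) low] that h(1) by (simp add: kappa_def)
    have "f k - h k = 0" if k: "\<not> (m - a < k \<and> k < a)" for k
    proof -
      consider "k < m - a" | "a < k" | "k = a" | "k = m - a" "a \<noteq> m - a" using k
        by (cases k a rule: linorder_cases; cases k "m - a" rule: linorder_cases) auto
      then show ?thesis by cases (use f h low fin in auto)
    qed
    then have "Phi m (\<lambda>i. f i - h i) \<in> inner a" unfolding inner_def by blast
    then have "Phi m f - Phi m h \<in> pm.span (larger_products Q w)"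
      using inner_subset_span[OF a] by (auto simp: Phi_diff w_def)
    moreover have "bracket Q w - (Phi m f - Phi m h) \<in> nichols_ideal Q"
      using relation_iff(2)[of h] h(3) hn f(1) by simp
    ultimately show "nichols_lin_comb Q (larger_products Q w) (bracket Q w)"
      unfolding nichols_lin_comb_def by blast
  qed
qed

text \<open>The indices \<open>a\<close> for which
\<open>x\<^sub>1\<^sup>ax\<^sub>2x\<^sub>1\<^bsup>m-a\<^esup>x\<^sub>2\<close> is a root vector
candidate (\<open>candidate_iff\<close>).\<close>

definition candidates :: "nat set" where
  "candidates = {a. a \<le> m \<and> m \<le> 2 * a \<and> (2 * a = m \<longrightarrow> q ^ (a * a) * r ^ a * s = -1)}"

lemma chi_block: "chi (deg (block a)) (deg (block a)) = q ^ (a * a) * r ^ a * s"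
  using chi_nat[of a 1 a 1] by (simp add: deg_block r_eq power_mult_distrib mult_ac)

lemma candidate_iff:
  assumes "a \<le> m" "m \<le> 2 * a"
  shows "root_vector_candidate Q (block a @ block (m - a)) \<longleftrightarrow> a \<in> candidates"
proof (cases "2 * a = m")
  case True
  then have "m - a = a" by simp
  then show ?thesis using assms True
    by (simp add: candidate_square two_in_root_orders chi_block candidates_def)
next
  case False
  then have "m - a < a" using assms by simp
  then have "root_vector_candidate Q (block a @ block (m - a))" by (rule candidate_block_block)
  then show ?thesis using assms False by (simp add: candidates_def)
qed

text \<open>A relation with leading index \<open>m/2\<close> says that
\<open>u\<^bsub>m/2\<^esub>\<^sup>2 = 0\<close>, which by \<open>relation_ends\<close> is only
possible if the square is a candidate.\<close>

lemma leading_subset_candidates: "leading \<subseteq> candidates"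
proof
  fix a assume "a \<in> leading"
  then obtain g where a: "a \<le> m" "m \<le> 2 * a"
    and g: "Phi m g \<in> radical" "g a \<noteq> 0" "\<And>k. a < k \<Longrightarrow> g k = 0"
    by (auto simp: leading_def relations_def)
  have "q ^ (a * a) * r ^ a * s = -1" if "2 * a = m"
  proof -
    have "g a * (1 + q21 ^ a * s * (q ^ a * q12) ^ a) = 0"
      using relation_ends(1)[OF g(1) a g(3) relation_support[OF g(1) a g(3)]] that by simp
    then have "1 + q21 ^ a * s * (q ^ a * q12) ^ a = 0" using g(2) by simp
    then have "q21 ^ a * s * (q ^ a * q12) ^ a = -1" by (metis add.commute add_eq_0_iff)
    then show ?thesis
      by (simp add: r_eq power_mult_distrib mult_ac flip: power_mult)
  qed
  then show "a \<in> candidates" using a by (simp add: candidates_def)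
qed

lemma root_vectors_of_degree:
  "{w. deg w = (int m, 2) \<and> root_vector Q w} = (\<lambda>a. block a @ block (m - a)) ` (candidates - leading)"
proof (intro antisym subsetI)
  fix w assume "w \<in> {w. deg w = (int m, 2) \<and> root_vector Q w}"
  then have w: "deg w = (int m, 2)" "root_vector Q w" by auto
  then have c: "root_vector_candidate Q w" by (simp add: root_vector_def)
  have cnt: "count_list w X2 = 2" "count_list w X1 = m" using w(1) by (simp_all add: deg_eq_count)
  obtain a b where ab: "w = block a @ block b" "b \<le> a" using candidate_two_X2[OF c cnt(1)] by blast
  then have m: "a + b = m" using cnt(2) by (simp add: count_block)
  then have a: "a \<le> m" "m \<le> 2 * a" "w = block a @ block (m - a)" using ab by auto
  have "a \<in> candidates" using c candidate_iff[OF a(1,2)] a(3) by simp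
  moreover have "a \<notin> leading" using w(2) lin_comb_iff_leading[OF a(1,2)] a(3) by (simp add: root_vector_def)
  ultimately show "w \<in> (\<lambda>a. block a @ block (m - a)) ` (candidates - leading)" using a(3) by blast
next
  fix w assume "w \<in> (\<lambda>a. block a @ block (m - a)) ` (candidates - leading)"
  then obtain a where a: "a \<in> candidates" "a \<notin> leading" "w = block a @ block (m - a)" by blast
  then have "a \<le> m" "m \<le> 2 * a" by (auto simp: candidates_def)
  then show "w \<in> {w. deg w = (int m, 2) \<and> root_vector Q w}"
    using a candidate_iff[of a] lin_comb_iff_leading[of a] by (simp add: root_vector_def deg_block_block)
qed

lemma finite_candidates: "finite candidates"
  by (rule finite_subset[of _ "{..m}"]) (auto simp: candidates_def)

lemma multiplicity_eq:
  "int (multiplicity Q (int m, 2)) = int (card candidates) - int (card (J_set q r s \<inter> {0..m}))"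
proof -
  have "inj_on (\<lambda>a. block a @ block (m - a)) (candidates - leading)"
  proof (rule inj_onI)
    fix a a' assume "block a @ block (m - a) = block a' @ block (m - a')"
    then have "\<not> a' < a" "\<not> a < a'" using block_append_less lex_less_irrefl by metis+
    then show "a = a'" by simp
  qed
  then have "multiplicity Q (int m, 2) = card (candidates - leading)"
    unfolding multiplicity_def root_vectors_of_degree by (rule card_image)
  also have "\<dots> = card candidates - card leading"
    using leading_subset_candidates finite_candidates finite_subset by (intro card_Diff_subset) auto
  finally show ?thesis
    using card_mono[OF finite_candidates leading_subset_candidates] card_leading by simp
qed

lemma card_candidates:
  "card candidates = (if odd m then (m + 1) div 2
    else if q ^ (m\<^sup>2 div 4) * r ^ (m div 2) * s \<noteq> -1 then m div 2 else m div 2 + 1)"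
proof (cases "odd m")
  case True
  then obtain l where l: "m = 2 * l + 1" by (elim oddE)
  have "m \<le> 2 * a \<longleftrightarrow> l + 1 \<le> a" "2 * a \<noteq> m" for a using l by presburger+
  then have "candidates = {l + 1..m}" unfolding candidates_def by auto
  then show ?thesis by (simp add: l)
next
  case False
  then obtain l where l: "m = 2 * l" by (auto elim: evenE)
  have c: "m \<le> 2 * a \<longleftrightarrow> l \<le> a" "2 * a = m \<longleftrightarrow> a = l" for a using l by auto
  have e: "m\<^sup>2 div 4 = l * l" by (simp add: l power2_eq_square)
  show ?thesis
  proof (cases "q ^ (l * l) * r ^ l * s = -1")
    case True
    then have "candidates = {l..m}" unfolding candidates_def c by auto
    then show ?thesis using False e True by (simp add: l)
  next
    case nt: False
    then have "candidates = {l + 1..m}" unfolding candidates_def c by (auto simp: Suc_le_eq le_less)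
    then show ?thesis using False e nt by (simp add: l)
  qed
qed

end

theorem corollary3p23:
  fixes Q :: "letter \<Rightarrow> letter \<Rightarrow> 'k::field"
    and q r s :: 'k
    and m m' :: nat
  assumes "\<And>i j. Q i j \<noteq> 0"
    and "q = Q X1 X1" and "r = Q X1 X2 * Q X2 X1" and "s = Q X2 X2"
    and "qfact m q * bprod q r m \<noteq> 0"
    and "m' = (if odd m then (m + 1) div 2
               else if q ^ (m\<^sup>2 div 4) * r ^ (m div 2) * s \<noteq> -1 then m div 2
               else m div 2 + 1)"
  shows "int (multiplicity Q (int m, 2)) = int m' - int (card (J_set q r s \<inter> {0..m}))"
proof -
  interpret rank_two Q q "Q X1 X2" "Q X2 X1" r s m
    using assms by unfold_locales auto
  show ?thesis
    using multiplicity_eq unfolding card_candidates assms(6) .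
qed

end
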